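(* Let $M$ be a connected manifold of dimension at least $2$, and let $F(x,\xi)=\sqrt{g(\xi,\xi)}+\omega(\xi)$ and $\bar F(x,\xi)=\sqrt{\bar g(\xi,\xi)}+\bar\omega(\xi)$ be two Randers metrics on $M$, where $g,\bar g$ are Riemannian metrics and $\omega,\bar\omega$ are $1$-forms on $M$. Suppose that $F$ and $\bar F$ are pointwise projectively related. Assume in addition that the set $M^0$ of the points of $M$ at which the differential $d\omega$ is not zero is connected. Then there exists a positive constant $c\in\mathbb{R}$ such that at least one of the following statements holds at all points of the manifold $M$: (1) $\bar g=c^2\cdot g$ and $\bar\omega-c\cdot\omega$ is a closed form; or (2) $\bar g=c^2\cdot g$ and $\bar\omega+c\cdot\omega$ is a closed form.
   Context: All objects considered (metrics, forms) are assumed to be at least $C^2$-smooth. A Randers metric on a manifold $M$ is a Finsler metric of the form $F(x,\xi)=\sqrt{g(x)_{ij}\xi^i\xi^j}+\omega(x)_i\xi^i=\sqrt{g(\xi,\xi)}+\omega(\xi)$, where $g$ is a Riemannian metric and $\omega$ is a $1$-form on $M$; that $F$ is a Finsler metric is equivalent to the $g$-norm of $\omega$ being less than one at every point. A forward (respectively backward) geodesic of a Finsler metric $F$ is a regular curve $x:I\to M$ ($I$ an interval) such that for any sufficiently close $a,b\in I$, $a\le b$, the restriction of $x$ to $[a,b]$ is an extremal of the functional $L^+_F(\gamma)=\int_a^b F(\gamma(t),\dot\gamma(t))\,dt$ (respectively $L^-_F(\gamma)=\int_a^b F(\gamma(t),-\dot\gamma(t))\,dt$) in the set of all smooth curves $\gamma:[a,b]\to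 M$ connecting $x(a)$ and $x(b)$. No preferred parameter is assumed: orientation-preserving reparameterizations of forward (backward) geodesics are again forward (backward) geodesics. The reverse curve $t\mapsto x(-t)$ of a forward geodesic is a backward geodesic, and vice versa. Two Finsler metrics $F$ and $\bar F$ on one manifold $M$ are pointwise projectively related if they have the same geodesics as point sets, i.e. the same geodesics when orientation is disregarded (so each forward geodesic of one metric is, after an orientation-preserving reparameterization, a forward or a backward geodesic of the other).
   Formalization: The set M^0 where dω is not zero is assumed to be nonempty as well as connected; for M^0 empty the claim fails (ω and ω̄ zero, g Euclidean on a ball, ḡ the Klein metric: same geodesics, but not homothetic). *)

theory Defs
  imports "HOL-Analysis.Analysis"
begin

text \<open>
  Smooth manifolds are Hausdorff second countable spaces with a smooth atlas modelled on a
  Euclidean space; a chart is a pair of its domain and its coordinate map. Metrics and forms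
  on a smooth manifold are \<open>C\<^sup>2\<close>.
\<close>

text \<open>
  Derivatives are taken within \<open>S\<close>, so that \<open>S\<close> may be an open set, an interval, or the
  product of an open and a closed interval. Since the domain is finite-dimensional, it is enough
  that every directional derivative be of class \<open>C\<^sup>k\<close>.
\<close>

primrec Ck_on :: "nat \<Rightarrow> ('e::euclidean_space \<Rightarrow> 'f::real_normed_vector) \<Rightarrow> 'e set \<Rightarrow> bool"
where
  "Ck_on 0 f S \<longleftrightarrow> continuous_on S f"
| "Ck_on (Suc k) f S \<longleftrightarrow>
     (\<exists>f'. (\<forall>x\<in>S. (f has_derivative f' x) (at x within S)) \<and> (\<forall>v. Ck_on k (\<lambda>x. f' x v) S))"

type_synonym ('a, 'e) chart = "'a set \<times> ('a \<Rightarrow> 'e)"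

definition chart_inv :: "('a, 'e) chart \<Rightarrow> 'e \<Rightarrow> 'a" where
  "chart_inv c = inv_into (fst c) (snd c)"

definition transition :: "('a, 'e) chart \<Rightarrow> ('a, 'e) chart \<Rightarrow> 'e \<Rightarrow> 'e" where
  "transition c d = snd d \<circ> chart_inv c"

definition smooth_manifold :: "'a topology \<Rightarrow> ('a, 'e::euclidean_space) chart set \<Rightarrow> bool" where
  "smooth_manifold X A \<longleftrightarrow>
     Hausdorff_space X \<and> second_countable X \<and>
     topspace X = (\<Union>c\<in>A. fst c) \<and>
     (\<forall>c\<in>A. openin X (fst c) \<and> open (snd c ` fst c) \<and>
        homeomorphic_map (subtopology X (fst c)) (top_of_set (snd c ` fst c)) (snd c)) \<and>
     (\<forall>c\<in>A. \<forall>d\<in>A. \<forall>k. Ck_on k (transition c d) (snd c ` (fst c \<inter> fst d)))"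

definition charts_at :: "('a, 'e) chart set \<Rightarrow> 'a \<Rightarrow> ('a, 'e) chart set" where
  "charts_at A p = {c \<in> A. p \<in> fst c}"

definition Ck_map ::
  "'a topology \<Rightarrow> ('a, 'e::euclidean_space) chart set \<Rightarrow> nat \<Rightarrow> 's::euclidean_space set \<Rightarrow>
    ('s \<Rightarrow> 'a) \<Rightarrow> bool" where
  "Ck_map X A k S f \<longleftrightarrow>
     continuous_map (top_of_set S) X f \<and>
     (\<forall>c\<in>A. Ck_on k (snd c \<circ> f) (S \<inter> f -` fst c))"

text \<open>
  A tangent vector at \<open>p\<close> is a family of coordinate vectors, one for each chart around \<open>p\<close>, which
  transforms by the derivatives of the transition maps. Its value at all other charts is \<open>0\<close> by
  convention, so that equality and negation of tangent vectors are those of functions.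
\<close>

type_synonym ('a, 'e) tvec = "('a, 'e) chart \<Rightarrow> 'e"

definition tangent_space ::
  "('a, 'e::euclidean_space) chart set \<Rightarrow> 'a \<Rightarrow> ('a, 'e) tvec set" where
  "tangent_space A p =
     {\<xi>. (\<forall>c. c \<notin> charts_at A p \<longrightarrow> \<xi> c = 0) \<and>
         (\<forall>c\<in>charts_at A p. \<forall>d\<in>charts_at A p.
            \<xi> d = frechet_derivative (transition c d) (at (snd c p)) (\<xi> c))}"

text \<open>The tangent vector at \<open>p\<close> whose coordinate vector in the chart \<open>c\<close> is \<open>v\<close>.\<close>

definition coord_tvec ::
  "('a, 'e::euclidean_space) chart set \<Rightarrow> ('a, 'e) chart \<Rightarrow> 'a \<Rightarrow> 'e \<Rightarrow> ('a, 'e) tvec" where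
  "coord_tvec A c p v =
     (\<lambda>d. if d \<in> charts_at A p then frechet_derivative (transition c d) (at (snd c p)) v else 0)"

definition velocity ::
  "('a, 'e::euclidean_space) chart set \<Rightarrow> real set \<Rightarrow> (real \<Rightarrow> 'a) \<Rightarrow> real \<Rightarrow> ('a, 'e) tvec" where
  "velocity A I x t =
     (\<lambda>c. if c \<in> charts_at A (x t) then vector_derivative (snd c \<circ> x) (at t within I) else 0)"

type_synonym ('a, 'e) field1 = "'a \<Rightarrow> ('a, 'e) tvec \<Rightarrow> real"
type_synonym ('a, 'e) field2 = "'a \<Rightarrow> ('a, 'e) tvec \<Rightarrow> ('a, 'e) tvec \<Rightarrow> real"

text \<open>Coordinate expressions in the chart \<open>c\<close>, at the point with coordinates \<open>u\<close>.\<close>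

definition local1 ::
  "('a, 'e::euclidean_space) chart set \<Rightarrow> ('a, 'e) chart \<Rightarrow> ('a, 'e) field1 \<Rightarrow> 'e \<Rightarrow> 'e \<Rightarrow> real"
where
  "local1 A c \<omega> u v = \<omega> (chart_inv c u) (coord_tvec A c (chart_inv c u) v)"

definition local2 ::
  "('a, 'e::euclidean_space) chart set \<Rightarrow> ('a, 'e) chart \<Rightarrow> ('a, 'e) field2 \<Rightarrow>
    'e \<Rightarrow> 'e \<Rightarrow> 'e \<Rightarrow> real" where
  "local2 A c g u v w =
     g (chart_inv c u) (coord_tvec A c (chart_inv c u) v) (coord_tvec A c (chart_inv c u) w)"

definition one_form :: "('a, 'e::euclidean_space) chart set \<Rightarrow> ('a, 'e) field1 \<Rightarrow> bool" where
  "one_form A \<omega> \<longleftrightarrow>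
     (\<forall>c\<in>A. (\<forall>u\<in>snd c ` fst c. linear (local1 A c \<omega> u)) \<and>
            (\<forall>v. Ck_on 2 (\<lambda>u. local1 A c \<omega> u v) (snd c ` fst c)))"

definition riemannian_metric :: "('a, 'e::euclidean_space) chart set \<Rightarrow> ('a, 'e) field2 \<Rightarrow> bool"
where
  "riemannian_metric A g \<longleftrightarrow>
     (\<forall>c\<in>A. (\<forall>u\<in>snd c ` fst c. bilinear (local2 A c g u) \<and>
               (\<forall>v w. local2 A c g u v w = local2 A c g u w v) \<and>
               (\<forall>v. v \<noteq> 0 \<longrightarrow> local2 A c g u v v > 0)) \<and>
            (\<forall>v w. Ck_on 2 (\<lambda>u. local2 A c g u v w) (snd c ` fst c)))"

text \<open>
  In coordinates, \<open>(d\<omega>)(v, w) = \<partial>\<^sub>v(\<omega>(w)) - \<partial>\<^sub>w(\<omega>(v))\<close> for constant vector fields \<open>v\<close>, \<open>w\<close>.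
  For a form \<open>\<omega>\<close> on a smooth manifold, and tangent vectors \<open>\<xi>\<close>, \<open>\<eta>\<close>, the value does not depend
  on the chart around \<open>p\<close>.
\<close>

definition ext_deriv ::
  "('a, 'e::euclidean_space) chart set \<Rightarrow> ('a, 'e) field1 \<Rightarrow> ('a, 'e) field2" where
  "ext_deriv A \<omega> p \<xi> \<eta> =
     (let c = (SOME c. c \<in> charts_at A p) in
        frechet_derivative (\<lambda>u. local1 A c \<omega> u (\<eta> c)) (at (snd c p)) (\<xi> c) -
        frechet_derivative (\<lambda>u. local1 A c \<omega> u (\<xi> c)) (at (snd c p)) (\<eta> c))"

definition nonclosed_locus ::
  "'a topology \<Rightarrow> ('a, 'e::euclidean_space) chart set \<Rightarrow> ('a, 'e) field1 \<Rightarrow> 'a set" where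
  "nonclosed_locus X A \<omega> =
     {p \<in> topspace X. \<exists>\<xi>\<in>tangent_space A p. \<exists>\<eta>\<in>tangent_space A p. ext_deriv A \<omega> p \<xi> \<eta> \<noteq> 0}"

definition closed_form ::
  "'a topology \<Rightarrow> ('a, 'e::euclidean_space) chart set \<Rightarrow> ('a, 'e) field1 \<Rightarrow> bool" where
  "closed_form X A \<omega> \<longleftrightarrow>
     (\<forall>p\<in>topspace X. \<forall>\<xi>\<in>tangent_space A p. \<forall>\<eta>\<in>tangent_space A p. ext_deriv A \<omega> p \<xi> \<eta> = 0)"

text \<open>
  The last condition says that the Hessian of \<open>F\<^sup>2/2\<close> in the direction variable is positive
  definite away from the zero section.
\<close>

definition finsler_metric :: "('a, 'e::euclidean_space) chart set \<Rightarrow> ('a, 'e) field1 \<Rightarrow> bool" where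
  "finsler_metric A F \<longleftrightarrow>
     (\<forall>c\<in>A.
        Ck_on 2 (\<lambda>(u, v). local1 A c F u v) ((snd c ` fst c) \<times> (- {0})) \<and>
        (\<forall>u\<in>snd c ` fst c.
           (\<forall>v. \<forall>r\<ge>0. local1 A c F u (r *\<^sub>R v) = r * local1 A c F u v) \<and>
           (\<forall>v. v \<noteq> 0 \<longrightarrow> local1 A c F u v > 0) \<and>
           (\<forall>v w. v \<noteq> 0 \<longrightarrow> w \<noteq> 0 \<longrightarrow>
              (deriv ^^ 2) (\<lambda>t. (local1 A c F u (v + t *\<^sub>R w))\<^sup>2 / 2) 0 > 0)))"

definition randers :: "('a, 'e) field2 \<Rightarrow> ('a, 'e) field1 \<Rightarrow> ('a, 'e) field1" where
  "randers g \<omega> p \<xi> = sqrt (g p \<xi> \<xi>) + \<omega> p \<xi>"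

definition length_fwd ::
  "('a, 'e::euclidean_space) chart set \<Rightarrow> ('a, 'e) field1 \<Rightarrow> real \<Rightarrow> real \<Rightarrow> (real \<Rightarrow> 'a) \<Rightarrow> real"
where
  "length_fwd A F a b \<gamma> = integral {a..b} (\<lambda>t. F (\<gamma> t) (velocity A {a..b} \<gamma> t))"

definition length_bwd ::
  "('a, 'e::euclidean_space) chart set \<Rightarrow> ('a, 'e) field1 \<Rightarrow> real \<Rightarrow> real \<Rightarrow> (real \<Rightarrow> 'a) \<Rightarrow> real"
where
  "length_bwd A F a b \<gamma> = integral {a..b} (\<lambda>t. F (\<gamma> t) (- velocity A {a..b} \<gamma> t))"

text \<open>
  An extremal of \<open>L\<close> is a curve at which the first variation of \<open>L\<close> vanishes for all
  variations with fixed endpoints. Curves and variations are of class \<open>C\<^sup>2\<close>: metrics are merely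
  \<open>C\<^sup>2\<close>, so geodesics need not be \<open>C\<^sup>\<infinity>\<close> in any parameter.
\<close>

definition variation ::
  "'a topology \<Rightarrow> ('a, 'e::euclidean_space) chart set \<Rightarrow> real \<Rightarrow> real \<Rightarrow> (real \<Rightarrow> 'a) \<Rightarrow>
    real \<Rightarrow> (real \<times> real \<Rightarrow> 'a) \<Rightarrow> bool" where
  "variation X A a b x \<epsilon> h \<longleftrightarrow>
     \<epsilon> > 0 \<and> Ck_map X A 2 ({-\<epsilon><..<\<epsilon>} \<times> {a..b}) h \<and>
     (\<forall>t\<in>{a..b}. h (0, t) = x t) \<and>
     (\<forall>s\<in>{-\<epsilon><..<\<epsilon>}. h (s, a) = x a \<and> h (s, b) = x b)"

definition extremal ::
  "'a topology \<Rightarrow> ('a, 'e::euclidean_space) chart set \<Rightarrow> (real \<Rightarrow> real \<Rightarrow> (real \<Rightarrow> 'a) \<Rightarrow> real) \<Rightarrow>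
    real \<Rightarrow> real \<Rightarrow> (real \<Rightarrow> 'a) \<Rightarrow> bool" where
  "extremal X A L a b x \<longleftrightarrow>
     (\<forall>\<epsilon> h. variation X A a b x \<epsilon> h \<longrightarrow>
        ((\<lambda>s. L a b (\<lambda>t. h (s, t))) has_real_derivative 0) (at 0))"

definition interval :: "real set \<Rightarrow> bool" where
  "interval I \<longleftrightarrow> is_interval I \<and> interior I \<noteq> {}"

definition regular_curve ::
  "'a topology \<Rightarrow> ('a, 'e::euclidean_space) chart set \<Rightarrow> real set \<Rightarrow> (real \<Rightarrow> 'a) \<Rightarrow> bool" where
  "regular_curve X A I x \<longleftrightarrow>
     interval I \<and> Ck_map X A 2 I x \<and> (\<forall>t\<in>I. velocity A I x t \<noteq> (\<lambda>_. 0))"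

definition locally_extremal ::
  "'a topology \<Rightarrow> ('a, 'e::euclidean_space) chart set \<Rightarrow> (real \<Rightarrow> real \<Rightarrow> (real \<Rightarrow> 'a) \<Rightarrow> real) \<Rightarrow>
    real set \<Rightarrow> (real \<Rightarrow> 'a) \<Rightarrow> bool" where
  "locally_extremal X A L I x \<longleftrightarrow>
     (\<forall>t\<in>I. \<exists>\<delta>>0. \<forall>a\<in>I \<inter> ball t \<delta>. \<forall>b\<in>I \<inter> ball t \<delta>. a \<le> b \<longrightarrow> extremal X A L a b x)"

definition forward_geodesic ::
  "'a topology \<Rightarrow> ('a, 'e::euclidean_space) chart set \<Rightarrow> ('a, 'e) field1 \<Rightarrow>
    real set \<Rightarrow> (real \<Rightarrow> 'a) \<Rightarrow> bool" where
  "forward_geodesic X A F I x \<longleftrightarrow>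
     regular_curve X A I x \<and> locally_extremal X A (length_fwd A F) I x"

definition backward_geodesic ::
  "'a topology \<Rightarrow> ('a, 'e::euclidean_space) chart set \<Rightarrow> ('a, 'e) field1 \<Rightarrow>
    real set \<Rightarrow> (real \<Rightarrow> 'a) \<Rightarrow> bool" where
  "backward_geodesic X A F I x \<longleftrightarrow>
     regular_curve X A I x \<and> locally_extremal X A (length_bwd A F) I x"

definition orientation_preserving_reparam :: "real set \<Rightarrow> real set \<Rightarrow> (real \<Rightarrow> real) \<Rightarrow> bool" where
  "orientation_preserving_reparam J I \<sigma> \<longleftrightarrow>
     interval J \<and> bij_betw \<sigma> J I \<and> Ck_on 2 \<sigma> J \<and>
     (\<forall>t\<in>J. vector_derivative \<sigma> (at t within J) > 0)"

text \<open>
  It suffices to consider forward geodesics, since backward geodesics are the forward ones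
  with the orientation reversed.
\<close>

definition geodesics_among ::
  "'a topology \<Rightarrow> ('a, 'e::euclidean_space) chart set \<Rightarrow> ('a, 'e) field1 \<Rightarrow> ('a, 'e) field1 \<Rightarrow> bool"
where
  "geodesics_among X A F F' \<longleftrightarrow>
     (\<forall>I x. forward_geodesic X A F I x \<longrightarrow>
        (\<exists>J \<sigma>. orientation_preserving_reparam J I \<sigma> \<and>
           (forward_geodesic X A F' J (x \<circ> \<sigma>) \<or> backward_geodesic X A F' J (x \<circ> \<sigma>))))"

definition pointwise_projectively_related ::
  "'a topology \<Rightarrow> ('a, 'e::euclidean_space) chart set \<Rightarrow> ('a, 'e) field1 \<Rightarrow> ('a, 'e) field1 \<Rightarrow> bool"
where
  "pointwise_projectively_related X A F F' \<longleftrightarrow>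
     geodesics_among X A F F' \<and> geodesics_among X A F' F"

end

theory Submission
  imports Defs "HOL-Complex_Analysis.Great_Picard" "HOL-Computational_Algebra.Fundamental_Theorem_Algebra"
begin

text \<open>
  In coordinates, let \<open>\<Gamma>\<close> be the Levi-Civita connection of \<open>g\<close>, let \<open>|v|\<close> be the norm of \<open>g\<close>, and
  let \<open>J\<close> be the endomorphism with \<open>g(J v, w) = d\<omega>(v, w)\<close>. The Euler-Lagrange equation of
  \<open>F = |\<cdot>| + \<omega>\<close> at a point of a curve with velocity \<open>v\<close> and acceleration \<open>a\<close> says that
  \<open>a + \<Gamma>(v, v) + |v| J v\<close> is a multiple of \<open>v\<close> (\<open>EL_zero_iff\<close>); for the backward length the sign of
  \<open>J\<close> is reversed. By Peano's theorem there is a geodesic of \<open>F\<close> in every direction \<open>\<xi>\<close>. If it is,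
  up to its parameter, a forward or a backward geodesic of \<open>F' = |\<cdot>|' + \<omega>'\<close>, then
  \<open>\<Gamma>'(\<xi>, \<xi>) - \<Gamma>(\<xi>, \<xi>) - |\<xi>| J \<xi> \<plusminus> |\<xi>|' J' \<xi>\<close> is a multiple of \<open>\<xi>\<close>
  (\<open>geodesics_among_pointwise\<close>). The signs are unknown, but the first difference is even in \<open>\<xi>\<close>
  and the other terms are odd. Comparing \<open>\<xi>\<close> with \<open>-\<xi>\<close>, for both orders of the two metrics,
  separates the parts (\<open>even_odd_separation\<close>): \<open>\<Gamma>'(\<xi>, \<xi>) - \<Gamma>(\<xi>, \<xi>)\<close> is a multiple of \<open>\<xi>\<close>, so
  \<open>g\<close> and \<open>g'\<close> are projectively equivalent, and \<open>|\<xi>| J \<xi> = \<plusminus> |\<xi>|' J' \<xi>\<close> modulo \<open>\<xi>\<close>.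

  The second relation is algebraic in the tangent space at one point. Squared, and restricted to a line
  of vectors \<open>\<xi>\<close>, it becomes an identity \<open>q P\<^sup>2 = q' P'\<^sup>2\<close> of polynomials in which \<open>q\<close> and \<open>q'\<close> are the
  positive quadratics given by \<open>g\<close> and \<open>g'\<close>. The non-real roots of \<open>q\<close> have odd multiplicity
  on the left, so they are roots of \<open>q'\<close>. Hence where \<open>d\<omega> \<noteq> 0\<close> we have \<open>g' = \<rho> g\<close> and
  \<open>d\<omega>' = \<plusminus> \<surd>\<rho> d\<omega>\<close>, and where \<open>d\<omega> = 0\<close> we have \<open>d\<omega>' = 0\<close> (\<open>skew_relation\<close>).

  What is left concerns the Riemannian metrics. In dimension at least \<open>2\<close>, metrics which are both conformal and
  projectively equivalent on an open set have a locally constant ratio there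
  (\<open>conformal_factor_deriv_zero\<close>), so \<open>g' = \<kappa> g\<close> on the connected set \<open>M\<^sup>0\<close> with one constant \<open>\<kappa>\<close>.
  To leave \<open>M\<^sup>0\<close>, one uses that \<open>g'(v, v)\<^sup>n\<^sup>+\<^sup>1 (det g / det g')\<^sup>2\<close> is constant along the geodesics of \<open>g\<close>
  (\<open>quadratic_integral\<close>). A point near a small ball on which \<open>g' = \<kappa> g\<close> sends geodesics into the ball in
  an open set of directions, and the integral shows that \<open>g'\<close> is proportional to \<open>g\<close> at that point as well.
  So the homothety spreads over coordinate balls of a size that does not depend on the small ball
  (\<open>homothety_propagation\<close>), and over the connected manifold. Finally, the sign in \<open>d\<omega>' = \<plusminus> \<surd>\<kappa> d\<omega>\<close> is locally
  constant on \<open>M\<^sup>0\<close>, hence constant, and it does not matter outside, where both sides vanish. With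
  \<open>c = \<surd>\<kappa>\<close>, this says that one of \<open>\<omega>' - c \<omega>\<close> and \<open>\<omega>' + c \<omega>\<close> is closed.
\<close>

section \<open>Functions of class C^k\<close>

lemma Ck_on_subset: "Ck_on k f S \<Longrightarrow> T \<subseteq> S \<Longrightarrow> Ck_on k f T"
proof (induction k arbitrary: f)
  case 0
  then show ?case by (auto intro: continuous_on_subset)
next
  case (Suc k)
  then obtain f' where "\<forall>x\<in>S. (f has_derivative f' x) (at x within S)" "\<forall>v. Ck_on k (\<lambda>x. f' x v) S"
    by auto
  then show ?case using Suc
    by (auto intro!: exI[of _ f'] intro: has_derivative_subset)
qed

lemma Ck_on_cong:
  assumes "\<And>x. x \<in> S \<Longrightarrow> f x = g x" "Ck_on k f S"
  shows "Ck_on k g S"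
proof (cases k)
  case 0
  then show ?thesis using assms by (auto cong: continuous_on_cong)
next
  case (Suc k')
  then obtain f' where "\<forall>x\<in>S. (f has_derivative f' x) (at x within S)" "\<forall>v. Ck_on k' (\<lambda>x. f' x v) S"
    using assms by auto
  then show ?thesis using Suc assms
    by (auto intro!: exI[of _ f'] intro: has_derivative_transform[of _ S g f])
qed

lemma Ck_on_imp_continuous_on: "Ck_on k f S \<Longrightarrow> continuous_on S f"
  by (cases k) (auto simp: continuous_on_eq_continuous_within intro: has_derivative_continuous)

lemma Ck_on_Suc_imp: "Ck_on (Suc k) f S \<Longrightarrow> Ck_on k f S"
proof (induction k arbitrary: f)
  case 0
  then show ?case using Ck_on_imp_continuous_on[OF 0] by simp
next
  case (Suc k)
  then obtain f' where f': "\<forall>x\<in>S. (f has_derivative f' x) (at x within S)" "\<forall>v. Ck_on (Suc k) (\<lambda>x. f' x v) S"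
    by auto
  then have "\<forall>v. Ck_on k (\<lambda>x. f' x v) S" using Suc.IH by blast
  then show ?case using f' by auto
qed

lemma Ck_on_const: "Ck_on k (\<lambda>x. c) S"
proof (induction k arbitrary: c)
  case (Suc k)
  then show ?case by (auto intro!: exI[of _ "\<lambda>x v. 0"])
qed simp

lemma Ck_on_bounded_linear:
  assumes "bounded_linear L"
  shows "Ck_on k f S \<Longrightarrow> Ck_on k (\<lambda>x. L (f x)) S"
proof (induction k arbitrary: f)
  case 0
  then show ?case using assms by (auto intro: bounded_linear.continuous_on)
next
  case (Suc k)
  then obtain f' where f': "\<forall>x\<in>S. (f has_derivative f' x) (at x within S)" "\<forall>v. Ck_on k (\<lambda>x. f' x v) S"
    by auto
  then show ?case using Suc.IH
    by (auto intro!: exI[of _ "\<lambda>x v. L (f' x v)"] bounded_linear.has_derivative[OF assms])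
qed

lemma Ck_on_id: "Ck_on k (\<lambda>x. x) S"
proof (cases k)
  case (Suc k')
  then show ?thesis by (auto intro!: exI[of _ "\<lambda>x v. v"] Ck_on_const derivative_intros)
qed (simp add: continuous_on_id)

lemma Ck_on_linear: "bounded_linear L \<Longrightarrow> Ck_on k L S"
  using Ck_on_bounded_linear[OF _ Ck_on_id] .

lemma Ck_on_add: "Ck_on k f S \<Longrightarrow> Ck_on k g S \<Longrightarrow> Ck_on k (\<lambda>x. f x + g x) S"
proof (induction k arbitrary: f g)
  case 0
  then show ?case by (auto intro: continuous_on_add)
next
  case (Suc k)
  then obtain f' g' where f': "\<forall>x\<in>S. (f has_derivative f' x) (at x within S)" "\<forall>v. Ck_on k (\<lambda>x. f' x v) S"
    and g': "\<forall>x\<in>S. (g has_derivative g' x) (at x within S)" "\<forall>v. Ck_on k (\<lambda>x. g' x v) S"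
    by auto
  then show ?case using Suc.IH
    by (auto intro!: exI[of _ "\<lambda>x v. f' x v + g' x v"] derivative_intros)
qed

lemma Ck_on_sum: "(\<And>i. i \<in> I \<Longrightarrow> Ck_on k (f i) S) \<Longrightarrow> Ck_on k (\<lambda>x. \<Sum>i\<in>I. f i x) S"
  by (induction I rule: infinite_finite_induct) (auto intro: Ck_on_const Ck_on_add)

lemma Ck_on_scaleR:
  "Ck_on k f S \<Longrightarrow> Ck_on k g S \<Longrightarrow> Ck_on k (\<lambda>x. f x *\<^sub>R g x) S"
proof (induction k arbitrary: f g)
  case 0
  then show ?case by (auto intro: continuous_on_scaleR)
next
  case (Suc k)
  then obtain f' g' where f': "\<forall>x\<in>S. (f has_derivative f' x) (at x within S)" "\<forall>v. Ck_on k (\<lambda>x. f' x v) S"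
    and g': "\<forall>x\<in>S. (g has_derivative g' x) (at x within S)" "\<forall>v. Ck_on k (\<lambda>x. g' x v) S"
    by auto
  have "Ck_on k f S" "Ck_on k g S"
    using Suc.prems Ck_on_Suc_imp by blast+
  then show ?case using f' g' Suc.IH
    by (auto intro!: exI[of _ "\<lambda>x v. f x *\<^sub>R g' x v + f' x v *\<^sub>R g x"] derivative_intros Ck_on_add)
qed

text \<open>The derivative of the composition in a fixed direction is a derivative of \<open>g\<close> in a direction
  that varies with \<open>x\<close>. Expanding that direction in the standard basis leaves products of functions
  of class \<open>C\<^sup>k\<close> with derivatives of \<open>g\<close> in fixed directions, to which the induction hypothesis
  applies.\<close>

lemma Ck_on_compose:
  fixes f :: "'a::euclidean_space \<Rightarrow> 'b::euclidean_space"
  assumes f: "Ck_on k f S" and "f ` S \<subseteq> T"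
  shows "Ck_on k g T \<Longrightarrow> Ck_on k (\<lambda>x. g (f x)) S"
  using f
proof (induction k arbitrary: g)
  case 0
  then show ?case using assms(2) by (auto intro: continuous_on_compose2)
next
  case (Suc k)
  obtain f' where f': "\<forall>x\<in>S. (f has_derivative f' x) (at x within S)" "\<forall>v. Ck_on k (\<lambda>x. f' x v) S"
    using Suc.prems by auto
  obtain g' where g': "\<forall>x\<in>T. (g has_derivative g' x) (at x within T)" "\<forall>v. Ck_on k (\<lambda>x. g' x v) T"
    using Suc.prems by auto
  have D: "((\<lambda>x. g (f x)) has_derivative (\<lambda>v. g' (f x) (f' x v))) (at x within S)" if "x \<in> S" for x
    by (rule has_derivative_in_compose2[where t=T and g=g]) (use f' g' assms(2) that in auto)
  have "Ck_on k (\<lambda>x. g' (f x) (f' x v)) S" for v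
  proof -
    have "Ck_on k (\<lambda>x. \<Sum>b\<in>Basis. (f' x v \<bullet> b) *\<^sub>R g' (f x) b) S"
      by (intro Ck_on_sum Ck_on_scaleR Ck_on_bounded_linear[OF bounded_linear_inner_left] Suc.IH
          spec[OF f'(2)] spec[OF g'(2)] Ck_on_Suc_imp[OF Suc.prems(2)])
    then show ?thesis
    proof (rule Ck_on_cong[rotated])
      fix x assume "x \<in> S"
      then have "linear (g' (f x))"
        using g'(1) assms(2) has_derivative_linear by blast
      then show "(\<Sum>b\<in>Basis. (f' x v \<bullet> b) *\<^sub>R g' (f x) b) = g' (f x) (f' x v)"
        by (subst (2) euclidean_representation[of "f' x v", symmetric])
          (simp add: linear_sum linear_scale)
    qed
  qed
  then show ?case using D by (auto intro!: exI[of _ "\<lambda>x v. g' (f x) (f' x v)"])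
qed

lemma linear_real_eq:
  fixes L :: "real \<Rightarrow> 'b::real_vector"
  assumes "linear L"
  shows "L = (\<lambda>h. h *\<^sub>R L 1)"
proof
  fix h
  have "L h = L (h *\<^sub>R 1)" by simp
  also have "\<dots> = h *\<^sub>R L 1" by (rule linear_scale[OF assms])
  finally show "L h = h *\<^sub>R L 1" .
qed

text \<open>On an interval, \<open>C\<^sup>2\<close> amounts to a continuous second derivative.\<close>

lemma Ck_on_2_real_iff:
  fixes f :: "real \<Rightarrow> 'b::real_normed_vector"
  shows "Ck_on 2 f S \<longleftrightarrow> (\<exists>f' f''. (\<forall>t\<in>S. (f has_vector_derivative f' t) (at t within S)) \<and>
     (\<forall>t\<in>S. (f' has_vector_derivative f'' t) (at t within S)) \<and> continuous_on S f'')" (is "?L \<longleftrightarrow> ?R")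
proof
  assume ?L
  then obtain D where D: "\<forall>x\<in>S. (f has_derivative D x) (at x within S)" "\<forall>v. Ck_on 1 (\<lambda>x. D x v) S"
    by (auto simp: numeral_2_eq_2)
  obtain D2 where D2: "\<forall>x\<in>S. ((\<lambda>x. D x 1) has_derivative D2 x) (at x within S)"
    "\<forall>v. continuous_on S (\<lambda>x. D2 x v)"
    using spec[OF D(2), of 1] by auto
  have *: "D x = (\<lambda>h. h *\<^sub>R D x 1)" if "x \<in> S" for x
    using D(1) that by (intro linear_real_eq has_derivative_linear[where F="at x within S"]) auto
  have **: "D2 x = (\<lambda>h. h *\<^sub>R D2 x 1)" if "x \<in> S" for x
    using D2(1) that by (intro linear_real_eq has_derivative_linear[where F="at x within S"]) auto
  show ?R
    using D(1) D2 *[symmetric] **[symmetric] unfolding has_vector_derivative_def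
    by (intro exI[of _ "\<lambda>x. D x 1"] exI[of _ "\<lambda>x. D2 x 1"]) auto
next
  assume ?R
  then obtain f' f'' where *: "\<forall>t\<in>S. (f has_vector_derivative f' t) (at t within S)"
     "\<forall>t\<in>S. (f' has_vector_derivative f'' t) (at t within S)" "continuous_on S f''"
    by blast
  have "Ck_on 1 (\<lambda>x. v *\<^sub>R f' x) S" for v
    using *(2,3) unfolding has_vector_derivative_def
    by (auto intro!: exI[of _ "\<lambda>x h. v *\<^sub>R h *\<^sub>R f'' x"] derivative_intros continuous_intros)
  then show ?L using *(1) unfolding has_vector_derivative_def
    by (simp add: numeral_2_eq_2 del: One_nat_def Ck_on.simps(1))
      (intro exI[of _ "\<lambda>x h. h *\<^sub>R f' x"], simp)
qed

section \<open>Mixed second derivatives\<close>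

text \<open>The two orders of differentiation are exchanged by writing \<open>H\<close> as an integral
  of its \<open>t\<close>-derivative and differentiating under the integral sign. The interval of \<open>t\<close> is closed,
  so the result holds up to the boundary.\<close>

lemma mixed_derivative:
  fixes H :: "real \<Rightarrow> real \<Rightarrow> 'b::euclidean_space"
  assumes U: "convex U" "s0 \<in> U" "s0 \<in> interior U"
    and Ht: "\<And>s t. s \<in> U \<Longrightarrow> t \<in> {a..b} \<Longrightarrow> (H s has_vector_derivative Ht s t) (at t within {a..b})"
    and Hts: "\<And>s t. s \<in> U \<Longrightarrow> t \<in> {a..b} \<Longrightarrow> ((\<lambda>s. Ht s t) has_vector_derivative Hts s t) (at s within U)"
    and contHt: "\<And>s. s \<in> U \<Longrightarrow> continuous_on {a..b} (Ht s)"
    and cont: "continuous_on (U \<times> {a..b}) (\<lambda>(s,t). Hts s t)"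
    and \<eta>: "\<And>t. t \<in> {a..b} \<Longrightarrow> ((\<lambda>s. H s t) has_vector_derivative \<eta> t) (at s0)"
    and t: "t \<in> {a..b}"
  shows "(\<eta> has_vector_derivative Hts s0 t) (at t within {a..b})"
proof -
  have eq: "\<eta> r = \<eta> a + integral {a..r} (Hts s0)" if r: "r \<in> {a..b}" for r
  proof -
    have I: "integral {a..r} (Ht s) = H s r - H s a" if "s \<in> U" for s
    proof (rule integral_unique, rule fundamental_theorem_of_calculus)
      show "a \<le> r" using r by auto
      fix x assume "x \<in> {a..r}"
      then show "(H s has_vector_derivative Ht s x) (at x within {a..r})"
        using r by (intro has_vector_derivative_within_subset[OF Ht[OF that, of x]]) auto
    qed
    have "((\<lambda>s. integral (cbox a r) (Ht s)) has_vector_derivative integral (cbox a r) (Hts s0)) (at s0 within U)"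
    proof (rule leibniz_rule_vector_derivative[OF _ _ _ U(2,1)])
      show "((\<lambda>x. Ht x t) has_vector_derivative Hts x t) (at x within U)" if "x \<in> U" "t \<in> cbox a r" for x t
        using Hts that r by auto
      show "Ht x integrable_on cbox a r" if "x \<in> U" for x
        by (intro integrable_continuous continuous_on_subset[OF contHt[OF that]]) (use r in auto)
      show "continuous_on (U \<times> cbox a r) (\<lambda>(x, t). Hts x t)"
        by (rule continuous_on_subset[OF cont]) (use r in auto)
    qed
    then have 1: "((\<lambda>s. integral {a..r} (Ht s)) has_vector_derivative integral {a..r} (Hts s0)) (at s0)"
      by (simp add: at_within_interior[OF U(3)])
    have ar: "a \<in> {a..b}" using t by auto
    have 2: "((\<lambda>s. H s r - H s a) has_vector_derivative \<eta> r - \<eta> a) (at s0)"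
      by (rule has_vector_derivative_diff[OF \<eta>[OF r] \<eta>[OF ar]])
    have "((\<lambda>s. H s r - H s a) has_vector_derivative integral {a..r} (Hts s0)) (at s0)"
      by (rule has_vector_derivative_transform_within_open[OF 1, of "interior U"])
        (use U(3) I interior_subset[of U] in auto)
    with 2 have "\<eta> r - \<eta> a = integral {a..r} (Hts s0)"
      by (rule vector_derivative_unique_at)
    then show ?thesis by (metis add.commute diff_add_cancel)
  qed
  have "continuous_on {a..b} (\<lambda>t. (s0, t))"
    by (rule continuous_on_Pair[OF continuous_on_const continuous_on_id])
  then have "continuous_on {a..b} (Hts s0)"
    using continuous_on_compose2[OF cont, of "{a..b}" "\<lambda>t. (s0, t)"] U(2) by auto
  then have "((\<lambda>u. \<eta> a + integral {a..u} (Hts s0)) has_vector_derivative 0 + Hts s0 t) (at t within {a..b})"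
    by (intro derivative_intros integral_has_vector_derivative t)
  from has_vector_derivative_transform[of t _ \<eta>, OF t eq this] show ?thesis by simp
qed

lemma has_vector_derivative_compose:
  assumes "(g has_vector_derivative v) (at s within T)" and f: "(f has_derivative D) (at (g s))"
  shows "((\<lambda>t. f (g t)) has_vector_derivative D v) (at s within T)"
  using has_derivative_compose[OF assms(1)[unfolded has_vector_derivative_def] f]
  unfolding has_vector_derivative_def by (simp add: linear_scale[OF has_derivative_linear[OF f]])

text \<open>This is \<open>mixed_derivative\<close> for the restriction of \<open>f\<close> to the plane through \<open>u\<close> spanned by \<open>v\<close>
  and \<open>w\<close>.\<close>

lemma Ck_on_2_symmetric:
  fixes f :: "'a::euclidean_space \<Rightarrow> 'b::euclidean_space"
  assumes S: "open S" "u \<in> S" "Ck_on 2 f S"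
    and f': "\<And>x. x \<in> S \<Longrightarrow> (f has_derivative f' x) (at x)"
    and fv: "((\<lambda>x. f' x v) has_derivative fv) (at u)"
    and fw: "((\<lambda>x. f' x w) has_derivative fw) (at u)"
  shows "fv w = fw v"
proof -
  obtain D where D: "\<forall>x\<in>S. (f has_derivative D x) (at x within S)" "\<forall>v. Ck_on 1 (\<lambda>x. D x v) S"
    using S(3) by (auto simp: numeral_2_eq_2)
  have Df: "D x = f' x" if "x \<in> S" for x
    using D(1) f' that has_derivative_unique at_within_open[OF that S(1)] by metis
  obtain D2 where D2: "\<forall>x\<in>S. ((\<lambda>x. D x w) has_derivative D2 x) (at x within S)"
    "\<forall>v. continuous_on S (\<lambda>x. D2 x v)"
    using spec[OF D(2), of w] by auto
  have fwD: "fw = D2 u"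
  proof (rule has_derivative_unique)
    show "((\<lambda>x. f' x w) has_derivative fw) (at u)" by (rule fw)
    have "((\<lambda>x. D x w) has_derivative D2 u) (at u)"
      using D2(1) S at_within_open by metis
    then show "((\<lambda>x. f' x w) has_derivative D2 u) (at u)"
      by (rule has_derivative_transform_within_open[OF _ S(1,2)]) (auto simp: Df)
  qed
  obtain r where r: "r > 0" "cball u r \<subseteq> S"
    using S open_contains_cball by blast
  define d where "d = r / (norm v + norm w + 1)"
  have pos: "norm v + norm w + 1 > 0" by (smt (verit) norm_ge_zero)
  have d: "d > 0" using r pos by (simp add: d_def)
  have inS: "u + s *\<^sub>R v + t *\<^sub>R w \<in> S" if "\<bar>s\<bar> \<le> d" "\<bar>t\<bar> \<le> d" for s t
  proof -
    have "norm (s *\<^sub>R v + t *\<^sub>R w) \<le> \<bar>s\<bar> * norm v + \<bar>t\<bar> * norm w"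
      by (metis norm_scaleR norm_triangle_ineq)
    also have "\<dots> \<le> d * norm v + d * norm w"
      using that by (intro add_mono mult_right_mono) auto
    also have "\<dots> \<le> d * (norm v + norm w + 1)" using d by (simp add: algebra_simps)
    also have "\<dots> = r" using pos by (simp add: d_def)
    finally have "dist u (u + s *\<^sub>R v + t *\<^sub>R w) \<le> r"
      by (metis add.assoc dist_add_cancel dist_0_norm add.right_neutral)
    then show ?thesis using r by auto
  qed
  define U where "U = {-d<..<d}"
  have tline: "((\<lambda>t. u + s *\<^sub>R v + t *\<^sub>R w) has_vector_derivative w) (at t within T)" for s t T
    by (auto intro!: derivative_eq_intros simp: has_vector_derivative_def)
  have sline: "((\<lambda>s. u + s *\<^sub>R v + t *\<^sub>R w) has_vector_derivative v) (at s within T)" for s t T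
    by (auto intro!: derivative_eq_intros simp: has_vector_derivative_def)
  have derf: "(f has_derivative D x) (at x)" and derD: "((\<lambda>x. D x w) has_derivative D2 x) (at x)" if "x \<in> S" for x
    using D(1) D2(1) that S(1) at_within_open by metis+
  have "((\<lambda>t. D (u + t *\<^sub>R w) v) has_vector_derivative D2 (u + 0 *\<^sub>R v + 0 *\<^sub>R w) v) (at 0 within {-d..d})"
  proof (rule mixed_derivative[where U=U and H="\<lambda>s t. f (u + s *\<^sub>R v + t *\<^sub>R w)"
        and Ht="\<lambda>s t. D (u + s *\<^sub>R v + t *\<^sub>R w) w" and Hts="\<lambda>s t. D2 (u + s *\<^sub>R v + t *\<^sub>R w) v"])
    show "convex U" "0 \<in> U" "0 \<in> interior U" "0 \<in> {-d..d}" using d by (auto simp: U_def)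
  next
    fix s t assume st: "s \<in> U" "t \<in> {-d..d}"
    then have x: "u + s *\<^sub>R v + t *\<^sub>R w \<in> S" using inS by (auto simp: U_def)
    show "((\<lambda>t. f (u + s *\<^sub>R v + t *\<^sub>R w)) has_vector_derivative D (u + s *\<^sub>R v + t *\<^sub>R w) w) (at t within {-d..d})"
      by (rule has_vector_derivative_compose[where f=f, OF tline derf[OF x]])
    show "((\<lambda>s. D (u + s *\<^sub>R v + t *\<^sub>R w) w) has_vector_derivative D2 (u + s *\<^sub>R v + t *\<^sub>R w) v) (at s within U)"
      by (rule has_vector_derivative_compose[where f="\<lambda>x. D x w", OF sline derD[OF x]])
  next
    fix s assume s: "s \<in> U"
    show "continuous_on {- d..d} (\<lambda>t. D (u + s *\<^sub>R v + t *\<^sub>R w) w)"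
      by (rule continuous_on_compose2[OF Ck_on_imp_continuous_on[OF spec[OF D(2), of w]]])
        (use inS s in \<open>auto intro!: continuous_intros simp: U_def\<close>)
  next
    show "continuous_on (U \<times> {- d..d}) (\<lambda>(s, t). D2 (u + s *\<^sub>R v + t *\<^sub>R w) v)"
      unfolding split_beta
      by (rule continuous_on_compose2[OF spec[OF D2(2), of v]])
        (use inS in \<open>auto intro!: continuous_intros simp: U_def\<close>)
  next
    fix t assume t: "t \<in> {-d..d}"
    then have x: "u + 0 *\<^sub>R v + t *\<^sub>R w \<in> S" using inS[of 0 t] d by auto
    have "((\<lambda>s. f (u + s *\<^sub>R v + t *\<^sub>R w)) has_vector_derivative D (u + 0 *\<^sub>R v + t *\<^sub>R w) v) (at 0)"
      by (rule has_vector_derivative_compose[where f=f, OF sline derf[OF x]])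
    then show "((\<lambda>s. f (u + s *\<^sub>R v + t *\<^sub>R w)) has_vector_derivative D (u + t *\<^sub>R w) v) (at 0)"
      by simp
  qed
  then have 1: "((\<lambda>t. D (u + t *\<^sub>R w) v) has_vector_derivative fw v) (at 0)"
    using d at_within_Icc_at[of "-d" 0 d] by (simp add: fwD)
  have "((\<lambda>x. D x v) has_derivative fv) (at u)"
    by (rule has_derivative_transform_within_open[OF fv S(1,2)]) (auto simp: Df)
  then have 2: "((\<lambda>t. D (u + t *\<^sub>R w) v) has_vector_derivative fv w) (at 0)"
    using has_vector_derivative_compose[where f="\<lambda>x. D x v" and g="\<lambda>t. u + 0 *\<^sub>R v + t *\<^sub>R w" and s=0, OF tline] by simp
  show ?thesis using vector_derivative_unique_at[OF 2 1] .
qed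

section \<open>The fundamental lemma of the calculus of variations\<close>

text \<open>Polynomial variations suffice: a continuous function that is orthogonal to all polynomials
  with respect to the weight \<open>(t - a)(b - t)\<close> vanishes, by the Weierstrass theorem.\<close>

lemma fundamental_lemma:
  fixes f :: "real \<Rightarrow> real"
  assumes "a < b" and cont: "continuous_on {a..b} f"
    and int: "\<And>p. real_polynomial_function p \<Longrightarrow> integral {a..b} (\<lambda>t. f t * ((t - a) * (b - t) * p t)) = 0"
    and t: "t \<in> {a..b}"
  shows "f t = 0"
proof -
  define w where "w t = (t - a) * (b - t)" for t
  have w: "w t \<ge> 0" if "t \<in> {a..b}" for t using that by (auto simp: w_def)
  have contw: "continuous_on {a..b} w" by (auto simp: w_def intro!: continuous_intros)
  define K where "K = integral {a..b} (\<lambda>t. \<bar>f t\<bar> * w t)"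
  have "K \<ge> 0" unfolding K_def using w by (intro integral_nonneg integrable_continuous_interval continuous_intros cont contw) auto
  have le: "integral {a..b} (\<lambda>t. f t * f t * w t) \<le> e * K" if e: "e > 0" for e
  proof -
    obtain p where p: "real_polynomial_function p" "\<And>t. t \<in> {a..b} \<Longrightarrow> \<bar>f t - p t\<bar> < e"
      using Stone_Weierstrass_real_polynomial_function[OF compact_Icc cont e] by blast
    have contp: "continuous_on {a..b} p"
      using continuous_on_polymonial_function p(1) real_polynomial_function_eq by blast
    have "integral {a..b} (\<lambda>t. f t * f t * w t) = integral {a..b} (\<lambda>t. f t * (f t - p t) * w t) + integral {a..b} (\<lambda>t. f t * (w t * p t))"
      by (subst integral_add[symmetric])
        (auto intro!: integrable_continuous_interval continuous_intros cont contw contp simp: algebra_simps)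
    also have "integral {a..b} (\<lambda>t. f t * (w t * p t)) = 0"
      using int[OF p(1)] by (simp add: w_def)
    also have "integral {a..b} (\<lambda>t. f t * (f t - p t) * w t) \<le> integral {a..b} (\<lambda>t. e * (\<bar>f t\<bar> * w t))"
    proof (intro integral_le integrable_continuous_interval continuous_intros cont contw contp)
      fix t assume t: "t \<in> {a..b}"
      have "f t * (f t - p t) \<le> \<bar>f t\<bar> * \<bar>f t - p t\<bar>" by (metis abs_ge_self abs_mult)
      also have "\<dots> \<le> \<bar>f t\<bar> * e" using p(2)[OF t] by (intro mult_left_mono) auto
      finally show "f t * (f t - p t) * w t \<le> e * (\<bar>f t\<bar> * w t)"
        using mult_right_mono[OF _ w[OF t]] by (metis mult.assoc mult.commute)
    qed
    also have "\<dots> = e * K" by (simp add: K_def)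
    finally show ?thesis by simp
  qed
  have int0: "integral {a..b} (\<lambda>t. f t * f t * w t) \<le> 0"
  proof (rule ccontr)
    assume "\<not> ?thesis"
    then have pos: "integral {a..b} (\<lambda>t. f t * f t * w t) > 0" (is "?I > 0") by simp
    have "?I \<le> ?I / (2 * (K + 1)) * K" using \<open>K \<ge> 0\<close> pos by (intro le) auto
    also have "\<dots> \<le> ?I / 2" using \<open>K \<ge> 0\<close> pos by (simp add: field_simps)
    finally show False using pos by simp
  qed
  moreover have "integral {a..b} (\<lambda>t. f t * f t * w t) \<ge> 0"
    using w by (intro integral_nonneg integrable_continuous_interval continuous_intros cont contw) auto
  ultimately have "integral {a..b} (\<lambda>t. f t * f t * w t) = 0" by simp
  moreover have "continuous_on {a..b} (\<lambda>t. f t * f t * w t)"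
    by (intro continuous_intros cont contw)
  ultimately have "\<forall>t\<in>{a..b}. f t * f t * w t = 0"
    using integral_eq_0_iff[of a b "\<lambda>t. f t * f t * w t"] \<open>a < b\<close> w by simp
  then have 0: "f t = 0" if "t \<in> {a<..<b}" for t
    using that by (auto simp: w_def)
  have "closure {a<..<b} = {a..b}" using \<open>a < b\<close> by simp
  then show ?thesis
    using continuous_constant_on_closure[of "{a<..<b}" f 0 t] 0 cont t by auto
qed

section \<open>Peano's existence theorem\<close>

text \<open>Approximate solutions solve the equation with a delay \<open>1 / (n + 1)\<close>. They are obtained by
  iterating the delayed integral operator, since each iteration makes the solution correct on a
  further interval of that length. Their limit along a uniformly convergent subsequence is the
  solution.\<close>

lemma Peano_existence:
  fixes f :: "'a::euclidean_space \<Rightarrow> 'a"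
  assumes cont: "continuous_on (cball y0 \<rho>) f" and M: "\<And>y. y \<in> cball y0 \<rho> \<Longrightarrow> norm (f y) \<le> M"
    and \<tau>: "0 < \<tau>" "\<tau> * M \<le> \<rho>" and "0 \<le> \<rho>"
  obtains y where "y 0 = y0" "\<And>t. t \<in> {0..\<tau>} \<Longrightarrow> y t \<in> cball y0 \<rho>"
    "\<And>t. t \<in> {0..\<tau>} \<Longrightarrow> (y has_vector_derivative f (y t)) (at t within {0..\<tau>})"
proof -
  have "norm (f y0) \<le> M" using M[of y0] \<open>0 \<le> \<rho>\<close> by simp
  then have "M \<ge> 0" using norm_ge_zero[of "f y0"] by linarith
  \<comment> \<open>the bound and the Lipschitz constant are common to all approximations, for the Arzela-Ascoli
    theorem\<close>
  define good where "good x \<longleftrightarrow> (\<forall>t\<in>{0..\<tau>}. x t \<in> cball y0 \<rho>) \<and> (\<forall>s\<in>{0..\<tau>}. \<forall>t\<in>{0..\<tau>}. norm (x s - x t) \<le> M * \<bar>s - t\<bar>)" for x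
  have goodcont: "continuous_on {0..\<tau>} x" if "good x" for x
    by (rule lipschitz_on_continuous_on[of M])
      (use that \<open>M \<ge> 0\<close> in \<open>auto simp: lipschitz_on_def good_def dist_norm\<close>)
  have fcont: "continuous_on {0..\<tau>} (\<lambda>s. f (x s))" if "good x" for x
    by (rule continuous_on_compose2[OF cont goodcont[OF that]]) (use that in \<open>auto simp: good_def\<close>)
  have fint: "(\<lambda>s. f (x s)) integrable_on {c..d}" if "good x" "0 \<le> c" "d \<le> \<tau>" for x c d
    by (rule integrable_continuous_interval, rule continuous_on_subset[OF fcont[OF that(1)]]) (use that in auto)
  have Fb: "norm (integral {0..s} (\<lambda>s. f (x s)) - integral {0..t} (\<lambda>s. f (x s))) \<le> M * \<bar>s - t\<bar>"
    if x: "good x" and "s \<in> {0..\<tau>}" "t \<in> {0..\<tau>}" for x s t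
  proof -
    have *: "norm (integral {0..s} (\<lambda>s. f (x s)) - integral {0..t} (\<lambda>s. f (x s))) \<le> M * (t - s)"
      if "0 \<le> s" "s \<le> t" "t \<le> \<tau>" for s t
    proof -
      have "integral {0..s} (\<lambda>s. f (x s)) + integral {s..t} (\<lambda>s. f (x s)) = integral {0..t} (\<lambda>s. f (x s))"
        using that by (intro Henstock_Kurzweil_Integration.integral_combine fint x) auto
      then have "norm (integral {0..s} (\<lambda>s. f (x s)) - integral {0..t} (\<lambda>s. f (x s))) = norm (integral {s..t} (\<lambda>s. f (x s)))"
        by (metis add_diff_cancel_left' norm_minus_commute)
      also have "\<dots> \<le> M * (t - s)"
        using that x by (intro integral_bound fcont continuous_on_subset[OF fcont[OF x]]) (auto simp: good_def intro!: M)
      finally show ?thesis .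
    qed
    show ?thesis
    proof (cases "s \<le> t")
      case True
      then show ?thesis using *[of s t] that by auto
    next
      case False
      then show ?thesis using *[of t s] that by (auto simp: norm_minus_commute)
    qed
  qed
  define op where "op n x t = y0 + integral {0..t - 1 / (real n + 1)} (\<lambda>s. f (x s))" for n and x :: "real \<Rightarrow> 'a" and t
  have op_eq: "op n x t = y0 + integral {0..max 0 (t - 1 / (real n + 1))} (\<lambda>s. f (x s))" for n x t
    by (cases "t - 1 / (real n + 1) \<ge> 0") (auto simp: op_def max_def)
  have mx: "max 0 (t - 1 / (real n + 1)) \<in> {0..\<tau>}" if "t \<in> {0..\<tau>}" for t n
    using that by (auto simp: max_def intro: order_trans[of _ t])
  have opgood: "good (op n x)" if x: "good x" for n x
  proof -
    have "norm (op n x t - y0) \<le> \<rho>" if t: "t \<in> {0..\<tau>}" for t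
    proof -
      have "norm (op n x t - y0) \<le> M * \<bar>max 0 (t - 1 / (real n + 1)) - 0\<bar>"
        using Fb[OF x mx[OF t, of n], of 0] \<tau> by (simp add: op_eq)
      also have "\<dots> \<le> M * \<tau>" using \<open>M \<ge> 0\<close> mx[OF t, of n] by (intro mult_left_mono) auto
      finally show ?thesis using \<tau> by (simp add: mult.commute)
    qed
    moreover have "norm (op n x s - op n x t) \<le> M * \<bar>s - t\<bar>" if "s \<in> {0..\<tau>}" "t \<in> {0..\<tau>}" for s t
    proof -
      have "norm (op n x s - op n x t) \<le> M * \<bar>max 0 (s - 1 / (real n + 1)) - max 0 (t - 1 / (real n + 1))\<bar>"
        using Fb[OF x mx[OF that(1), of n] mx[OF that(2), of n]] by (simp add: op_eq)
      also have "\<dots> \<le> M * \<bar>s - t\<bar>" using \<open>M \<ge> 0\<close> by (intro mult_left_mono) auto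
      finally show ?thesis .
    qed
    ultimately show ?thesis by (auto simp: good_def dist_norm norm_minus_commute)
  qed
  define it where "it n k = (op n ^^ k) (\<lambda>_. y0)" for n k
  have it_Suc: "it n (Suc k) = op n (it n k)" and it_0: "it n 0 = (\<lambda>_. y0)" for n k by (auto simp: it_def)
  have itgood: "good (it n k)" for n k
  proof (induction k)
    case 0
    then show ?case using \<open>0 \<le> \<rho>\<close> \<open>M \<ge> 0\<close> by (auto simp: good_def it_0)
  next
    case (Suc k)
    then show ?case by (simp add: it_Suc opgood)
  qed
  have stab: "it n (Suc k) t = it n k t" if "t \<le> real (Suc k) / (real n + 1)" for n k t
    using that
  proof (induction k arbitrary: t)
    case 0
    then show ?case
      by (cases "t = 1 / (real n + 1)") (auto simp: it_Suc it_0 op_def)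
  next
    case (Suc k)
    have "integral {0..t - 1 / (real n + 1)} (\<lambda>s. f (it n (Suc k) s)) = integral {0..t - 1 / (real n + 1)} (\<lambda>s. f (it n k s))"
    proof (rule integral_cong)
      fix s assume "s \<in> {0..t - 1 / (real n + 1)}"
      then have "s \<le> real (Suc k) / (real n + 1)" using Suc.prems by (auto simp: add_divide_distrib)
      then show "f (it n (Suc k) s) = f (it n k s)" using Suc.IH by simp
    qed
    then show ?case by (simp add: it_Suc[of n "Suc k"] it_Suc[of n k] op_def)
  qed
  define X where "X n = it n (nat \<lceil>\<tau> * (real n + 1)\<rceil>)" for n
  have X: "X n t = y0 + integral {0..max 0 (t - 1 / (real n + 1))} (\<lambda>s. f (X n s))" if "t \<in> {0..\<tau>}" for n t
  proof -
    define k where "k = nat \<lceil>\<tau> * (real n + 1)\<rceil>"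
    have "\<tau> * (real n + 1) \<le> real (Suc k)" unfolding k_def by linarith
    then have "\<tau> \<le> real (Suc k) / (real n + 1)" by (simp add: field_simps)
    then have "it n (Suc k) t = it n k t" using that by (intro stab) auto
    then have "it n k t = op n (it n k) t" by (simp only: it_Suc)
    also have "\<dots> = y0 + integral {0..max 0 (t - 1 / (real n + 1))} (\<lambda>s. f (it n k s))"
      by (rule op_eq)
    finally show ?thesis unfolding X_def k_def .
  qed
  have Xg: "good (X n)" for n by (simp add: X_def itgood)
  have bd: "norm (X n x) \<le> norm y0 + \<rho>" if "x \<in> {0..\<tau>}" for n x
    using Xg[of n] that norm_triangle_sub[of "X n x" y0] by (force simp: good_def dist_norm norm_minus_commute)
  have eqc: "\<exists>d. 0 < d \<and> (\<forall>n y. y \<in> {0..\<tau>} \<and> norm (x - y) < d \<longrightarrow> norm (X n x - X n y) < e)" if x: "x \<in> {0..\<tau>}" and "0 < e" for x e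
  proof (intro exI[of _ "e / (M + 1)"] conjI allI impI)
    show "0 < e / (M + 1)" using that \<open>M \<ge> 0\<close> by auto
    fix n y assume y: "y \<in> {0..\<tau>} \<and> norm (x - y) < e / (M + 1)"
    then have "norm (X n x - X n y) \<le> M * \<bar>x - y\<bar>" using Xg[of n] x by (simp add: good_def)
    also have "\<dots> \<le> (M + 1) * \<bar>x - y\<bar>" by (intro mult_right_mono) auto
    also have "\<dots> < e" using y \<open>M \<ge> 0\<close> by (simp add: pos_less_divide_eq mult.commute)
    finally show "norm (X n x - X n y) < e" .
  qed
  obtain g k where g: "continuous_on {0..\<tau>} g" "strict_mono (k :: nat \<Rightarrow> nat)"
    "\<And>e. 0 < e \<Longrightarrow> \<exists>N. \<forall>n x. n \<ge> N \<and> x \<in> {0..\<tau>} \<longrightarrow> norm (X (k n) x - g x) < e"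
    using Arzela_Ascoli[of "{0..\<tau>}" X, OF compact_Icc bd eqc] by blast
  have lim: "(\<lambda>n. X (k n) t) \<longlonglongrightarrow> g t" if "t \<in> {0..\<tau>}" for t
    using g(3) that by (force simp: LIMSEQ_iff)
  have gin: "g t \<in> cball y0 \<rho>" if t: "t \<in> {0..\<tau>}" for t
    using closed_sequentially[OF closed_cball _ lim[OF t], of y0 \<rho>] Xg t by (auto simp: good_def)
  have gint: "g t = y0 + integral {0..t} (\<lambda>s. f (g s))" if t: "t \<in> {0..\<tau>}" for t
  proof -
    have I: "(\<lambda>n. integral {0..t} (\<lambda>s. f (X (k n) s))) \<longlonglongrightarrow> integral {0..t} (\<lambda>s. f (g s))"
    proof (rule dominated_convergence)
      show "(\<lambda>s. f (X (k n) s)) integrable_on {0..t}" for n by (rule fint[OF Xg]) (use t in auto)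
      show "(\<lambda>_. M) integrable_on {0..t}" by (rule integrable_const_ivl)
      show "norm (f (X (k n) x)) \<le> M" if "x \<in> {0..t}" for n x
        by (rule M) (use that t Xg[of "k n"] in \<open>auto simp: good_def\<close>)
      show "(\<lambda>n. f (X (k n) x)) \<longlonglongrightarrow> f (g x)" if "x \<in> {0..t}" for x
        using that t by (intro continuous_on_tendsto_compose[OF cont lim])
          (use gin Xg in \<open>auto simp: good_def\<close>)
    qed
    have small: "norm (X (k n) t - (y0 + integral {0..t} (\<lambda>s. f (X (k n) s)))) \<le> M * (1 / (real n + 1))" for n
    proof -
      have "norm (X (k n) t - (y0 + integral {0..t} (\<lambda>s. f (X (k n) s)))) \<le> M * \<bar>max 0 (t - 1 / (real (k n) + 1)) - t\<bar>"
        using Fb[OF Xg[of "k n"] mx[OF t, of "k n"] t] by (simp add: X[OF t])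
      also have "\<dots> \<le> M * (1 / (real (k n) + 1))"
        using \<open>M \<ge> 0\<close> t by (intro mult_left_mono) (auto simp: max_def abs_if)
      also have "\<dots> \<le> M * (1 / (real n + 1))"
        using \<open>M \<ge> 0\<close> seq_suble[OF g(2), of n] by (intro mult_left_mono) (simp_all add: frac_le)
      finally show ?thesis .
    qed
    have "(\<lambda>n. 1 / (real n + 1)) \<longlonglongrightarrow> 0"
      using LIMSEQ_inverse_real_of_nat by (simp only: inverse_eq_divide of_nat_Suc add.commute)
    then have "(\<lambda>n. M * (1 / (real n + 1))) \<longlonglongrightarrow> 0"
      using tendsto_mult_left[of "\<lambda>n. 1 / (real n + 1)" 0 sequentially M] by simp
    then have "(\<lambda>n. X (k n) t - (y0 + integral {0..t} (\<lambda>s. f (X (k n) s)))) \<longlonglongrightarrow> 0"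
      by (rule Lim_null_comparison[rotated]) (intro always_eventually allI small)
    moreover have "(\<lambda>n. X (k n) t - (y0 + integral {0..t} (\<lambda>s. f (X (k n) s)))) \<longlonglongrightarrow> g t - (y0 + integral {0..t} (\<lambda>s. f (g s)))"
      by (intro tendsto_intros lim t I)
    ultimately have "g t - (y0 + integral {0..t} (\<lambda>s. f (g s))) = 0" by (rule LIMSEQ_unique[rotated])
    then show ?thesis by simp
  qed
  have fg: "continuous_on {0..\<tau>} (\<lambda>s. f (g s))"
    by (rule continuous_on_compose2[OF cont g(1)]) (use gin in auto)
  show thesis
  proof
    show "g 0 = y0" using gint[of 0] \<tau> by simp
    show "g t \<in> cball y0 \<rho>" if "t \<in> {0..\<tau>}" for t using gin that .
    fix t assume t: "t \<in> {0..\<tau>}"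
    have "((\<lambda>t. y0 + integral {0..t} (\<lambda>s. f (g s))) has_vector_derivative 0 + f (g t)) (at t within {0..\<tau>})"
      by (intro derivative_intros integral_has_vector_derivative fg t)
    from has_vector_derivative_transform[of t _ g, OF t gint this]
    show "(g has_vector_derivative f (g t)) (at t within {0..\<tau>})" by simp
  qed
qed

section \<open>Metrics and one-forms in a coordinate domain\<close>

locale local_metric =
  fixes W :: "'e::euclidean_space set" and G :: "'e \<Rightarrow> 'e \<Rightarrow> 'e \<Rightarrow> real"
    and G1 :: "'e \<Rightarrow> 'e \<Rightarrow> 'e \<Rightarrow> 'e \<Rightarrow> real"
  assumes open_W: "open W"
    and bil: "u \<in> W \<Longrightarrow> bilinear (G u)"
    and sym: "u \<in> W \<Longrightarrow> G u v w = G u w v"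
    and pos: "u \<in> W \<Longrightarrow> v \<noteq> 0 \<Longrightarrow> G u v v > 0"
    and deriv: "u \<in> W \<Longrightarrow> ((\<lambda>u. G u v w) has_derivative (\<lambda>h. G1 u h v w)) (at u)"
    and cont1: "continuous_on W (\<lambda>u. G1 u h v w)"

locale local_form =
  fixes W :: "'e::euclidean_space set" and B :: "'e \<Rightarrow> 'e \<Rightarrow> real" and B1 :: "'e \<Rightarrow> 'e \<Rightarrow> 'e \<Rightarrow> real"
  assumes open_W': "open W"
    and lin: "u \<in> W \<Longrightarrow> linear (B u)"
    and fderiv: "u \<in> W \<Longrightarrow> ((\<lambda>u. B u v) has_derivative (\<lambda>h. B1 u h v)) (at u)"
    and fcont1: "continuous_on W (\<lambda>u. B1 u h v)"

text \<open>A form that is linear at each point is continuous or differentiable as a function of point and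
  vectors as soon as its finitely many components are; this is what the expansions are for.\<close>

lemma linear_eq_sum_Basis:
  fixes L :: "'e::euclidean_space \<Rightarrow> real"
  assumes "linear L"
  shows "L v = (\<Sum>b\<in>Basis. (v \<bullet> b) * L b)"
proof -
  have "L v = L (\<Sum>b\<in>Basis. (v \<bullet> b) *\<^sub>R b)" by (simp add: euclidean_representation)
  also have "\<dots> = (\<Sum>b\<in>Basis. (v \<bullet> b) * L b)"
    by (simp only: linear_sum[OF assms] linear_scale[OF assms] real_scaleR_def)
  finally show ?thesis .
qed

lemma bilinear_eq_sum_Basis:
  fixes L :: "'e::euclidean_space \<Rightarrow> 'e \<Rightarrow> real"
  assumes "bilinear L"
  shows "L v w = (\<Sum>b\<in>Basis. \<Sum>b'\<in>Basis. (v \<bullet> b) * (w \<bullet> b') * L b b')"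
proof -
  have 1: "linear (\<lambda>v. L v w)" for w using assms by (simp add: bilinear_def)
  have 2: "linear (L v)" for v using assms by (simp add: bilinear_def)
  have "L v w = (\<Sum>b\<in>Basis. (v \<bullet> b) * L b w)"
    by (rule linear_eq_sum_Basis[OF 1])
  also have "\<dots> = (\<Sum>b\<in>Basis. (v \<bullet> b) * (\<Sum>b'\<in>Basis. (w \<bullet> b') * L b b'))"
    by (intro sum.cong refl arg_cong2[where f="(*)"] linear_eq_sum_Basis[OF 2])
  finally show ?thesis by (simp add: sum_distrib_left mult.assoc)
qed

context local_form
begin

lemmas B_add = linear_add[OF lin] and B_scale = linear_scale[OF lin] and B_0 = linear_0[OF lin]

lemma lin1: "u \<in> W \<Longrightarrow> linear (\<lambda>h. B1 u h v)"
  using fderiv has_derivative_linear by blast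

lemma lin2: assumes u: "u \<in> W" shows "linear (B1 u h)"
proof (rule linearI)
  fix v w :: 'e and r :: real
  have "((\<lambda>u. B u v + B u w) has_derivative (\<lambda>h. B1 u h v + B1 u h w)) (at u)"
    by (intro derivative_intros fderiv u)
  then have "((\<lambda>u. B u (v + w)) has_derivative (\<lambda>h. B1 u h v + B1 u h w)) (at u)"
    by (rule has_derivative_transform_within_open[OF _ open_W' u]) (simp add: B_add)
  from has_derivative_unique[OF fderiv[OF u] this]
  show "B1 u h (v + w) = B1 u h v + B1 u h w" by meson
  have "((\<lambda>u. r * B u v) has_derivative (\<lambda>h. r * B1 u h v)) (at u)"
    by (intro has_derivative_mult_right fderiv u)
  then have "((\<lambda>u. B u (r *\<^sub>R v)) has_derivative (\<lambda>h. r * B1 u h v)) (at u)"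
    by (rule has_derivative_transform_within_open[OF _ open_W' u]) (simp add: B_scale)
  from has_derivative_unique[OF fderiv[OF u] this]
  show "B1 u h (r *\<^sub>R v) = r *\<^sub>R B1 u h v" by (metis real_scaleR_def)
qed

lemma bil1: "u \<in> W \<Longrightarrow> bilinear (B1 u)"
  using lin1 lin2 by (simp add: bilinear_def)

lemma cont0: "continuous_on W (\<lambda>u. B u v)"
  by (intro continuous_at_imp_continuous_on ballI has_derivative_continuous[OF fderiv])

lemma cont_B:
  assumes "continuous_on S x" "continuous_on S v" "x ` S \<subseteq> W"
  shows "continuous_on S (\<lambda>t. B (x t) (v t))"
proof -
  have "continuous_on S (\<lambda>t. \<Sum>b\<in>Basis. (v t \<bullet> b) * B (x t) b)"
    by (intro continuous_intros assms continuous_on_compose2[OF cont0])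
  then show ?thesis
    by (rule continuous_on_eq) (use assms(3) in \<open>auto simp: linear_eq_sum_Basis[OF lin, symmetric]\<close>)
qed

lemma cont_B1:
  assumes "continuous_on S x" "continuous_on S h" "continuous_on S v" "x ` S \<subseteq> W"
  shows "continuous_on S (\<lambda>t. B1 (x t) (h t) (v t))"
proof -
  have "continuous_on S (\<lambda>t. \<Sum>b\<in>Basis. \<Sum>b'\<in>Basis. (h t \<bullet> b) * (v t \<bullet> b') * B1 (x t) b b')"
    by (intro continuous_intros assms continuous_on_compose2[OF fcont1])
  then show ?thesis
    by (rule continuous_on_eq) (use assms(4) in \<open>auto simp: bilinear_eq_sum_Basis[OF bil1, symmetric]\<close>)
qed

lemma deriv_B:
  assumes x: "(x has_vector_derivative x') (at t within S)" and v: "(v has_vector_derivative v') (at t within S)"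
    and t: "t \<in> S" and xW: "x ` S \<subseteq> W"
  shows "((\<lambda>t. B (x t) (v t)) has_real_derivative B1 (x t) x' (v t) + B (x t) v') (at t within S)"
proof -
  have u: "x t \<in> W" using t xW by auto
  have c: "((\<lambda>t. B (x t) b) has_real_derivative B1 (x t) x' b) (at t within S)" for b
    using has_vector_derivative_compose[OF x fderiv[OF u]]
    by (simp add: has_real_derivative_iff_has_vector_derivative)
  have d: "((\<lambda>t. v t \<bullet> b) has_real_derivative v' \<bullet> b) (at t within S)" for b
    using bounded_linear.has_vector_derivative[OF bounded_linear_inner_left v]
    by (simp add: has_real_derivative_iff_has_vector_derivative)
  have "((\<lambda>t. \<Sum>b\<in>Basis. (v t \<bullet> b) * B (x t) b) has_real_derivative
     (\<Sum>b\<in>Basis. (v' \<bullet> b) * B (x t) b + B1 (x t) x' b * (v t \<bullet> b))) (at t within S)"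
    by (intro DERIV_sum DERIV_mult c d)
  also have "(\<Sum>b\<in>Basis. (v' \<bullet> b) * B (x t) b + B1 (x t) x' b * (v t \<bullet> b)) = B1 (x t) x' (v t) + B (x t) v'"
    by (simp add: linear_eq_sum_Basis[OF lin[OF u], of v'] linear_eq_sum_Basis[OF lin2[OF u], of _ "v t"]
        sum.distrib mult.commute)
  finally show ?thesis
    by (rule has_field_derivative_transform_within[OF _ zero_less_one t])
      (use xW in \<open>auto simp: linear_eq_sum_Basis[OF lin, symmetric]\<close>)
qed

definition dB :: "'e \<Rightarrow> 'e \<Rightarrow> 'e \<Rightarrow> real" where
  "dB u v w = B1 u v w - B1 u w v"

lemma dB_bil: "u \<in> W \<Longrightarrow> bilinear (dB u)"
  using lin1 lin2 unfolding bilinear_def dB_def by (auto intro!: linear_compose_sub)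

lemma dB_self [simp]: "dB u v v = 0" by (simp add: dB_def)

lemma cont_dB:
  assumes "continuous_on S x" "continuous_on S h" "continuous_on S v" "x ` S \<subseteq> W"
  shows "continuous_on S (\<lambda>t. dB (x t) (h t) (v t))"
  unfolding dB_def by (intro continuous_intros cont_B1 assms)

end

context local_metric
begin

lemma linl: "u \<in> W \<Longrightarrow> linear (\<lambda>v. G u v w)" and linr: "u \<in> W \<Longrightarrow> linear (G u v)"
  using bil unfolding bilinear_def by blast+

lemmas G_ladd = linear_add[OF linl] and G_lscale = linear_scale[OF linl] and G_l0 = linear_0[OF linl]
  and G_ldiff = linear_diff[OF linl] and G_lneg = linear_neg[OF linl]
  and G_radd = linear_add[OF linr] and G_rscale = linear_scale[OF linr] and G_r0 = linear_0[OF linr]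
  and G_rdiff = linear_diff[OF linr] and G_rneg = linear_neg[OF linr]

lemma lin1: "u \<in> W \<Longrightarrow> linear (\<lambda>h. G1 u h v w)"
  using deriv has_derivative_linear by blast

lemma sym1: assumes u: "u \<in> W" shows "G1 u h v w = G1 u h w v"
proof -
  have "((\<lambda>u. G u v w) has_derivative (\<lambda>h. G1 u h w v)) (at u)"
    by (rule has_derivative_transform_within_open[OF deriv[OF u, of w v] open_W u]) (rule sym)
  from has_derivative_unique[OF deriv[OF u] this] show ?thesis by meson
qed

lemma lin3: assumes u: "u \<in> W" shows "linear (G1 u h v)"
proof -
  interpret F: local_form W "\<lambda>u. G u v" "\<lambda>u h. G1 u h v"
    by (intro local_form.intro open_W linr deriv cont1)
  show ?thesis by (rule F.lin2[OF u])
qed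

lemma lin2: assumes u: "u \<in> W" shows "linear (\<lambda>v. G1 u h v w)"
proof -
  have "(\<lambda>v. G1 u h v w) = G1 u h w" by (rule ext) (rule sym1[OF u])
  then show ?thesis using lin3[OF u] by metis
qed

lemma bil1: "u \<in> W \<Longrightarrow> bilinear (G1 u h)"
  using lin2 lin3 by (simp add: bilinear_def)

lemma cont0: "continuous_on W (\<lambda>u. G u v w)"
  by (intro continuous_at_imp_continuous_on ballI has_derivative_continuous[OF deriv])

lemma cont_G:
  assumes "continuous_on S x" "continuous_on S v" "continuous_on S w" "x ` S \<subseteq> W"
  shows "continuous_on S (\<lambda>t. G (x t) (v t) (w t))"
proof -
  have "continuous_on S (\<lambda>t. \<Sum>b\<in>Basis. \<Sum>b'\<in>Basis. (v t \<bullet> b) * (w t \<bullet> b') * G (x t) b b')"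
    by (intro continuous_intros assms continuous_on_compose2[OF cont0])
  then show ?thesis
    by (rule continuous_on_eq) (use assms(4) in \<open>auto simp: bilinear_eq_sum_Basis[OF bil, symmetric]\<close>)
qed

lemma cont_G1:
  assumes "continuous_on S x" "continuous_on S h" "continuous_on S v" "continuous_on S w" "x ` S \<subseteq> W"
  shows "continuous_on S (\<lambda>t. G1 (x t) (h t) (v t) (w t))"
proof -
  have *: "G1 u h v w = (\<Sum>b\<in>Basis. (h \<bullet> b) * (\<Sum>b'\<in>Basis. \<Sum>b''\<in>Basis. (v \<bullet> b') * (w \<bullet> b'') * G1 u b b' b''))"
    if "u \<in> W" for u h v w
    by (subst linear_eq_sum_Basis[OF lin1[OF that]]) (simp only: bilinear_eq_sum_Basis[OF bil1[OF that], of _ v w])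
  have "continuous_on S (\<lambda>t. \<Sum>b\<in>Basis. (h t \<bullet> b) * (\<Sum>b'\<in>Basis. \<Sum>b''\<in>Basis. (v t \<bullet> b') * (w t \<bullet> b'') * G1 (x t) b b' b''))"
    by (intro continuous_intros assms continuous_on_compose2[OF cont1])
  then show ?thesis
    by (rule continuous_on_eq) (use assms(5) * in auto)
qed

lemma deriv_G:
  assumes x: "(x has_vector_derivative x') (at t within S)" and v: "(v has_vector_derivative v') (at t within S)"
    and w: "(w has_vector_derivative w') (at t within S)"
    and t: "t \<in> S" and xW: "x ` S \<subseteq> W"
  shows "((\<lambda>t. G (x t) (v t) (w t)) has_real_derivative
     G1 (x t) x' (v t) (w t) + G (x t) v' (w t) + G (x t) (v t) w') (at t within S)"
proof -
  have u: "x t \<in> W" using t xW by auto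
  have c: "((\<lambda>t. G (x t) b b') has_real_derivative G1 (x t) x' b b') (at t within S)" for b b'
    using has_vector_derivative_compose[OF x deriv[OF u]]
    by (simp add: has_real_derivative_iff_has_vector_derivative)
  have d: "((\<lambda>t. v t \<bullet> b) has_real_derivative v' \<bullet> b) (at t within S)"
    "((\<lambda>t. w t \<bullet> b) has_real_derivative w' \<bullet> b) (at t within S)" for b
    using bounded_linear.has_vector_derivative[OF bounded_linear_inner_left v]
      bounded_linear.has_vector_derivative[OF bounded_linear_inner_left w]
    by (simp_all add: has_real_derivative_iff_has_vector_derivative)
  have "((\<lambda>t. \<Sum>b\<in>Basis. \<Sum>b'\<in>Basis. ((v t \<bullet> b) * (w t \<bullet> b')) * G (x t) b b') has_real_derivative
     (\<Sum>b\<in>Basis. \<Sum>b'\<in>Basis. (((v' \<bullet> b) * (w t \<bullet> b') + (w' \<bullet> b') * (v t \<bullet> b))) * G (x t) b b'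
        + G1 (x t) x' b b' * ((v t \<bullet> b) * (w t \<bullet> b')))) (at t within S)"
    by (intro DERIV_sum DERIV_mult c d)
  also have "(\<Sum>b\<in>Basis. \<Sum>b'\<in>Basis. (((v' \<bullet> b) * (w t \<bullet> b') + (w' \<bullet> b') * (v t \<bullet> b))) * G (x t) b b'
        + G1 (x t) x' b b' * ((v t \<bullet> b) * (w t \<bullet> b'))) = G1 (x t) x' (v t) (w t) + G (x t) v' (w t) + G (x t) (v t) w'"
    by (simp add: bilinear_eq_sum_Basis[OF bil[OF u], of v'] bilinear_eq_sum_Basis[OF bil[OF u], of _ w']
        bilinear_eq_sum_Basis[OF bil1[OF u], of _ "v t"]
        sum.distrib algebra_simps)
  finally show ?thesis
    by (rule has_field_derivative_transform_within[OF _ zero_less_one t])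
      (use xW in \<open>auto simp: bilinear_eq_sum_Basis[OF bil, symmetric]\<close>)
qed

subsection \<open>Raising an index\<close>

text \<open>The vector that corresponds to the linear form \<open>l\<close> under the metric at \<open>u\<close>.\<close>

definition sharp :: "'e \<Rightarrow> ('e \<Rightarrow> real) \<Rightarrow> 'e" where
  "sharp u l = (THE a. \<forall>\<eta>. G u a \<eta> = l \<eta>)"

lemma G_cancel:
  assumes u: "u \<in> W" and "\<And>\<eta>. G u a \<eta> = G u b \<eta>"
  shows "a = b"
proof (rule ccontr)
  assume "a \<noteq> b"
  then have "G u (a - b) (a - b) > 0" using pos[OF u] by simp
  then show False using assms(2)[of "a - b"] G_ldiff[OF u] by simp
qed

text \<open>Sending \<open>a\<close> to the form \<open>G u a\<close> is injective, hence surjective by dimension.\<close>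

lemma sharp:
  assumes u: "u \<in> W" and l: "linear l"
  shows "G u (sharp u l) \<eta> = l \<eta>"
proof -
  define T where "T a = (\<Sum>b\<in>Basis. G u a b *\<^sub>R b)" for a
  have Tb: "T a \<bullet> b = G u a b" if "b \<in> Basis" for a b
    using that by (simp add: T_def inner_sum_left inner_Basis if_distrib sum.delta cong: if_cong)
  have lT: "linear T"
    by (rule linearI) (simp_all add: T_def G_ladd[OF u] G_lscale[OF u] scaleR_add_left sum.distrib scaleR_sum_right)
  have "inj T"
  proof (rule injI)
    fix a b assume "T a = T b"
    then have "G u a b' = G u b b'" if "b' \<in> Basis" for b' using Tb[OF that] by metis
    then have "G u a \<eta> = G u b \<eta>" for \<eta>
      by (subst (1 2) linear_eq_sum_Basis[OF linr[OF u]]) simp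
    then show "a = b" by (rule G_cancel[OF u])
  qed
  then have "surj T" using linear_injective_imp_surjective[OF lT] by blast
  then obtain a where a: "T a = (\<Sum>b\<in>Basis. l b *\<^sub>R b)" by (metis surjD)
  have ab: "G u a b = l b" if "b \<in> Basis" for b
    using that Tb[OF that, of a] by (simp add: a inner_sum_left inner_Basis if_distrib sum.delta cong: if_cong)
  have al: "\<forall>\<eta>. G u a \<eta> = l \<eta>"
    by (intro allI, subst linear_eq_sum_Basis[OF linr[OF u]], subst linear_eq_sum_Basis[OF l]) (simp add: ab)
  then have "\<exists>!a. \<forall>\<eta>. G u a \<eta> = l \<eta>"
    using G_cancel[OF u] by (intro ex1I[of _ a]) auto
  from theI'[OF this] show ?thesis by (simp add: sharp_def)
qed

text \<open>The minimum of \<open>G u v v\<close> over \<open>u\<close> in a compact ball and \<open>v\<close> in the unit sphere is positive.\<close>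

lemma elliptic:
  assumes "u0 \<in> W"
  obtains \<delta> \<mu> where "\<delta> > 0" "\<mu> > 0" "ball u0 \<delta> \<subseteq> W" "\<And>u v. u \<in> ball u0 \<delta> \<Longrightarrow> G u v v \<ge> \<mu> * (norm v)\<^sup>2"
proof -
  obtain \<delta> where \<delta>: "\<delta> > 0" "cball u0 \<delta> \<subseteq> W" using open_W assms open_contains_cball by blast
  define K where "K = cball u0 \<delta> \<times> sphere (0::'e) 1"
  have "compact K" by (simp add: K_def compact_Times)
  obtain b :: 'e where b: "b \<in> Basis" using nonempty_Basis by blast
  then have "(u0, b) \<in> K" using \<delta> by (simp add: K_def)
  then have "K \<noteq> {}" by blast
  have "continuous_on K (\<lambda>(u,v). G u v v)"
    unfolding split_beta by (rule cont_G) (use \<delta> in \<open>auto simp: K_def intro!: continuous_intros\<close>)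
  then obtain m where m: "m \<in> K" "\<forall>y\<in>K. (\<lambda>(u,v). G u v v) m \<le> (\<lambda>(u,v). G u v v) y"
    using continuous_attains_inf[OF \<open>compact K\<close> \<open>K \<noteq> {}\<close>] by blast
  define \<mu> where "\<mu> = G (fst m) (snd m) (snd m)"
  have "snd m \<noteq> 0" using m(1) by (auto simp: K_def)
  then have "\<mu> > 0" using m(1) \<delta> unfolding \<mu>_def by (intro pos) (auto simp: K_def)
  have "G u v v \<ge> \<mu> * (norm v)\<^sup>2" if u: "u \<in> ball u0 \<delta>" for u v
  proof (cases "v = 0")
    case True
    have "u \<in> W" using u \<delta> by auto
    then show ?thesis using True G_r0 by simp
  next
    case False
    have uW: "u \<in> W" using u \<delta> by auto
    define n where "n = norm v"
    have n: "n > 0" using False by (simp add: n_def)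
    define y where "y = v /\<^sub>R n"
    have vn: "v = n *\<^sub>R y" using n by (simp add: y_def)
    have "norm y = 1" using n by (simp add: n_def y_def)
    then have "(u, y) \<in> K" using u by (simp add: K_def)
    then have "\<mu> \<le> G u y y" using m(2) by (auto simp: \<mu>_def split_beta)
    then have "\<mu> * n\<^sup>2 \<le> G u y y * n\<^sup>2"
      by (rule mult_right_mono) simp
    also have "\<dots> = G u v v"
      by (simp add: vn G_lscale[OF uW] G_rscale[OF uW] power2_eq_square)
    finally show ?thesis by (simp add: n_def)
  qed
  then show thesis using that[OF \<delta>(1) \<open>\<mu> > 0\<close>] \<delta>(2) ball_subset_cball[of u0 \<delta>] by blast
qed

text \<open>The solution \<open>a\<close> of \<open>G a = l\<close> depends continuously on \<open>G\<close> and \<open>l\<close>: its deviation from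
  \<open>a\<^sub>0\<close> is bounded by the residual of \<open>a\<^sub>0\<close>, divided by an ellipticity constant.\<close>

lemma cont_sharp:
  fixes x :: "'z::topological_space \<Rightarrow> 'e"
  assumes x: "continuous_on S x" and xW: "x ` S \<subseteq> W" and l: "\<And>t. t \<in> S \<Longrightarrow> linear (l t)"
    and cl: "\<And>\<eta>. continuous_on S (\<lambda>t. l t \<eta>)"
  shows "continuous_on S (\<lambda>t. sharp (x t) (l t))"
  unfolding continuous_on_def
proof
  fix t0 assume t0: "t0 \<in> S"
  define a0 where "a0 = sharp (x t0) (l t0)"
  have "x t0 \<in> W" using t0 xW by auto
  then obtain \<delta> \<mu> where d: "\<delta> > 0" "\<mu> > 0" "ball (x t0) \<delta> \<subseteq> W"
    and ell: "\<And>u v. u \<in> ball (x t0) \<delta> \<Longrightarrow> G u v v \<ge> \<mu> * (norm v)\<^sup>2"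
    using elliptic by blast
  define C where "C t = (\<Sum>b\<in>Basis. \<bar>l t b - G (x t) a0 b\<bar>)" for t
  have est: "norm (sharp (x t) (l t) - a0) \<le> C t / \<mu>" if t: "t \<in> S" "x t \<in> ball (x t0) \<delta>" for t
  proof -
    define a where "a = sharp (x t) (l t)"
    have u: "x t \<in> W" using t xW by auto
    have ln: "linear (\<lambda>\<eta>. l t \<eta> - G (x t) a0 \<eta>)"
      by (intro linear_compose_sub l t linr u)
    have "\<mu> * (norm (a - a0))\<^sup>2 \<le> G (x t) (a - a0) (a - a0)" by (rule ell[OF t(2)])
    also have "\<dots> = l t (a - a0) - G (x t) a0 (a - a0)"
      using sharp[OF u l[OF t(1)]] by (simp add: G_ldiff[OF u] a_def)
    also have "\<dots> = (\<Sum>b\<in>Basis. ((a - a0) \<bullet> b) * (l t b - G (x t) a0 b))"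
      by (rule linear_eq_sum_Basis[OF ln])
    also have "\<dots> \<le> (\<Sum>b\<in>Basis. norm (a - a0) * \<bar>l t b - G (x t) a0 b\<bar>)"
    proof (rule sum_mono)
      fix b :: 'e assume b: "b \<in> Basis"
      have "((a - a0) \<bullet> b) * (l t b - G (x t) a0 b) \<le> \<bar>(a - a0) \<bullet> b\<bar> * \<bar>l t b - G (x t) a0 b\<bar>"
        by (metis abs_ge_self abs_mult)
      also have "\<dots> \<le> norm (a - a0) * \<bar>l t b - G (x t) a0 b\<bar>"
        using Basis_le_norm[OF b] by (intro mult_right_mono) auto
      finally show "((a - a0) \<bullet> b) * (l t b - G (x t) a0 b) \<le> norm (a - a0) * \<bar>l t b - G (x t) a0 b\<bar>" .
    qed
    also have "\<dots> = norm (a - a0) * C t" by (simp add: C_def sum_distrib_left)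
    finally have *: "norm (a - a0) * (\<mu> * norm (a - a0)) \<le> norm (a - a0) * C t"
      by (simp add: power2_eq_square algebra_simps)
    have "C t \<ge> 0" by (simp add: C_def sum_nonneg)
    then have "\<mu> * norm (a - a0) \<le> C t"
    proof (cases "a = a0")
      case False
      then have "norm (a - a0) > 0" by simp
      then show ?thesis using * by (rule mult_left_le_imp_le[rotated])
    qed auto
    then show ?thesis using d(2) by (simp add: a_def pos_le_divide_eq mult.commute)
  qed
  have "continuous_on S C"
    unfolding C_def by (intro continuous_intros cl cont_G x xW)
  then have "(C \<longlongrightarrow> C t0) (at t0 within S)" using t0 by (simp add: continuous_on_def)
  moreover have "C t0 = 0"
    using sharp[OF \<open>x t0 \<in> W\<close> l[OF t0]] by (simp add: C_def a0_def)
  ultimately have "(C \<longlongrightarrow> 0) (at t0 within S)" by simp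
  then have C0: "((\<lambda>t. C t / \<mu>) \<longlongrightarrow> 0) (at t0 within S)"
    using tendsto_divide_zero by blast
  have "(x \<longlongrightarrow> x t0) (at t0 within S)" using x t0 by (simp add: continuous_on_def)
  then have "\<forall>\<^sub>F t in at t0 within S. x t \<in> ball (x t0) \<delta>"
    using d(1) by (intro topological_tendstoD) auto
  then have "\<forall>\<^sub>F t in at t0 within S. norm (sharp (x t) (l t) - a0) \<le> C t / \<mu>"
    using eventually_at_topological est by (auto simp: eventually_at_filter elim: eventually_mono)
  then have "((\<lambda>t. sharp (x t) (l t) - a0) \<longlongrightarrow> 0) (at t0 within S)"
    by (rule Lim_null_comparison[OF _ C0])
  then show "((\<lambda>t. sharp (x t) (l t)) \<longlongrightarrow> sharp (x t0) (l t0)) (at t0 within S)"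
    by (simp only: LIM_zero_iff a0_def)
qed

subsection \<open>The Levi-Civita connection\<close>

definition chris :: "'e \<Rightarrow> 'e \<Rightarrow> 'e \<Rightarrow> 'e" where
  "chris u v w = sharp u (\<lambda>\<eta>. (G1 u v w \<eta> + G1 u w v \<eta> - G1 u \<eta> v w) / 2)"

lemma chris_lin:
  assumes u: "u \<in> W" shows "linear (\<lambda>\<eta>. (G1 u v w \<eta> + G1 u w v \<eta> - G1 u \<eta> v w) / 2)"
proof -
  have "linear (\<lambda>\<eta>. (1/2) *\<^sub>R (G1 u v w \<eta> + G1 u w v \<eta> - G1 u \<eta> v w))"
    by (intro linear_compose_scale_right linear_compose_sub linear_compose_add lin1 lin3 u)
  then show ?thesis by (simp add: field_simps)
qed

lemma G_chris:
  assumes u: "u \<in> W" shows "G u (chris u v w) \<eta> = (G1 u v w \<eta> + G1 u w v \<eta> - G1 u \<eta> v w) / 2"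
  unfolding chris_def by (rule sharp[OF u chris_lin[OF u]])

lemma chris_sym: "u \<in> W \<Longrightarrow> chris u v w = chris u w v"
  using sym1[of u _ v w] by (simp add: chris_def add.commute)

lemma chris_linear: assumes u: "u \<in> W" shows "linear (chris u v)"
proof (rule linearI; rule G_cancel[OF u])
  fix w w' \<eta> and r :: real
  show "G u (chris u v (w + w')) \<eta> = G u (chris u v w + chris u v w') \<eta>"
    by (simp add: G_ladd[OF u] G_chris[OF u] linear_add[OF lin1[OF u]] linear_add[OF lin2[OF u]]
        linear_add[OF lin3[OF u]] field_simps)
  show "G u (chris u v (r *\<^sub>R w)) \<eta> = G u (r *\<^sub>R chris u v w) \<eta>"
    by (simp add: G_lscale[OF u] G_chris[OF u] linear_scale[OF lin1[OF u]] linear_scale[OF lin2[OF u]]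
        linear_scale[OF lin3[OF u]] field_simps)
qed

lemma G1_eq_chris:
  assumes u: "u \<in> W" shows "G1 u h v w = G u (chris u h v) w + G u v (chris u h w)"
  using G_chris[OF u, of h v w] G_chris[OF u, of h w v] sym1[OF u, of h v w] sym1[OF u, of v h w]
    sym1[OF u, of w v h] sym[OF u, of v "chris u h w"]
  by (simp add: field_simps)

lemma cont_chris:
  assumes "continuous_on S x" "continuous_on S v" "continuous_on S w" "x ` S \<subseteq> W"
  shows "continuous_on S (\<lambda>t. chris (x t) (v t) (w t))"
  unfolding chris_def
proof (rule cont_sharp[OF assms(1,4)])
  show "linear (\<lambda>\<eta>. (G1 (x t) (v t) (w t) \<eta> + G1 (x t) (w t) (v t) \<eta> - G1 (x t) \<eta> (v t) (w t)) / 2)"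
    if "t \<in> S" for t using that assms(4) by (intro chris_lin) auto
  show "continuous_on S (\<lambda>t. (G1 (x t) (v t) (w t) \<eta> + G1 (x t) (w t) (v t) \<eta> - G1 (x t) \<eta> (v t) (w t)) / 2)" for \<eta>
    by (intro continuous_intros cont_G1 assms) auto
qed

definition nrm :: "'e \<Rightarrow> 'e \<Rightarrow> real" where
  "nrm u v = sqrt (G u v v)"

lemma nrm_pos: "u \<in> W \<Longrightarrow> v \<noteq> 0 \<Longrightarrow> nrm u v > 0"
  using pos by (simp add: nrm_def)

lemma nrm_sq: "u \<in> W \<Longrightarrow> nrm u v * nrm u v = G u v v"
  using pos[of u v] by (cases "v = 0") (auto simp: nrm_def G_r0 G_l0)

lemma nrm_scale: "u \<in> W \<Longrightarrow> nrm u (r *\<^sub>R v) = \<bar>r\<bar> * nrm u v"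
  by (simp add: nrm_def G_lscale G_rscale real_sqrt_mult flip: power2_eq_square mult.assoc)

lemma cont_nrm:
  assumes "continuous_on S x" "continuous_on S v" "x ` S \<subseteq> W"
  shows "continuous_on S (\<lambda>t. nrm (x t) (v t))"
  unfolding nrm_def by (intro continuous_intros cont_G assms)

lemma deriv_nrm:
  assumes x: "(x has_vector_derivative x') (at t within S)" and v: "(v has_vector_derivative v') (at t within S)"
    and t: "t \<in> S" and xW: "x ` S \<subseteq> W" and v0: "v t \<noteq> 0"
  shows "((\<lambda>t. nrm (x t) (v t)) has_real_derivative
     (G1 (x t) x' (v t) (v t) + 2 * G (x t) v' (v t)) / (2 * nrm (x t) (v t))) (at t within S)"
proof -
  have u: "x t \<in> W" using t xW by auto
  have "((\<lambda>t. sqrt (G (x t) (v t) (v t))) has_real_derivative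
    (G1 (x t) x' (v t) (v t) + G (x t) v' (v t) + G (x t) (v t) v') * (inverse (sqrt (G (x t) (v t) (v t))) / 2)) (at t within S)"
    using DERIV_chain2[OF DERIV_real_sqrt[OF pos[OF u v0]] deriv_G[OF x v v t xW]] by (simp add: mult.commute)
  moreover have "(a + b + b) * (inverse s / 2) = (a + 2 * b) / (2 * s)" for a b s :: real
    by (cases "s = 0") (auto simp: field_simps)
  ultimately show ?thesis
    unfolding nrm_def sym[OF u, of "v t" v'] by (simp only:)
qed

end

section \<open>The Euler-Lagrange equation of a Randers metric\<close>

locale local_randers = local_metric W G G1 + F: local_form W B B1
  for W :: "'e::euclidean_space set" and G G1 B B1
begin

text \<open>The endomorphism that corresponds to the exterior derivative of the one-form under the
  metric.\<close>

definition J :: "'e \<Rightarrow> 'e \<Rightarrow> 'e" where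
  "J u v = sharp u (F.dB u v)"

text \<open>For the Lagrangian \<open>L = \<surd>G u v v + B u v\<close>, this is \<open>\<partial>L/\<partial>u - d/dt (\<partial>L/\<partial>v)\<close>, paired with \<open>\<eta>\<close>, at
  a point of a curve with velocity \<open>v\<close> and acceleration \<open>a\<close>.\<close>

definition EL :: "'e \<Rightarrow> 'e \<Rightarrow> 'e \<Rightarrow> 'e \<Rightarrow> real" where
  "EL u v a \<eta> = (G1 u \<eta> v v / 2 - G1 u v v \<eta> - G u a \<eta>) / nrm u v
     + G u v \<eta> * (G1 u v v v + 2 * G u a v) / (2 * nrm u v ^ 3) - F.dB u v \<eta>"

text \<open>The acceleration of the extremals that are parametrized with constant \<open>G\<close>-speed.\<close>

definition spray :: "'e \<Rightarrow> 'e \<Rightarrow> 'e" where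
  "spray u v = - chris u v v - nrm u v *\<^sub>R J u v"

definition lag :: "'e \<Rightarrow> 'e \<Rightarrow> real" where
  "lag u v = nrm u v + B u v"

lemma dB_lin: "u \<in> W \<Longrightarrow> linear (F.dB u v)"
  using F.dB_bil unfolding bilinear_def by blast

lemma G_J: "u \<in> W \<Longrightarrow> G u (J u v) \<eta> = F.dB u v \<eta>"
  unfolding J_def by (rule sharp[OF _ dB_lin])

lemma J_linear: assumes u: "u \<in> W" shows "linear (J u)"
proof -
  have l: "linear (\<lambda>v. F.dB u v \<eta>)" for \<eta> using F.dB_bil[OF u] unfolding bilinear_def by blast
  show ?thesis
    by (rule linearI; rule G_cancel[OF u])
      (simp_all add: G_J[OF u] G_ladd[OF u] G_lscale[OF u] linear_add[OF l] linear_scale[OF l])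
qed

lemma EL_eq:
  assumes u: "u \<in> W"
  shows "EL u v a \<eta> = - G u (a + chris u v v) \<eta> / nrm u v
    + G u v \<eta> * G u (a + chris u v v) v / nrm u v ^ 3 - F.dB u v \<eta>"
proof -
  have 1: "G u (chris u v v) \<eta> = G1 u v v \<eta> - G1 u \<eta> v v / 2"
    by (simp add: G_chris[OF u] field_simps)
  have 2: "G u (chris u v v) v = G1 u v v v / 2" by (simp add: G_chris[OF u])
  have 3: "- (c + (d - e / 2)) / n = (e / 2 - d - c) / n" for c d e n :: real
    by (simp add: algebra_simps)
  have 4: "g * (k + l / 2) / n = g * (l + 2 * k) / (2 * n)" for g k l n :: real
    by (cases "n = 0") (simp_all add: field_simps)
  show ?thesis unfolding EL_def G_ladd[OF u] 1 2 3 4 ..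
qed

text \<open>Since \<open>J v\<close> is orthogonal to \<open>v\<close>, the expression \<open>EL\<close> is, up to the factor \<open>-1 / |v|\<close>, the
  component orthogonal to \<open>v\<close> of the left-hand side of the equation. Orthogonality of \<open>EL\<close> to \<open>v\<close>
  reflects that length does not depend on the parameter.\<close>

lemma EL_zero_iff:
  assumes u: "u \<in> W" and v: "v \<noteq> 0"
  shows "(\<forall>\<eta>. EL u v a \<eta> = 0) \<longleftrightarrow> (\<exists>c. a + chris u v v + nrm u v *\<^sub>R J u v = c *\<^sub>R v)"
proof -
  define n where "n = nrm u v"
  define p where "p = a + chris u v v"
  have n: "n > 0" using nrm_pos[OF u v] by (simp add: n_def)
  have nn: "G u v v = n * n" using nrm_sq[OF u, of v] by (simp add: n_def)
  have eq: "n * EL u v a \<eta> = - G u (p + n *\<^sub>R J u v - (G u p v / n\<^sup>2) *\<^sub>R v) \<eta>" for \<eta>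
    using n unfolding EL_eq[OF u] p_def[symmetric] n_def[symmetric]
    by (simp add: G_ladd[OF u] G_ldiff[OF u] G_lscale[OF u] G_J[OF u] field_simps power2_eq_square power3_eq_cube)
  show ?thesis
  proof
    assume "\<forall>\<eta>. EL u v a \<eta> = 0"
    then have "G u (p + n *\<^sub>R J u v - (G u p v / n\<^sup>2) *\<^sub>R v) \<eta> = G u 0 \<eta>" for \<eta>
      using eq[of \<eta>] G_l0[OF u] by simp
    then have "p + n *\<^sub>R J u v - (G u p v / n\<^sup>2) *\<^sub>R v = 0" by (rule G_cancel[OF u])
    then have "p + n *\<^sub>R J u v = (G u p v / n\<^sup>2) *\<^sub>R v" by simp
    then show "\<exists>c. a + chris u v v + nrm u v *\<^sub>R J u v = c *\<^sub>R v" unfolding p_def n_def by blast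
  next
    assume "\<exists>c. a + chris u v v + nrm u v *\<^sub>R J u v = c *\<^sub>R v"
    then obtain c where c: "p + n *\<^sub>R J u v = c *\<^sub>R v" unfolding p_def n_def by blast
    have "G u (p + n *\<^sub>R J u v) v = G u p v"
      by (simp add: G_ladd[OF u] G_lscale[OF u] G_J[OF u])
    then have "G u p v = c * n\<^sup>2"
      unfolding c by (simp add: G_lscale[OF u] nn power2_eq_square)
    then have "c = G u p v / n\<^sup>2" using n by simp
    then have "p + n *\<^sub>R J u v - (G u p v / n\<^sup>2) *\<^sub>R v = 0" using c by simp
    then have "n * EL u v a \<eta> = 0" for \<eta> unfolding eq using G_l0[OF u] by simp
    then show "\<forall>\<eta>. EL u v a \<eta> = 0" using n by simp
  qed
qed

lemma EL_spray: "u \<in> W \<Longrightarrow> v \<noteq> 0 \<Longrightarrow> EL u v (spray u v) \<eta> = 0"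
  using EL_zero_iff[of u v "spray u v"] by (auto simp: spray_def intro: exI[of _ 0])

lemma EL_linear:
  assumes u: "u \<in> W" shows "linear (EL u v a)"
proof -
  have "linear (\<lambda>\<eta>. (- 1 / nrm u v) *\<^sub>R G u (a + chris u v v) \<eta>
    + (G u (a + chris u v v) v / nrm u v ^ 3) *\<^sub>R G u v \<eta> - F.dB u v \<eta>)"
    by (intro linear_compose_sub linear_compose_add linear_compose_scale_right linr dB_lin u)
  moreover have "EL u v a = (\<lambda>\<eta>. (- 1 / nrm u v) *\<^sub>R G u (a + chris u v v) \<eta>
    + (G u (a + chris u v v) v / nrm u v ^ 3) *\<^sub>R G u v \<eta> - F.dB u v \<eta>)"
    by (rule ext) (simp add: EL_eq[OF u] field_simps)
  ultimately show ?thesis by simp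
qed

lemma cont_J:
  assumes "continuous_on S x" "continuous_on S v" "x ` S \<subseteq> W"
  shows "continuous_on S (\<lambda>t. J (x t) (v t))"
  unfolding J_def
proof (rule cont_sharp[OF assms(1,3)])
  show "linear (F.dB (x t) (v t))" if "t \<in> S" for t
    using that assms(3) by (intro dB_lin) auto
  show "continuous_on S (\<lambda>t. F.dB (x t) (v t) \<eta>)" for \<eta>
    by (intro F.cont_dB assms continuous_on_const)
qed

lemma cont_spray:
  assumes "continuous_on S x" "continuous_on S v" "x ` S \<subseteq> W"
  shows "continuous_on S (\<lambda>t. spray (x t) (v t))"
  unfolding spray_def by (intro continuous_intros cont_chris cont_J cont_nrm assms)

lemma cont_EL:
  assumes "continuous_on S x" "continuous_on S v" "continuous_on S a" "continuous_on S \<eta>" "x ` S \<subseteq> W"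
    and "\<And>t. t \<in> S \<Longrightarrow> v t \<noteq> 0"
  shows "continuous_on S (\<lambda>t. EL (x t) (v t) (a t) (\<eta> t))"
proof -
  have nz: "nrm (x t) (v t) \<noteq> 0" if "t \<in> S" for t
    using nrm_pos[of "x t" "v t"] that assms(5,6) by force
  show ?thesis
    unfolding EL_def
    by (intro continuous_intros cont_G cont_G1 F.cont_dB cont_nrm assms) (use nz in auto)
qed

subsection \<open>Solutions of the geodesic equation\<close>

text \<open>Time of existence and distance from the straight line are uniform in the initial data. The
  bounds serve to aim geodesics at a given ball.\<close>

lemma spray_solution:
  assumes p: "p \<in> W" and R: "R \<ge> 0"
  obtains \<delta> \<tau> C where "\<delta> > 0" "\<tau> > 0" "C \<ge> 0" "cball p \<delta> \<subseteq> W"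
    "\<And>u v. u \<in> cball p \<delta> \<Longrightarrow> norm v \<le> R \<Longrightarrow> \<exists>x x'. x 0 = u \<and> x' 0 = v \<and>
       (\<forall>t\<in>{0..\<tau>}. x t \<in> W \<and> (x has_vector_derivative x' t) (at t within {0..\<tau>}) \<and>
          (x' has_vector_derivative spray (x t) (x' t)) (at t within {0..\<tau>}) \<and>
          norm (x' t - v) \<le> C * t \<and> norm (x t - u - t *\<^sub>R v) \<le> C * t\<^sup>2)"
proof -
  obtain d where d: "d > 0" "cball p d \<subseteq> W" using open_W p open_contains_cball by blast
  define \<delta> where "\<delta> = d / 2"
  define K where "K = cball p d \<times> cball (0::'e) (R + 1)"
  define f where "f y = (snd y, spray (fst y) (snd y))" for y :: "'e \<times> 'e"
  have contf: "continuous_on K f"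
    unfolding f_def by (intro continuous_intros cont_spray) (use d in \<open>auto simp: K_def\<close>)
  have "compact K" by (simp add: K_def compact_Times)
  then have "compact (f ` K)" using contf compact_continuous_image by blast
  then obtain M where M: "M > 0" "\<And>y. y \<in> K \<Longrightarrow> norm (f y) \<le> M"
    using compact_imp_bounded bounded_pos by (metis image_eqI)
  define \<rho> where "\<rho> = min \<delta> 1"
  have \<rho>: "\<rho> > 0" "\<rho> \<le> d / 2" "\<rho> \<le> 1" using d by (auto simp: \<rho>_def \<delta>_def)
  define \<tau> where "\<tau> = \<rho> / M"
  have \<tau>: "\<tau> > 0" "\<tau> * M \<le> \<rho>" using \<rho> M by (auto simp: \<tau>_def)
  show thesis
  proof (rule that[of \<delta> \<tau> M])
    show "\<delta> > 0" "\<tau> > 0" "M \<ge> 0" using d \<tau> M by (auto simp: \<delta>_def)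
    show "cball p \<delta> \<subseteq> W" using d by (auto simp: \<delta>_def)
    fix u v :: 'e assume u: "u \<in> cball p \<delta>" and v: "norm v \<le> R"
    have sub: "cball (u, v) \<rho> \<subseteq> K"
    proof
      fix y assume y: "y \<in> cball (u, v) \<rho>"
      have "dist u (fst y) \<le> \<rho>" "dist v (snd y) \<le> \<rho>"
        using y order_trans[OF dist_fst_le[of "(u,v)" y]] order_trans[OF dist_snd_le[of "(u,v)" y]] by auto
      moreover have "dist p (fst y) \<le> dist p u + dist u (fst y)" by (rule dist_triangle)
      moreover have "norm (snd y) \<le> norm v + dist v (snd y)"
        by (metis dist_commute dist_norm norm_triangle_sub add.commute)
      ultimately show "y \<in> K"
        using u v \<rho> by (auto simp: K_def \<delta>_def mem_Times_iff)
    qed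
    obtain y where y: "y 0 = (u, v)" "\<And>t. t \<in> {0..\<tau>} \<Longrightarrow> y t \<in> cball (u, v) \<rho>"
      "\<And>t. t \<in> {0..\<tau>} \<Longrightarrow> (y has_vector_derivative f (y t)) (at t within {0..\<tau>})"
      using Peano_existence[OF continuous_on_subset[OF contf sub] M(2)[OF subsetD[OF sub]] \<tau> less_imp_le[OF \<rho>(1)]] by blast
    define x where "x t = fst (y t)" for t
    define x' where "x' t = snd (y t)" for t
    have yK: "y t \<in> K" if "t \<in> {0..\<tau>}" for t using y(2)[OF that] sub by auto
    have dx: "(x has_vector_derivative x' t) (at t within {0..\<tau>})" if "t \<in> {0..\<tau>}" for t
      using bounded_linear.has_vector_derivative[OF bounded_linear_fst y(3)[OF that]]
      by (simp add: x_def[abs_def] x'_def f_def)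
    have dx': "(x' has_vector_derivative spray (x t) (x' t)) (at t within {0..\<tau>})" if "t \<in> {0..\<tau>}" for t
      using bounded_linear.has_vector_derivative[OF bounded_linear_snd y(3)[OF that]]
      by (simp add: x_def x'_def[abs_def] f_def)
    have bound: "norm (g t - g 0) \<le> N * t"
      if t: "t \<in> {0..\<tau>}" and g: "\<And>s. s \<in> {0..t} \<Longrightarrow> (g has_vector_derivative g' s) (at s within {0..t})"
        and N: "\<And>s. s \<in> {0..t} \<Longrightarrow> norm (g' s) \<le> N" for g g' :: "real \<Rightarrow> 'e" and N t
    proof -
      have "norm (g t - g 0) \<le> N * norm (t - 0)"
      proof (rule differentiable_bound[of "{0..t}" g "\<lambda>s h. h *\<^sub>R g' s"])
        show "(g has_derivative (\<lambda>h. h *\<^sub>R g' s)) (at s within {0..t})" if "s \<in> {0..t}" for s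
          using g[OF that] by (simp add: has_vector_derivative_def)
        show "onorm (\<lambda>h. h *\<^sub>R g' s) \<le> N" if "s \<in> {0..t}" for s
        proof (rule onorm_le)
          fix d :: real
          have "\<bar>d\<bar> * norm (g' s) \<le> \<bar>d\<bar> * N" by (rule mult_left_mono[OF N[OF that]]) simp
          then show "norm (d *\<^sub>R g' s) \<le> N * norm d" by (simp add: mult.commute)
        qed
      qed (use t in auto)
      then show ?thesis using t by simp
    qed
    have b1: "norm (x' t - v) \<le> M * t" if t: "t \<in> {0..\<tau>}" for t
    proof -
      have "norm (x' t - x' 0) \<le> M * t"
      proof (rule bound[OF t])
        fix s assume s: "s \<in> {0..t}"
        then have s': "s \<in> {0..\<tau>}" using t by auto
        show "(x' has_vector_derivative spray (x s) (x' s)) (at s within {0..t})"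
          by (rule has_vector_derivative_within_subset[OF dx'[OF s']]) (use t in auto)
        have "norm (snd (f (y s))) \<le> norm (f (y s))" using norm_snd_le[of "snd (f (y s))" "fst (f (y s))"] by simp
        then show "norm (spray (x s) (x' s)) \<le> M"
          using M(2)[OF yK[OF s']] by (simp add: f_def x_def x'_def)
      qed
      then show ?thesis using y(1) by (simp add: x'_def)
    qed
    have b2: "norm (x t - u - t *\<^sub>R v) \<le> M * t\<^sup>2" if t: "t \<in> {0..\<tau>}" for t
    proof -
      have "norm ((x t - t *\<^sub>R v) - (x 0 - 0 *\<^sub>R v)) \<le> (M * t) * t"
      proof (rule bound[OF t])
        fix s assume s: "s \<in> {0..t}"
        then have s': "s \<in> {0..\<tau>}" using t by auto
        have "(x has_vector_derivative x' s) (at s within {0..t})"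
          by (rule has_vector_derivative_within_subset[OF dx[OF s']]) (use t in auto)
        moreover have "((\<lambda>t. t *\<^sub>R v) has_vector_derivative v) (at s within {0..t})"
          by (auto intro!: derivative_eq_intros simp: has_vector_derivative_def)
        ultimately show "((\<lambda>t. x t - t *\<^sub>R v) has_vector_derivative x' s - v) (at s within {0..t})"
          by (rule has_vector_derivative_diff)
        have "norm (x' s - v) \<le> M * s" by (rule b1[OF s'])
        also have "\<dots> \<le> M * t" using s M by (intro mult_left_mono) auto
        finally show "norm (x' s - v) \<le> M * t" .
      qed
      then show ?thesis using y(1) by (simp add: x_def algebra_simps power2_eq_square)
    qed
    show "\<exists>x x'. x 0 = u \<and> x' 0 = v \<and>
       (\<forall>t\<in>{0..\<tau>}. x t \<in> W \<and> (x has_vector_derivative x' t) (at t within {0..\<tau>}) \<and>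
          (x' has_vector_derivative spray (x t) (x' t)) (at t within {0..\<tau>}) \<and>
          norm (x' t - v) \<le> M * t \<and> norm (x t - u - t *\<^sub>R v) \<le> M * t\<^sup>2)"
    proof (rule exI[of _ x], rule exI[of _ x'], intro conjI ballI)
      show "x 0 = u" "x' 0 = v" using y(1) by (simp_all add: x_def x'_def)
      show "x t \<in> W" if "t \<in> {0..\<tau>}" for t using yK[OF that] d by (auto simp: x_def K_def)
    qed (use dx dx' b1 b2 in auto)
  qed
qed

subsection \<open>The first variation of length\<close>

lemma deriv_lag:
  assumes x: "(x has_vector_derivative x') (at t within S)" and v: "(v has_vector_derivative v') (at t within S)"
    and t: "t \<in> S" and xW: "x ` S \<subseteq> W" and v0: "v t \<noteq> 0"
  shows "((\<lambda>t. lag (x t) (v t)) has_real_derivative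
     (G1 (x t) x' (v t) (v t) + 2 * G (x t) v' (v t)) / (2 * nrm (x t) (v t)) + (B1 (x t) x' (v t) + B (x t) v')) (at t within S)"
  unfolding lag_def by (intro DERIV_add deriv_nrm[OF assms] F.deriv_B[OF x v t xW])

text \<open>Along the curve, the derivative of the integrand in the direction of the variation and the
  Euler-Lagrange expression differ by the derivative of the momentum, paired with the variation.\<close>

lemma deriv_momentum:
  assumes z: "(z has_vector_derivative v t) (at t within S)" and v: "(v has_vector_derivative a) (at t within S)"
    and \<eta>: "(\<eta> has_vector_derivative \<eta>') (at t within S)"
    and t: "t \<in> S" and zW: "z ` S \<subseteq> W" and v0: "v t \<noteq> 0"
  shows "((\<lambda>t. G (z t) (v t) (\<eta> t) / nrm (z t) (v t) + B (z t) (\<eta> t)) has_real_derivative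
     (G1 (z t) (\<eta> t) (v t) (v t) + 2 * G (z t) \<eta>' (v t)) / (2 * nrm (z t) (v t)) + (B1 (z t) (\<eta> t) (v t) + B (z t) \<eta>')
     - EL (z t) (v t) a (\<eta> t)) (at t within S)"
proof -
  have u: "z t \<in> W" using t zW by auto
  define n where "n = nrm (z t) (v t)"
  have n: "n > 0" using nrm_pos[OF u v0] by (simp add: n_def)
  have "((\<lambda>t. G (z t) (v t) (\<eta> t) / nrm (z t) (v t) + B (z t) (\<eta> t)) has_real_derivative
    ((G1 (z t) (v t) (v t) (\<eta> t) + G (z t) a (\<eta> t) + G (z t) (v t) \<eta>') * nrm (z t) (v t)
      - G (z t) (v t) (\<eta> t) * ((G1 (z t) (v t) (v t) (v t) + 2 * G (z t) a (v t)) / (2 * nrm (z t) (v t))))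
      / (nrm (z t) (v t) * nrm (z t) (v t)) + (B1 (z t) (v t) (\<eta> t) + B (z t) \<eta>')) (at t within S)"
    using nrm_pos[OF u v0]
    by (intro DERIV_add DERIV_divide deriv_G[OF z v \<eta> t zW] deriv_nrm[OF z v t zW v0] F.deriv_B[OF z \<eta> t zW]) simp
  then show ?thesis
    by (rule DERIV_cong)
      (use n in \<open>simp add: EL_def F.dB_def n_def[symmetric] sym[OF u, of \<eta>' "v t"] field_simps power3_eq_cube\<close>)
qed

text \<open>After differentiation under the integral sign, the integrand is \<open>EL\<close> plus the derivative of a
  function that vanishes at both ends of the interval, because the end points of the variation are
  fixed.\<close>

lemma first_variation:
  fixes h :: "real \<times> real \<Rightarrow> 'e"
  assumes ab: "a < b" and \<epsilon>: "\<epsilon> > 0"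
    and C2: "Ck_on 2 h ({-\<epsilon><..<\<epsilon>} \<times> {a..b})" and hW: "h ` ({-\<epsilon><..<\<epsilon>} \<times> {a..b}) \<subseteq> W"
    and h0: "\<And>t. t \<in> {a..b} \<Longrightarrow> h (0, t) = z t"
    and z: "\<And>t. t \<in> {a..b} \<Longrightarrow> (z has_vector_derivative v t) (at t within {a..b})"
    and v: "\<And>t. t \<in> {a..b} \<Longrightarrow> (v has_vector_derivative acc t) (at t within {a..b})"
    and cacc: "continuous_on {a..b} acc" and v0: "\<And>t. t \<in> {a..b} \<Longrightarrow> v t \<noteq> 0"
    and ends: "\<And>s. s \<in> {-\<epsilon><..<\<epsilon>} \<Longrightarrow> h (s, a) = z a \<and> h (s, b) = z b"
    and \<eta>: "\<And>t. t \<in> {a..b} \<Longrightarrow> ((\<lambda>s. h (s, t)) has_vector_derivative \<eta> t) (at 0)"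
  shows "((\<lambda>s. integral {a..b} (\<lambda>t. lag (h (s, t)) (vector_derivative (\<lambda>r. h (s, r)) (at t within {a..b}))))
    has_real_derivative integral {a..b} (\<lambda>t. EL (z t) (v t) (acc t) (\<eta> t))) (at 0)"
proof -
  define U where "U = {-\<epsilon><..<\<epsilon>}"
  define S where "S = U \<times> {a..b}"
  have U: "open U" "convex U" "0 \<in> U" "interior U = U" using \<epsilon> by (auto simp: U_def)
  have hS: "h x \<in> W" if "x \<in> S" for x using hW that by (auto simp: S_def U_def)
  obtain D where D: "\<forall>x\<in>S. (h has_derivative D x) (at x within S)" "\<forall>v. Ck_on 1 (\<lambda>x. D x v) S"
    using C2 by (auto simp: numeral_2_eq_2 S_def U_def)
  obtain D2 where D2: "\<forall>x\<in>S. ((\<lambda>x. D x (0,1)) has_derivative D2 x) (at x within S)"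
    "\<forall>v. continuous_on S (\<lambda>x. D2 x v)"
    using spec[OF D(2), of "(0,1)"] by auto
  have contD: "continuous_on S (\<lambda>x. D x w)" for w
    using Ck_on_imp_continuous_on[OF spec[OF D(2)]] .
  define Ht where "Ht s t = D (s,t) (0,1)" for s t
  define Hs where "Hs s t = D (s,t) (1,0)" for s t
  define Hts where "Hts s t = D2 (s,t) (1,0)" for s t
  have partial: "((\<lambda>r. f (c r)) has_vector_derivative f' (c r) c') (at r within T)"
    if f: "\<forall>x\<in>S. (f has_derivative f' x) (at x within S)" and c: "(c has_vector_derivative c') (at r within T)"
      and T: "c ` T \<subseteq> S" "r \<in> T" for f :: "real \<times> real \<Rightarrow> 'e" and f' c c' and r :: real and T
  proof -
    have "c r \<in> S" using T by auto
    then have l: "linear (f' (c r))" using f has_derivative_linear by blast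
    have "((\<lambda>r. f (c r)) has_derivative (\<lambda>d. f' (c r) (d *\<^sub>R c'))) (at r within T)"
      by (rule has_derivative_in_compose2[where t=S and g=f and g'=f', OF _ T c[unfolded has_vector_derivative_def]])
        (rule bspec[OF f])
    then show ?thesis unfolding has_vector_derivative_def by (simp only: linear_scale[OF l])
  qed
  have cs: "((\<lambda>s. (s, t)) has_vector_derivative (1, 0)) (at s within T)"
    and ct: "((\<lambda>t. (s, t)) has_vector_derivative (0, 1)) (at t within T)" for s t :: real and T
    by (auto intro!: derivative_eq_intros simp: has_vector_derivative_def)
  have dt: "((\<lambda>r. h (s, r)) has_vector_derivative Ht s t) (at t within {a..b})" if "s \<in> U" "t \<in> {a..b}" for s t
    unfolding Ht_def by (rule partial[OF D(1) ct]) (use that in \<open>auto simp: S_def\<close>)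
  have ds: "((\<lambda>s. h (s, t)) has_vector_derivative Hs s t) (at s within U)" if "s \<in> U" "t \<in> {a..b}" for s t
    unfolding Hs_def by (rule partial[OF D(1) cs]) (use that in \<open>auto simp: S_def\<close>)
  have dts: "((\<lambda>s. Ht s t) has_vector_derivative Hts s t) (at s within U)" if "s \<in> U" "t \<in> {a..b}" for s t
    unfolding Ht_def Hts_def by (rule partial[OF D2(1) cs]) (use that in \<open>auto simp: S_def\<close>)
  have cont_t: "continuous_on {a..b} (\<lambda>t. (s, t))" for s :: real
    by (rule continuous_on_Pair[OF continuous_on_const continuous_on_id])
  have contHt: "continuous_on {a..b} (Ht s)" if "s \<in> U" for s
    unfolding Ht_def by (rule continuous_on_compose2[OF contD cont_t]) (use that in \<open>auto simp: S_def\<close>)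
  have Ht0: "Ht 0 t = v t" if t: "t \<in> {a..b}" for t
  proof -
    have "(z has_vector_derivative Ht 0 t) (at t within {a..b})"
      by (rule has_vector_derivative_transform[OF t _ dt[OF U(3) t]]) (simp add: h0)
    moreover have "at t within {a..b} \<noteq> bot" using ab t by (simp add: trivial_limit_within islimpt_Icc)
    ultimately show ?thesis using vector_derivative_unique_within z[OF t] by metis
  qed
  have Hs0: "Hs 0 t = \<eta> t" if t: "t \<in> {a..b}" for t
  proof -
    have "((\<lambda>s. h (s, t)) has_vector_derivative Hs 0 t) (at 0)"
      using ds[OF U(3) t] by (simp only: at_within_open[OF U(3,1)])
    then show ?thesis using vector_derivative_unique_at \<eta>[OF t] by blast
  qed
  have d\<eta>: "(\<eta> has_vector_derivative Hts 0 t) (at t within {a..b})" if t: "t \<in> {a..b}" for t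
  proof (rule mixed_derivative[where U=U and H="\<lambda>s t. h (s,t)" and Ht=Ht])
    show "continuous_on (U \<times> {a..b}) (\<lambda>(s, t). Hts s t)"
      using spec[OF D2(2), of "(1,0)"] by (simp add: Hts_def S_def split_beta)
    show "0 \<in> interior U" using U(3,4) by simp
  qed (fact U dt dts contHt \<eta> t)+
  \<comment> \<open>The velocity of the varied curve does not vanish for small \<open>s\<close>.\<close>
  obtain e where e: "e > 0" "{-e<..<e} \<subseteq> U" "\<And>s t. s \<in> {-e<..<e} \<Longrightarrow> t \<in> {a..b} \<Longrightarrow> Ht s t \<noteq> 0"
  proof -
    have "open (- {0::'e})" by auto
    with contD[of "(0,1)"] obtain O1 where O1: "open O1" "O1 \<inter> S = (\<lambda>x. D x (0,1)) -` (- {0}) \<inter> S"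
      unfolding continuous_on_open_invariant by meson
    have "{0} \<times> {a..b} \<subseteq> O1"
    proof
      fix y assume y: "y \<in> {0::real} \<times> {a..b}"
      then have "D y (0,1) \<noteq> 0" using Ht0 v0 by (auto simp: Ht_def)
      moreover have "y \<in> S" using y U by (auto simp: S_def)
      ultimately show "y \<in> O1" using O1(2) by blast
    qed
    from Elementary_Topology.tube_lemma[OF compact_Icc O1(1) this]
    obtain X0 where X0: "0 \<in> X0" "open X0" "X0 \<times> {a..b} \<subseteq> O1" by auto
    have "open (X0 \<inter> U)" "0 \<in> X0 \<inter> U" using X0 U by (simp_all add: open_Int)
    from openE[OF this] obtain e where e: "e > 0" "ball 0 e \<subseteq> X0 \<inter> U" .
    have eb: "{-e<..<e} = ball 0 e" by (simp add: ball_eq_greaterThanLessThan)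
    show thesis
    proof (rule that[OF e(1)])
      show "{-e<..<e} \<subseteq> U" using e eb by blast
      fix s t assume "s \<in> {-e<..<e}" "t \<in> {a..b}"
      then have "s \<in> X0" "s \<in> U" using e(2) unfolding eb by blast+
      then have "(s,t) \<in> O1 \<inter> S" using X0(3) \<open>t \<in> {a..b}\<close> by (auto simp: S_def)
      then show "Ht s t \<noteq> 0" using O1(2) by (auto simp: Ht_def)
    qed
  qed
  define V where "V = {-e<..<e}"
  have V: "V \<subseteq> U" "open V" "convex V" "0 \<in> V" using e by (auto simp: V_def)
  define DL where "DL s t = (G1 (h (s,t)) (Hs s t) (Ht s t) (Ht s t) + 2 * G (h (s,t)) (Hts s t) (Ht s t)) / (2 * nrm (h (s,t)) (Ht s t))
      + (B1 (h (s,t)) (Hs s t) (Ht s t) + B (h (s,t)) (Hts s t))" for s t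
  have VS: "V \<times> {a..b} \<subseteq> S" using V by (auto simp: S_def)
  have conth: "continuous_on S h" using Ck_on_imp_continuous_on[OF C2] by (simp add: S_def U_def)
  have contDL: "continuous_on (V \<times> {a..b}) (\<lambda>(s,t). DL s t)"
  proof -
    have c: "continuous_on (V \<times> {a..b}) h" "continuous_on (V \<times> {a..b}) (\<lambda>x. D x (0,1))"
      "continuous_on (V \<times> {a..b}) (\<lambda>x. D x (1,0))" "continuous_on (V \<times> {a..b}) (\<lambda>x. D2 x (1,0))"
      by (rule continuous_on_subset[OF conth VS] continuous_on_subset[OF contD VS]
          continuous_on_subset[OF spec[OF D2(2)] VS])+
    have hV: "h ` (V \<times> {a..b}) \<subseteq> W" using hS VS by blast
    have nz: "\<forall>x\<in>V \<times> {a..b}. 2 * nrm (h x) (D x (0,1)) \<noteq> 0"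
    proof
      fix x assume x: "x \<in> V \<times> {a..b}"
      then have "D x (0,1) \<noteq> 0" using e(3)[of "fst x" "snd x"] by (auto simp: Ht_def V_def)
      then show "2 * nrm (h x) (D x (0,1)) \<noteq> 0" using nrm_pos[of "h x"] x hV by force
    qed
    have "continuous_on (V \<times> {a..b}) (\<lambda>x. (G1 (h x) (D x (1,0)) (D x (0,1)) (D x (0,1)) + 2 * G (h x) (D2 x (1,0)) (D x (0,1))) / (2 * nrm (h x) (D x (0,1)))
      + (B1 (h x) (D x (1,0)) (D x (0,1)) + B (h x) (D2 x (1,0))))"
      by (intro continuous_on_add continuous_on_divide continuous_on_mult continuous_on_const cont_G1 cont_G cont_nrm
          F.cont_B1 F.cont_B c hV nz)
    then show ?thesis by (simp add: DL_def Ht_def Hs_def Hts_def split_beta)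
  qed
  have L: "((\<lambda>s. integral (cbox a b) (\<lambda>t. lag (h (s,t)) (Ht s t))) has_field_derivative integral (cbox a b) (DL 0)) (at 0 within V)"
  proof (rule leibniz_rule_field_derivative[OF _ _ _ V(4,3)])
    fix s t assume s: "s \<in> V" and t: "t \<in> cbox a b"
    then have t': "t \<in> {a..b}" and sU: "s \<in> U" using V by auto
    show "((\<lambda>s. lag (h (s,t)) (Ht s t)) has_field_derivative DL s t) (at s within V)"
      unfolding DL_def
    proof (rule deriv_lag)
      show "((\<lambda>s. h (s,t)) has_vector_derivative Hs s t) (at s within V)"
        by (rule has_vector_derivative_within_subset[OF ds[OF sU t'] V(1)])
      show "((\<lambda>s. Ht s t) has_vector_derivative Hts s t) (at s within V)"
        by (rule has_vector_derivative_within_subset[OF dts[OF sU t'] V(1)])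
      show "(\<lambda>s. h (s,t)) ` V \<subseteq> W" using hS VS t' by blast
      show "Ht s t \<noteq> 0" using e(3) s t' by (simp add: V_def)
    qed (rule s)
  next
    fix s assume s: "s \<in> V"
    then have sU: "s \<in> U" using V by auto
    have "continuous_on {a..b} (\<lambda>t. lag (h (s,t)) (Ht s t))"
      unfolding lag_def
    proof (intro continuous_on_add cont_nrm F.cont_B contHt sU)
      show "continuous_on {a..b} (\<lambda>t. h (s,t))"
        by (rule continuous_on_compose2[OF conth cont_t]) (use sU in \<open>auto simp: S_def\<close>)
      show "(\<lambda>t. h (s,t)) ` {a..b} \<subseteq> W" using hS sU by (auto simp: S_def)
      then show "(\<lambda>t. h (s,t)) ` {a..b} \<subseteq> W" .
      show "continuous_on {a..b} (\<lambda>t. h (s,t))"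
        by (rule continuous_on_compose2[OF conth cont_t]) (use sU in \<open>auto simp: S_def\<close>)
    qed
    then show "(\<lambda>t. lag (h (s,t)) (Ht s t)) integrable_on cbox a b"
      using integrable_continuous_interval by simp
  next
    show "continuous_on (V \<times> cbox a b) (\<lambda>(s,t). DL s t)" using contDL by simp
  qed
  have EL: "integral {a..b} (DL 0) = integral {a..b} (\<lambda>t. EL (z t) (v t) (acc t) (\<eta> t))"
  proof -
    define P where "P t = G (z t) (v t) (\<eta> t) / nrm (z t) (v t) + B (z t) (\<eta> t)" for t
    have zW: "z ` {a..b} \<subseteq> W" using h0 hS U by (force simp: S_def)
    have dP: "(P has_vector_derivative DL 0 t - EL (z t) (v t) (acc t) (\<eta> t)) (at t within {a..b})" if t: "t \<in> {a..b}" for t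
      using deriv_momentum[OF z[OF t] v[OF t] d\<eta>[OF t] t zW v0[OF t]]
      by (simp add: P_def[abs_def] DL_def Ht0[OF t] Hs0[OF t] h0[OF t] has_real_derivative_iff_has_vector_derivative)
    have end0: "\<eta> r = 0" if r: "r = a \<or> r = b" for r
    proof -
      have "r \<in> {a..b}" using r ab by auto
      then have 1: "((\<lambda>s. h (s, r)) has_vector_derivative \<eta> r) (at 0)" by (rule \<eta>)
      have eq: "z r = h (s, r)" if "s \<in> U" for s
      proof -
        have "h (s, a) = z a" "h (s, b) = z b" using ends that unfolding U_def by blast+
        with r show ?thesis by (elim disjE) (simp_all only:)
      qed
      have "((\<lambda>s. h (s, r)) has_vector_derivative 0) (at 0)"
        using has_vector_derivative_const[of "z r" "at 0"] U(1,3) eq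
        by (rule has_vector_derivative_transform_within_open)
      with 1 show ?thesis by (rule vector_derivative_unique_at)
    qed
    have "((\<lambda>t. DL 0 t - EL (z t) (v t) (acc t) (\<eta> t)) has_integral (P b - P a)) {a..b}"
      by (rule fundamental_theorem_of_calculus) (use ab dP in auto)
    moreover have "P r = 0" if r: "r = a \<or> r = b" for r
    proof -
      have "z r \<in> W" using zW r ab by auto
      then show ?thesis using end0[OF r] by (simp add: P_def G_r0 F.B_0)
    qed
    ultimately have i0: "integral {a..b} (\<lambda>t. DL 0 t - EL (z t) (v t) (acc t) (\<eta> t)) = 0"
      by (simp add: integral_unique)
    have cz: "continuous_on {a..b} z" "continuous_on {a..b} v" "continuous_on {a..b} \<eta>"
      unfolding continuous_on_eq_continuous_within
      by (intro ballI has_vector_derivative_continuous, erule z v d\<eta>)+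
    have "continuous_on {a..b} (\<lambda>t. EL (z t) (v t) (acc t) (\<eta> t))"
      by (rule cont_EL[OF cz(1,2) cacc cz(3) zW v0])
    moreover have "continuous_on {a..b} (DL 0)"
      using continuous_on_compose2[OF contDL cont_t[of 0]] V(4) by auto
    ultimately show ?thesis
      using i0 by (simp add: integral_diff integrable_continuous_interval)
  qed
  have "((\<lambda>s. integral {a..b} (\<lambda>t. lag (h (s,t)) (Ht s t))) has_real_derivative integral {a..b} (\<lambda>t. EL (z t) (v t) (acc t) (\<eta> t))) (at 0)"
    using L unfolding at_within_open[OF V(4,2)] by (simp add: EL)
  then show ?thesis
  proof (rule has_field_derivative_transform_within_open[OF _ U(1,3)])
    fix s assume s: "s \<in> U"
    show "integral {a..b} (\<lambda>t. lag (h (s,t)) (Ht s t)) =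
      integral {a..b} (\<lambda>t. lag (h (s, t)) (vector_derivative (\<lambda>r. h (s, r)) (at t within {a..b})))"
    proof (rule integral_cong)
      fix t assume t: "t \<in> {a..b}"
      have "vector_derivative (\<lambda>r. h (s, r)) (at t within {a..b}) = Ht s t"
        using vector_derivative_within_cbox[of a b t "\<lambda>r. h (s, r)" "Ht s t"] dt[OF s t] ab t by simp
      then show "lag (h (s,t)) (Ht s t) = lag (h (s, t)) (vector_derivative (\<lambda>r. h (s, r)) (at t within {a..b}))" by simp
    qed
  qed
qed

end

section \<open>Pointwise comparison of two Randers metrics\<close>

text \<open>The quadratic \<open>q\<close> has two distinct non-real roots. In the identity \<open>q P\<^sup>2 = q' P'\<^sup>2\<close> of
  complex polynomials such a root has odd multiplicity on the left, so it is a root of \<open>q'\<close>. As the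
  coefficients are real, the two quadratics share both roots.\<close>

lemma positive_quadratics_proportional:
  fixes a0 a1 a2 b0 b1 b2 p0 p1 p2 r0 r1 r2 :: real
  assumes a: "\<And>t. a0 + a1 * t + a2 * t\<^sup>2 > 0" and a2: "a2 > 0"
    and p: "p0 \<noteq> 0"
    and eq: "\<And>t. (a0 + a1 * t + a2 * t\<^sup>2) * (p0 + p1 * t + p2 * t\<^sup>2)\<^sup>2 = (b0 + b1 * t + b2 * t\<^sup>2) * (r0 + r1 * t + r2 * t\<^sup>2)\<^sup>2"
  shows "a2 * b0 = b2 * a0"
proof -
  define Q where "Q = [:complex_of_real a0, complex_of_real a1, complex_of_real a2:]"
  define Q' where "Q' = [:complex_of_real b0, complex_of_real b1, complex_of_real b2:]"
  define P where "P = [:complex_of_real p0, complex_of_real p1, complex_of_real p2:]"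
  define P' where "P' = [:complex_of_real r0, complex_of_real r1, complex_of_real r2:]"
  have evQ: "poly [:complex_of_real c0, complex_of_real c1, complex_of_real c2:] (of_real t) = of_real (c0 + c1 * t + c2 * t\<^sup>2)"
    for c0 c1 c2 t by (simp add: power2_eq_square algebra_simps)
  have "poly (Q * (P * P) - Q' * (P' * P')) (of_real t) = 0" for t
    using arg_cong[OF eq[of t], of complex_of_real]
    unfolding poly_diff poly_mult Q_def Q'_def P_def P'_def evQ of_real_mult power2_eq_square by simp
  then have "range complex_of_real \<subseteq> {z. poly (Q * (P * P) - Q' * (P' * P')) z = 0}" by auto
  moreover have "infinite (range complex_of_real)"
    using infinite_UNIV_char_0 by (simp add: finite_image_iff inj_of_real)
  ultimately have "infinite {z. poly (Q * (P * P) - Q' * (P' * P')) z = 0}" using finite_subset by blast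
  then have "Q * (P * P) - Q' * (P' * P') = 0" using poly_roots_finite by blast
  then have PQ: "Q * (P * P) = Q' * (P' * P')" by simp
  have Q0: "Q \<noteq> 0" and P0: "P \<noteq> 0" using a2 p by (auto simp: Q_def P_def)
  then have "Q * (P * P) \<noteq> 0" by simp
  then have nz: "Q' * (P' * P') \<noteq> 0" using PQ by simp
  have "\<not> constant (poly Q)"
    using a2 by (simp add: constant_degree Q_def)
  then obtain z where z: "poly Q z = 0" using fundamental_theorem_of_algebra by blast
  have im: "Im z \<noteq> 0"
  proof
    assume "Im z = 0"
    then have "z = of_real (Re z)" by (simp add: complex_eq_iff)
    then have "complex_of_real (a0 + a1 * Re z + a2 * (Re z)\<^sup>2) = 0" using z evQ unfolding Q_def by metis
    then have "a0 + a1 * Re z + a2 * (Re z)\<^sup>2 = 0" by (simp only: of_real_eq_0_iff)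
    then show False using a[of "Re z"] by simp
  qed
  have z': "poly Q' z = 0"
  proof (rule ccontr)
    assume nz': "poly Q' z \<noteq> 0"
    have "order z Q + (order z P + order z P) = order z Q' + (order z P' + order z P')"
      using nz Q0 P0 arg_cong[OF PQ, of "order z"] by (simp add: order_mult)
    moreover have "order z Q' = 0" using nz' by (simp add: order_root)
    moreover have "order z Q \<noteq> 0" using z Q0 order_root by blast
    ultimately have "2 \<le> order z Q" by presburger
    then have "[:- z, 1:] ^ 2 dvd Q" using order_divides by blast
    then obtain k where "Q = [:- z, 1:] ^ 2 * k" by (rule dvdE)
    then have k: "Q = [:- z, 1:] * ([:- z, 1:] * k)" by (simp only: power2_eq_square mult.assoc)
    have "poly (pderiv Q) z = 0" unfolding k pderiv_mult by simp
    then have "of_real a1 + 2 * of_real a2 * z = 0" by (simp add: Q_def pderiv_pCons algebra_simps)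
    then have "Im (of_real a1 + 2 * of_real a2 * z) = 0" by simp
    then show False using im a2 by simp
  qed
  have "of_real a2 * poly Q' z - of_real b2 * poly Q z = 0" using z z' by simp
  then have *: "of_real (a2 * b0 - b2 * a0) + of_real (a2 * b1 - b2 * a1) * z = 0"
    unfolding Q_def Q'_def by (simp add: algebra_simps)
  then have "Im (of_real (a2 * b0 - b2 * a0) + of_real (a2 * b1 - b2 * a1) * z) = 0" by (simp only: zero_complex.sel)
  then have "a2 * b1 - b2 * a1 = 0" using im by simp
  then have "complex_of_real (a2 * b0 - b2 * a0) = 0" using * by simp
  then show ?thesis by (simp only: of_real_eq_0_iff)
qed

text \<open>The relation \<open>|\<xi>| J \<xi> = \<plusminus> |\<xi>|' J' \<xi>\<close> modulo \<open>\<xi>\<close> determines the conformal class: along a line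
  through a vector \<open>u\<close> with \<open>J u \<noteq> 0\<close>, the square of a suitable component of \<open>\<xi> \<and> J \<xi>\<close> turns it into
  an identity of the form above. In each direction the metric is then compared with its value at
  \<open>u\<close>.\<close>

lemma skew_relation_conformal:
  fixes g g' :: "'e::euclidean_space \<Rightarrow> 'e \<Rightarrow> real" and J J' :: "'e \<Rightarrow> 'e"
  assumes g: "bilinear g" "\<And>v w. g v w = g w v" "\<And>v. v \<noteq> 0 \<Longrightarrow> g v v > 0"
    and g': "bilinear g'" "\<And>v w. g' v w = g' w v" "\<And>v. v \<noteq> 0 \<Longrightarrow> g' v v > 0"
    and J: "linear J" "\<And>v. g (J v) v = 0" and J': "linear J'"
    and rel: "\<And>\<xi>. \<xi> \<noteq> 0 \<Longrightarrow> \<exists>\<epsilon>\<in>{1,-1}. \<exists>k. sqrt (g \<xi> \<xi>) *\<^sub>R J \<xi> - (\<epsilon> * sqrt (g' \<xi> \<xi>)) *\<^sub>R J' \<xi> = k *\<^sub>R \<xi>"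
    and u: "J u \<noteq> 0"
  obtains \<rho> where "\<rho> > 0" "\<And>v w. g' v w = \<rho> * g v w"
proof -
  have lg: "linear (\<lambda>v. g v w)" "linear (g v)" "linear (\<lambda>v. g' v w)" "linear (g' v)" for v w
    using g(1) g'(1) unfolding bilinear_def by blast+
  note gs = linear_add[OF lg(1)] linear_add[OF lg(2)] linear_scale[OF lg(1)] linear_scale[OF lg(2)]
    linear_add[OF lg(3)] linear_add[OF lg(4)] linear_scale[OF lg(3)] linear_scale[OF lg(4)]
    linear_0[OF lg(1)] linear_0[OF lg(2)] linear_0[OF lg(3)] linear_0[OF lg(4)]
    linear_diff[OF lg(1)] linear_diff[OF lg(3)] linear_diff[OF lg(2)] linear_diff[OF lg(4)]
  have u0: "u \<noteq> 0" using u linear_0[OF J(1)] by auto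
  have diag: "g' v v * g u u = g' u u * g v v" for v
  proof (cases "\<exists>c. v = c *\<^sub>R u")
    case True
    then show ?thesis by (auto simp: gs)
  next
    case False
    then have v0: "v \<noteq> 0" by (metis scaleR_zero_left)
    define x where "x t = u + t *\<^sub>R v" for t
    have x0: "x t \<noteq> 0" for t
    proof
      assume "x t = 0"
      then have e: "t *\<^sub>R v = - u" by (simp add: x_def eq_neg_iff_add_eq_0 add.commute)
      then have "t \<noteq> 0" using u0 by auto
      then have "v = (- 1 / t) *\<^sub>R u" using arg_cong[OF e, of "\<lambda>y. (1 / t) *\<^sub>R y"] by simp
      then show False using False by blast
    qed
    \<comment> \<open>a component of \<open>\<xi> \<and> K \<xi>\<close> which does not vanish at \<open>\<xi> = u\<close> for \<open>K = J\<close>\<close>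
    define c where "c K \<xi> = g u \<xi> * g (J u) (K \<xi>) - g (J u) \<xi> * g u (K \<xi>)" for K and \<xi> :: 'e
    have sq: "g (x t) (x t) * (c J (x t))\<^sup>2 = g' (x t) (x t) * (c J' (x t))\<^sup>2" for t
    proof -
      obtain \<epsilon> k where e: "\<epsilon> \<in> {1,-1::real}" "sqrt (g (x t) (x t)) *\<^sub>R J (x t) - (\<epsilon> * sqrt (g' (x t) (x t))) *\<^sub>R J' (x t) = k *\<^sub>R x t"
        using rel[OF x0[of t]] by blast
      define m where "m = sqrt (g (x t) (x t))"
      define m' where "m' = sqrt (g' (x t) (x t))"
      have e2: "m *\<^sub>R J (x t) = (\<epsilon> * m') *\<^sub>R J' (x t) + k *\<^sub>R x t"
        using e(2) unfolding m_def m'_def by (simp add: algebra_simps)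
      have "m * g w (J (x t)) = \<epsilon> * m' * g w (J' (x t)) + k * g w (x t)" for w
        using arg_cong[OF e2, of "g w"] by (simp add: gs)
      note w = this
      have "m * c J (x t) = g u (x t) * (m * g (J u) (J (x t))) - g (J u) (x t) * (m * g u (J (x t)))"
        by (simp add: c_def algebra_simps)
      also have "\<dots> = \<epsilon> * m' * c J' (x t) + k * (g u (x t) * g (J u) (x t) - g (J u) (x t) * g u (x t))"
        unfolding w by (simp add: c_def algebra_simps)
      finally have "m * c J (x t) = \<epsilon> * m' * c J' (x t)" by simp
      then have "m\<^sup>2 * (c J (x t))\<^sup>2 = \<epsilon>\<^sup>2 * m'\<^sup>2 * (c J' (x t))\<^sup>2"
        by (metis power_mult_distrib)
      moreover have "\<epsilon>\<^sup>2 = 1" using e(1) by auto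
      moreover have "m\<^sup>2 = g (x t) (x t)" "m'\<^sup>2 = g' (x t) (x t)"
        using g(3)[OF x0[of t]] g'(3)[OF x0[of t]] by (auto simp: m_def m'_def)
      ultimately show ?thesis by simp
    qed
    have qx: "g (x t) (x t) = g u u + (2 * g u v) * t + g v v * t\<^sup>2" "g' (x t) (x t) = g' u u + (2 * g' u v) * t + g' v v * t\<^sup>2" for t
      using g(2)[of v u] g'(2)[of v u] by (simp_all add: x_def gs algebra_simps power2_eq_square)
    have cx: "c K (x t) = c K u + (g u u * g (J u) (K v) + g u v * g (J u) (K u) - g (J u) u * g u (K v) - g (J u) v * g u (K u)) * t
       + c K v * t\<^sup>2" if K: "linear K" for K t
      unfolding c_def x_def by (simp add: gs linear_add[OF K] linear_scale[OF K] algebra_simps power2_eq_square)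
    have "c J u = g u u * g (J u) (J u)" using J(2)[of u] by (simp add: c_def)
    then have c0: "c J u \<noteq> 0" using g(3)[OF u0] g(3)[OF u] by simp
    have "g v v * g' u u = g' v v * g u u"
    proof (rule positive_quadratics_proportional[OF _ _ c0])
      show "g u u + (2 * g u v) * t + g v v * t\<^sup>2 > 0" for t using g(3)[OF x0[of t]] by (simp only: qx)
      show "g v v > 0" by (rule g(3)[OF v0])
    qed (rule sq[unfolded qx cx[OF J(1)] cx[OF J']])
    then show ?thesis by (simp add: mult.commute)
  qed
  define \<rho> where "\<rho> = g' u u / g u u"
  have "\<rho> > 0" using g(3)[OF u0] g'(3)[OF u0] by (simp add: \<rho>_def)
  have d: "g' v v = \<rho> * g v v" for v
    using diag[of v] g(3)[OF u0] by (simp add: \<rho>_def field_simps)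
  have "g' v w = \<rho> * g v w" for v w
    using d[of "v + w"] d[of v] d[of w] g(2)[of w v] g'(2)[of w v] by (simp add: gs algebra_simps)
  then show thesis using that \<open>\<rho> > 0\<close> by blast
qed

text \<open>For each vector one of the two signs is right; a vector space is not the union
  of two proper subspaces.\<close>

lemma linear_eq_or_eq_neg:
  assumes J: "linear J" and K: "linear K" and *: "\<And>x. J x = K x \<or> J x = - K x"
  shows "(\<forall>x. J x = K x) \<or> (\<forall>x. J x = - K x)"
proof (rule ccontr)
  assume "\<not> ?thesis"
  then obtain a b where a: "J a \<noteq> K a" and b: "J b \<noteq> - K b" by auto
  have a': "J a = - K a" and b': "J b = K b" using a b * by blast+
  have "J (a + b) = J a + J b" "K (a + b) = K a + K b" by (simp_all add: linear_add[OF J] linear_add[OF K])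
  then have "J a + J b = K a + K b \<or> J a + J b = - (K a + K b)" using *[of "a + b"] by metis
  then show False
  proof
    assume "J a + J b = K a + K b"
    then show False using a b' by simp
  next
    assume "J a + J b = - (K a + K b)"
    then show False using b a' by simp
  qed
qed

text \<open>Once \<open>g' = \<rho> g\<close> is known, pairing the relation with \<open>\<xi>\<close> removes the multiple of \<open>\<xi>\<close>, since
  \<open>J \<xi>\<close> and \<open>J' \<xi>\<close> are orthogonal to \<open>\<xi>\<close>; this leaves \<open>J \<xi> = \<plusminus> \<surd>\<rho> J' \<xi>\<close> for every \<open>\<xi>\<close>. If \<open>J = 0\<close>,
  the same pairing gives \<open>J' = 0\<close>.\<close>

lemma skew_relation:
  fixes g g' :: "'e::euclidean_space \<Rightarrow> 'e \<Rightarrow> real" and J J' :: "'e \<Rightarrow> 'e"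
  assumes g: "bilinear g" "\<And>v w. g v w = g w v" "\<And>v. v \<noteq> 0 \<Longrightarrow> g v v > 0"
    and g': "bilinear g'" "\<And>v w. g' v w = g' w v" "\<And>v. v \<noteq> 0 \<Longrightarrow> g' v v > 0"
    and J: "linear J" "\<And>v. g (J v) v = 0" and J': "linear J'" "\<And>v. g' (J' v) v = 0"
    and rel: "\<And>\<xi>. \<xi> \<noteq> 0 \<Longrightarrow> \<exists>\<epsilon>\<in>{1,-1}. \<exists>k. sqrt (g \<xi> \<xi>) *\<^sub>R J \<xi> - (\<epsilon> * sqrt (g' \<xi> \<xi>)) *\<^sub>R J' \<xi> = k *\<^sub>R \<xi>"
  shows "(\<forall>v w. g (J v) w = 0) \<and> (\<forall>v w. g' (J' v) w = 0) \<or>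
    (\<exists>\<rho>>0. (\<forall>v w. g' v w = \<rho> * g v w) \<and>
      ((\<forall>v w. g' (J' v) w = sqrt \<rho> * g (J v) w) \<or> (\<forall>v w. g' (J' v) w = - sqrt \<rho> * g (J v) w)))"
proof (cases "\<forall>u. J u = 0")
  case True
  have lg: "linear (\<lambda>v. g v w)" "linear (\<lambda>v. g' v w)" for w
    using g(1) g'(1) unfolding bilinear_def by blast+
  have "J' \<xi> = 0" for \<xi>
  proof (cases "\<xi> = 0")
    case True
    then show ?thesis using linear_0[OF J'(1)] by simp
  next
    case False
    then obtain \<epsilon> k where e: "\<epsilon> \<in> {1,-1::real}" "sqrt (g \<xi> \<xi>) *\<^sub>R J \<xi> - (\<epsilon> * sqrt (g' \<xi> \<xi>)) *\<^sub>R J' \<xi> = k *\<^sub>R \<xi>"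
      using rel by blast
    define m where "m = - (\<epsilon> * sqrt (g' \<xi> \<xi>))"
    have m: "m \<noteq> 0" using e(1) g'(3)[OF False] by (auto simp: m_def)
    have k: "m *\<^sub>R J' \<xi> = k *\<^sub>R \<xi>" using e(2) True by (simp add: m_def)
    have "m * g' (J' \<xi>) \<xi> = k * g' \<xi> \<xi>" using arg_cong[OF k, of "\<lambda>v. g' v \<xi>"] by (simp add: linear_scale[OF lg(2)])
    then have "k = 0" using J'(2)[of \<xi>] g'(3)[OF False] by simp
    then show ?thesis using k m by simp
  qed
  then have "g' (J' v) w = 0" for v w using linear_0[OF lg(2)] by simp
  moreover have "g (J v) w = 0" for v w using True linear_0[OF lg(1)] by simp
  ultimately show ?thesis by blast
next
  case False
  then obtain u where u: "J u \<noteq> 0" by blast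
  obtain \<rho> where \<rho>: "\<rho> > 0" "\<And>v w. g' v w = \<rho> * g v w"
    using skew_relation_conformal[OF g g' J J'(1) rel u] by blast
  have lg: "linear (\<lambda>v. g v w)" for w
    using g(1) unfolding bilinear_def by blast
  define s where "s = sqrt \<rho>"
  have s: "s > 0" "s * s = \<rho>" using \<rho>(1) by (auto simp: s_def)
  define K where "K v = s *\<^sub>R J' v" for v
  have "linear K" unfolding K_def[abs_def] by (rule linear_compose_scale_right[OF J'(1)])
  have "J \<xi> = K \<xi> \<or> J \<xi> = - K \<xi>" for \<xi>
  proof (cases "\<xi> = 0")
    case True
    then show ?thesis using linear_0[OF J(1)] linear_0[OF \<open>linear K\<close>] by simp
  next
    case False
    then obtain \<epsilon> k where e: "\<epsilon> \<in> {1,-1::real}" "sqrt (g \<xi> \<xi>) *\<^sub>R J \<xi> - (\<epsilon> * sqrt (g' \<xi> \<xi>)) *\<^sub>R J' \<xi> = k *\<^sub>R \<xi>"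
      using rel by blast
    define m where "m = sqrt (g \<xi> \<xi>)"
    have m: "m > 0" using g(3)[OF False] by (simp add: m_def)
    have "sqrt (g' \<xi> \<xi>) = m * s" by (simp add: \<rho>(2) real_sqrt_mult m_def s_def mult.commute)
    then have k: "m *\<^sub>R (J \<xi> - \<epsilon> *\<^sub>R K \<xi>) = k *\<^sub>R \<xi>"
      using e(2) by (simp add: m_def[symmetric] K_def algebra_simps)
    have "g (J' \<xi>) \<xi> = 0" using J'(2)[of \<xi>] \<rho> by simp
    then have "k * g \<xi> \<xi> = 0"
      using arg_cong[OF k, of "\<lambda>v. g v \<xi>"] J(2)[of \<xi>]
      by (simp add: linear_scale[OF lg] linear_diff[OF lg] K_def)
    then have "k = 0" using g(3)[OF False] by simp
    then have "J \<xi> = \<epsilon> *\<^sub>R K \<xi>" using k m by simp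
    then show ?thesis using e(1) by auto
  qed
  from linear_eq_or_eq_neg[OF J(1) \<open>linear K\<close> this]
  have "(\<forall>v w. g' (J' v) w = s * g (J v) w) \<or> (\<forall>v w. g' (J' v) w = - s * g (J v) w)"
  proof
    assume *: "\<forall>x. J x = K x"
    have "g' (J' v) w = s * g (J v) w" for v w
      using *[rule_format, of v] by (simp add: K_def linear_scale[OF lg] \<rho>(2) s(2)[symmetric])
    then show ?thesis by blast
  next
    assume *: "\<forall>x. J x = - K x"
    have "g' (J' v) w = - s * g (J v) w" for v w
      using *[rule_format, of v] by (simp add: K_def linear_scale[OF lg] linear_neg[OF lg] \<rho>(2) s(2)[symmetric])
    then show ?thesis by blast
  qed
  then show ?thesis using \<rho> unfolding s_def by blast
qed

text \<open>The geodesics of either metric in the directions \<open>\<xi>\<close> and \<open>-\<xi>\<close> give four conditions on the even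
  part \<open>T\<close> and the odd parts \<open>a\<close>, \<open>b\<close>. If the signs for \<open>\<xi>\<close> and \<open>-\<xi>\<close> agree, the sum of the first two
  conditions isolates \<open>T\<close>. Otherwise their difference isolates \<open>a\<close>, and the conditions of the other
  metric then give \<open>T\<close> and \<open>b\<close>.\<close>

lemma even_odd_separation:
  fixes T a b \<xi> :: "'e::real_vector"
  assumes 1: "\<epsilon>1 \<in> {1,-1::real}" "T - a + \<epsilon>1 *\<^sub>R b \<in> span {\<xi>}"
    and 2: "\<epsilon>2 \<in> {1,-1::real}" "T + a - \<epsilon>2 *\<^sub>R b \<in> span {\<xi>}"
    and 3: "\<epsilon>3 \<in> {1,-1::real}" "T + b - \<epsilon>3 *\<^sub>R a \<in> span {\<xi>}"
    and 4: "\<epsilon>4 \<in> {1,-1::real}" "T - b + \<epsilon>4 *\<^sub>R a \<in> span {\<xi>}"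
  shows "T \<in> span {\<xi>}" and "\<exists>\<epsilon>\<in>{1,-1}. a - \<epsilon> *\<^sub>R b \<in> span {\<xi>}"
proof -
  have half: "x \<in> span {\<xi>}" if "y \<in> span {\<xi>}" "x + x = y" for x y
  proof -
    have "x = (1/2) *\<^sub>R y" unfolding that(2)[symmetric] by (simp flip: scaleR_2)
    then show ?thesis using span_scale[OF that(1), of "1/2"] by simp
  qed
  have "T \<in> span {\<xi>} \<and> (\<exists>\<epsilon>\<in>{1,-1}. a - \<epsilon> *\<^sub>R b \<in> span {\<xi>})"
  proof (cases "\<epsilon>1 = \<epsilon>2")
    case True
    have T: "T \<in> span {\<xi>}"
      by (rule half[OF span_add[OF 1(2) 2(2)]]) (simp add: True)
    have "T - (T - a + \<epsilon>1 *\<^sub>R b) = a - \<epsilon>1 *\<^sub>R b" by simp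
    then have "a - \<epsilon>1 *\<^sub>R b \<in> span {\<xi>}" using span_diff[OF T 1(2)] by metis
    then show ?thesis using T 1(1) by blast
  next
    case False
    then have e: "\<epsilon>2 = - \<epsilon>1" using 1(1) 2(1) by auto
    have a: "a \<in> span {\<xi>}"
      by (rule half[OF span_diff[OF 2(2) 1(2)]]) (simp add: e)
    have "T + b - \<epsilon>3 *\<^sub>R a + \<epsilon>3 *\<^sub>R a \<in> span {\<xi>}" by (rule span_add[OF 3(2) span_scale[OF a]])
    then have Tb: "T + b \<in> span {\<xi>}" by simp
    have "T - b + \<epsilon>4 *\<^sub>R a - \<epsilon>4 *\<^sub>R a \<in> span {\<xi>}" by (rule span_diff[OF 4(2) span_scale[OF a]])
    then have Tb': "T - b \<in> span {\<xi>}" by simp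
    have T: "T \<in> span {\<xi>}" by (rule half[OF span_add[OF Tb Tb']]) simp
    have "b \<in> span {\<xi>}" using span_diff[OF Tb T] by simp
    then have "a - 1 *\<^sub>R b \<in> span {\<xi>}" using span_diff[OF a] by simp
    then show ?thesis using T by blast
  qed
  then show "T \<in> span {\<xi>}" "\<exists>\<epsilon>\<in>{1,-1}. a - \<epsilon> *\<^sub>R b \<in> span {\<xi>}" by blast+
qed

text \<open>This is the form of the difference of the Christoffel symbols of projectively equivalent
  metrics. The scalar in \<open>T v v = 2 \<phi>(v) v\<close> is additive on independent \<open>v\<close> and \<open>w\<close>: compare the
  coefficients in the parallelogram identity
  \<open>T (v + w) (v + w) + T (v - w) (v - w) = 2 T v v + 2 T w w\<close>.\<close>

lemma symmetric_bilinear_radial: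
  fixes T :: "'e::real_vector \<Rightarrow> 'e \<Rightarrow> 'e"
  assumes lin: "\<And>v. linear (T v)" and sym: "\<And>v w. T v w = T w v" and rad: "\<And>v. T v v \<in> span {v}"
  obtains \<phi> :: "'e \<Rightarrow> real" where "linear \<phi>" "\<And>v w. T v w = \<phi> v *\<^sub>R w + \<phi> w *\<^sub>R v"
proof -
  have linl: "linear (\<lambda>v. T v w)" for w
    using lin[of w] sym by (metis (no_types, lifting) ext)
  note Ts = linear_add[OF lin] linear_add[OF linl] linear_scale[OF lin] linear_scale[OF linl]
    linear_diff[OF lin] linear_diff[OF linl]
  have "\<forall>v. \<exists>c. T v v = (2 * c) *\<^sub>R v"
  proof
    fix v
    obtain c where "T v v = c *\<^sub>R v" using rad[of v] by (auto simp: span_singleton)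
    then show "\<exists>c. T v v = (2 * c) *\<^sub>R v" by (intro exI[of _ "c / 2"]) simp
  qed
  then obtain f where f: "\<And>v. T v v = (2 * f v) *\<^sub>R v" by metis
  define \<phi> where "\<phi> v = (if v = 0 then 0 else f v)" for v
  have \<phi>: "T v v = (2 * \<phi> v) *\<^sub>R v" for v using f[of v] linear_0[OF lin] by (auto simp: \<phi>_def)
  have \<phi>_scale: "\<phi> (c *\<^sub>R v) = c * \<phi> v" for c v
  proof (cases "c = 0 \<or> v = 0")
    case True
    then show ?thesis by (auto simp: \<phi>_def)
  next
    case False
    have "T (c *\<^sub>R v) (c *\<^sub>R v) = (c * c) *\<^sub>R T v v" by (simp add: Ts)
    then have "(2 * \<phi> (c *\<^sub>R v) * c) *\<^sub>R v = (c * c * (2 * \<phi> v)) *\<^sub>R v" unfolding \<phi> by simp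
    then show ?thesis using False by simp
  qed
  have \<phi>_add: "\<phi> (v + w) = \<phi> v + \<phi> w" for v w
  proof (cases "\<exists>c d. v = c *\<^sub>R w \<or> w = d *\<^sub>R v")
    case True
    then consider c where "v = c *\<^sub>R w" | d where "w = d *\<^sub>R v" by blast
    then show ?thesis
    proof cases
      case 1
      then have "v + w = (c + 1) *\<^sub>R w" by (simp add: algebra_simps)
      then have "\<phi> (v + w) = (c + 1) * \<phi> w" using \<phi>_scale by metis
      moreover have "\<phi> v = c * \<phi> w" using 1 \<phi>_scale by metis
      ultimately show ?thesis by (simp add: algebra_simps)
    next
      case 2
      then have "v + w = (1 + d) *\<^sub>R v" by (simp add: algebra_simps)
      then have "\<phi> (v + w) = (1 + d) * \<phi> v" using \<phi>_scale by metis
      moreover have "\<phi> w = d * \<phi> v" using 2 \<phi>_scale by metis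
      ultimately show ?thesis by (simp add: algebra_simps)
    qed
  next
    case False
    have "T (v + w) (v + w) + T (v - w) (v - w) = 2 *\<^sub>R T v v + 2 *\<^sub>R T w w"
      by (simp add: Ts algebra_simps scaleR_2)
    then have "(2 * \<phi> (v + w)) *\<^sub>R (v + w) + (2 * \<phi> (v - w)) *\<^sub>R (v - w) = (4 * \<phi> v) *\<^sub>R v + (4 * \<phi> w) *\<^sub>R w"
      unfolding \<phi> by simp
    then have *: "(2 * \<phi> (v + w) + 2 * \<phi> (v - w) - 4 * \<phi> v) *\<^sub>R v = (4 * \<phi> w - 2 * \<phi> (v + w) + 2 * \<phi> (v - w)) *\<^sub>R w"
      by (simp add: algebra_simps)
    have eq0: "a = 0 \<and> b = 0" if "a *\<^sub>R v = b *\<^sub>R w" for a b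
    proof -
      have w0: "w \<noteq> 0" using False scaleR_zero_left by metis
      have "a = 0"
      proof (rule ccontr)
        assume "a \<noteq> 0"
        then have "v = (b / a) *\<^sub>R w" using arg_cong[OF that, of "\<lambda>x. (1/a) *\<^sub>R x"] by simp
        then show False using False by blast
      qed
      then show ?thesis using that w0 by simp
    qed
    from eq0[OF *] show ?thesis by simp
  qed
  have "T v w = \<phi> v *\<^sub>R w + \<phi> w *\<^sub>R v" for v w
  proof -
    have "T (v + w) (v + w) = T v v + T w w + 2 *\<^sub>R T v w"
      by (simp add: Ts sym[of w v] algebra_simps scaleR_2)
    then have "2 *\<^sub>R T v w = 2 *\<^sub>R (\<phi> v *\<^sub>R w + \<phi> w *\<^sub>R v)"
      unfolding \<phi> \<phi>_add by (simp add: algebra_simps)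
    then show ?thesis by simp
  qed
  moreover have "linear \<phi>" by (rule linearI) (simp_all add: \<phi>_add \<phi>_scale)
  ultimately show thesis using that by blast
qed

section \<open>Derivatives of determinants\<close>

text \<open>The derivative of \<open>det\<close> at \<open>A\<close> in the direction \<open>H\<close>, from the Leibniz formula.\<close>

definition det_deriv :: "real^'n^'n \<Rightarrow> real^'n^'n \<Rightarrow> real" where
  "det_deriv A H = (\<Sum>p | p permutes UNIV. of_int (sign p) * (\<Sum>i\<in>UNIV. H$i$p i * (\<Prod>j\<in>UNIV - {i}. A$j$p j)))"

lemma DERIV_det:
  fixes M :: "real \<Rightarrow> real^'n^'n"
  assumes "\<And>i j. ((\<lambda>t. M t $ i $ j) has_real_derivative H $ i $ j) (at t within S)"
  shows "((\<lambda>t. det (M t)) has_real_derivative det_deriv (M t) H) (at t within S)"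
  unfolding det_def det_deriv_def
proof (intro DERIV_sum DERIV_cmult)
  fix p :: "'n \<Rightarrow> 'n"
  have "((\<lambda>t. \<Prod>i\<in>UNIV. M t $ i $ p i) has_derivative
      (\<lambda>y. \<Sum>i\<in>UNIV. H$i$p i * y * (\<Prod>j\<in>UNIV - {i}. M t $ j $ p j))) (at t within S)"
    by (rule has_derivative_prod) (use assms in \<open>simp add: has_field_derivative_def\<close>)
  also have "(\<lambda>y. \<Sum>i\<in>UNIV. H$i$p i * y * (\<Prod>j\<in>UNIV - {i}. M t $ j $ p j))
     = (*) (\<Sum>i\<in>UNIV. H$i$p i * (\<Prod>j\<in>UNIV - {i}. M t $ j $ p j))"
    by (rule ext) (simp add: sum_distrib_left mult.assoc mult.commute mult.left_commute)
  finally show "((\<lambda>t. \<Prod>i\<in>UNIV. M t $ i $ p i) has_real_derivative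
      (\<Sum>i\<in>UNIV. H$i$p i * (\<Prod>j\<in>UNIV - {i}. M t $ j $ p j))) (at t within S)"
    unfolding has_field_derivative_def .
qed

text \<open>A permutation other than the identity moves at least two points, so each of its terms retains
  an off-diagonal entry of the unit matrix.\<close>

lemma det_deriv_mat_1:
  fixes K :: "real^'n^'n"
  shows "det_deriv (mat 1) K = (\<Sum>i\<in>UNIV. K$i$i)"
proof -
  have "(\<Sum>i\<in>UNIV. K$i$p i * (\<Prod>j\<in>UNIV - {i}. (mat 1 :: real^'n^'n)$j$p j)) = 0"
    if p: "p permutes UNIV" "p \<noteq> id" for p
  proof (rule sum.neutral, rule ballI)
    fix i :: 'n
    have "\<exists>j\<in>UNIV - {i}. j \<noteq> p j"
    proof (rule ccontr)
      assume "\<not> ?thesis"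
      then have fix_all: "p j = j" if "j \<noteq> i" for j using that by auto
      have "p i = i"
      proof (rule ccontr)
        assume "p i \<noteq> i"
        then have "p (p i) = p i" by (rule fix_all)
        then show False using \<open>p i \<noteq> i\<close> permutes_inj[OF p(1)] by (metis injD)
      qed
      then show False using fix_all p(2) by (metis eq_id_iff)
    qed
    then obtain j where "j \<in> UNIV - {i}" "j \<noteq> p j" by blast
    then have "(\<Prod>j\<in>UNIV - {i}. (mat 1 :: real^'n^'n)$j$p j) = 0"
      by (intro prod_zero bexI[of _ j]) (auto simp: mat_def)
    then show "K$i$p i * (\<Prod>j\<in>UNIV - {i}. (mat 1 :: real^'n^'n)$j$p j) = 0" by simp
  qed
  then have "det_deriv (mat 1) K = (\<Sum>p\<in>{id}. of_int (sign p) * (\<Sum>i\<in>UNIV. K$i$p i * (\<Prod>j\<in>UNIV - {i}. (mat 1 :: real^'n^'n)$j$p j)))"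
    unfolding det_deriv_def by (intro sum.mono_neutral_right) (auto simp: permutes_id finite_permutations)
  then show ?thesis by (simp add: mat_def)
qed

text \<open>Jacobi's formula for a congruence, from \<open>det ((1 + tK)\<^sup>T A (1 + tK)) = det (1 + tK)\<^sup>2 det A\<close>.\<close>

lemma det_deriv_congruence:
  fixes A K :: "real^'n^'n"
  shows "det_deriv A (transpose K ** A + A ** K) = 2 * (\<Sum>i\<in>UNIV. K$i$i) * det A"
proof -
  define S where "S t = mat 1 + t *\<^sub>R K" for t
  have S: "((\<lambda>t. S t $ i $ j) has_real_derivative K$i$j) (at 0)" for i j
    unfolding S_def by (auto intro!: derivative_eq_intros)
  have S0: "S 0 = mat 1" by (simp add: S_def)
  define M where "M t = transpose (S t) ** A ** S t" for t
  have MH: "((\<lambda>t. M t $ i $ j) has_real_derivative (transpose K ** A + A ** K)$i$j) (at 0)" for i j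
  proof -
    have "((\<lambda>t. \<Sum>k\<in>UNIV. (\<Sum>l\<in>UNIV. S t $ l $ i * A$l$k) * S t $ k $ j) has_real_derivative
       (\<Sum>k\<in>UNIV. (\<Sum>l\<in>UNIV. K $ l $ i * A$l$k) * S 0 $ k $ j + K $ k $ j * (\<Sum>l\<in>UNIV. S 0 $ l $ i * A$l$k))) (at 0)"
      by (intro DERIV_sum DERIV_mult DERIV_cmult_right S)
    also have "(\<Sum>k\<in>UNIV. (\<Sum>l\<in>UNIV. K $ l $ i * A$l$k) * S 0 $ k $ j + K $ k $ j * (\<Sum>l\<in>UNIV. S 0 $ l $ i * A$l$k))
       = (\<Sum>l\<in>UNIV. K $ l $ i * A$l$j) + (\<Sum>k\<in>UNIV. A$i$k * K $ k $ j)"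
      by (simp add: S0 mat_def sum.distrib if_distrib[of "\<lambda>x. x * _"] if_distrib[of "\<lambda>x. _ * x"] sum.delta sum.delta' mult.commute cong: if_cong)
    also have "\<dots> = (transpose K ** A + A ** K)$i$j"
      by (simp add: matrix_matrix_mult_def transpose_def)
    also have "(\<lambda>t. \<Sum>k\<in>UNIV. (\<Sum>l\<in>UNIV. S t $ l $ i * A$l$k) * S t $ k $ j) = (\<lambda>t. M t $ i $ j)"
      by (rule ext) (simp add: M_def matrix_matrix_mult_def transpose_def)
    finally show ?thesis .
  qed
  have 1: "((\<lambda>t. det (M t)) has_real_derivative det_deriv (M 0) (transpose K ** A + A ** K)) (at 0)"
    by (rule DERIV_det[OF MH])
  have "((\<lambda>t. det (S t)) has_real_derivative det_deriv (S 0) K) (at 0)"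
    by (rule DERIV_det[OF S])
  then have s: "((\<lambda>t. det (S t)) has_real_derivative (\<Sum>i\<in>UNIV. K$i$i)) (at 0)"
    by (simp only: S0 det_deriv_mat_1)
  have "((\<lambda>t. det (S t) * det A * det (S t)) has_real_derivative
     ((\<Sum>i\<in>UNIV. K$i$i) * det A) * det (S 0) + (\<Sum>i\<in>UNIV. K$i$i) * (det (S 0) * det A)) (at 0)"
    by (intro DERIV_mult DERIV_cmult_right s)
  then have 2: "((\<lambda>t. det (M t)) has_real_derivative 2 * (\<Sum>i\<in>UNIV. K$i$i) * det A) (at 0)"
    by (simp add: M_def det_mul det_transpose S0 algebra_simps)
  show ?thesis using DERIV_unique[OF 1 2] by (simp add: M_def S0 transpose_mat)
qed

text \<open>The standard basis as a finite index type, so that a bilinear form has a Gram matrix.\<close>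

typedef (overloaded) 'e basis_index = "Basis :: 'e::euclidean_space set"
  morphisms basis_vec Abs_basis_index
  using nonempty_Basis by blast

instance basis_index :: (euclidean_space) finite
proof
  have "(UNIV :: 'a basis_index set) \<subseteq> Abs_basis_index ` (Basis :: 'a set)"
    using Abs_basis_index_cases by blast
  then show "finite (UNIV :: 'a basis_index set)" using finite_surj[OF finite_Basis] by blast
qed

lemma bij_basis_vec: "bij_betw basis_vec (UNIV :: 'e::euclidean_space basis_index set) (Basis :: 'e set)"
  unfolding bij_betw_def using type_definition.Rep_range[OF type_definition_basis_index]
  by (simp add: inj_on_def basis_vec_inject)

lemma sum_basis_index: "(\<Sum>i\<in>UNIV. f (basis_vec (i :: 'e::euclidean_space basis_index))) = (\<Sum>b\<in>Basis. f b)"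
  by (rule sum.reindex_bij_betw[OF bij_basis_vec])

definition gram :: "('e::euclidean_space \<Rightarrow> 'e \<Rightarrow> real) \<Rightarrow> real^'e basis_index^'e basis_index" where
  "gram B = (\<chi> i j. B (basis_vec i) (basis_vec j))"

lemma det_gram_nonzero:
  assumes B: "bilinear B" and pos: "\<And>v. v \<noteq> 0 \<Longrightarrow> B v v > 0"
  shows "det (gram B) \<noteq> 0"
proof -
  have ll: "linear (\<lambda>v. B v w)" and lr: "linear (B v)" for v w using B unfolding bilinear_def by blast+
  have "x = 0" if x: "gram B *v x = 0" for x
  proof -
    define v where "v = (\<Sum>i\<in>UNIV. x $ i *\<^sub>R basis_vec i)"
    have "B (basis_vec i) v = (gram B *v x) $ i" for i
      by (simp add: v_def linear_sum[OF lr] linear_scale[OF lr] gram_def matrix_vector_mult_def mult.commute)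
    then have "B (basis_vec i) v = 0" for i using x by simp
    then have "B (\<Sum>i\<in>UNIV. x $ i *\<^sub>R basis_vec i) v = 0"
      by (simp add: linear_sum[OF ll] linear_scale[OF ll])
    then have "B v v = 0" by (simp only: v_def[symmetric])
    then have "v = 0" using pos[of v] by force
    have "x $ k = v \<bullet> basis_vec k" for k
    proof -
      have "v \<bullet> basis_vec k = (\<Sum>i\<in>UNIV. x $ i * (if i = k then 1 else 0))"
        unfolding v_def inner_sum_left inner_scaleR_left
        by (intro sum.cong refl) (simp add: inner_Basis basis_vec basis_vec_inject)
      then show ?thesis by (simp add: sum.delta if_distrib cong: if_cong)
    qed
    then show "x = 0" using \<open>v = 0\<close> by (simp add: vec_eq_iff)
  qed
  then have "invertible (gram B)" using matrix_left_invertible_ker invertible_left_inverse by blast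
  then show ?thesis by (simp add: invertible_det_nz)
qed

lemma det_gram_scale:
  "det (gram (\<lambda>v w. c * B v w)) = c ^ CARD('e basis_index) * det (gram (B :: 'e::euclidean_space \<Rightarrow> 'e \<Rightarrow> real))"
  by (simp add: det_def gram_def prod.distrib sum_distrib_left mult.left_commute)

context local_metric
begin

definition trace_chris :: "'e \<Rightarrow> 'e \<Rightarrow> real" where
  "trace_chris u h = (\<Sum>b\<in>Basis. chris u h b \<bullet> b)"

text \<open>\<open>\<partial>\<^sub>h log det G = 2 tr \<Gamma>(h, \<cdot>)\<close>.\<close>

lemma deriv_det_gram:
  assumes x: "(x has_vector_derivative x') (at t within S)" and t: "t \<in> S" and xW: "x ` S \<subseteq> W"
  shows "((\<lambda>t. det (gram (G (x t)))) has_real_derivative 2 * trace_chris (x t) x' * det (gram (G (x t)))) (at t within S)"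
proof -
  have u: "x t \<in> W" using t xW by auto
  define K :: "real^'e basis_index^'e basis_index" where "K = (\<chi> l j. chris (x t) x' (basis_vec j) \<bullet> basis_vec l)"
  have expand: "G (x t) v w = (\<Sum>l\<in>UNIV. (v \<bullet> basis_vec l) * G (x t) (basis_vec l) w)" for v w
    using linear_eq_sum_Basis[OF linl[OF u], of v w] by (simp add: sum_basis_index[where f="\<lambda>b. (v \<bullet> b) * G (x t) b w"])
  have "((\<lambda>t. gram (G (x t)) $ i $ j) has_real_derivative
      (transpose K ** gram (G (x t)) + gram (G (x t)) ** K) $ i $ j) (at t within S)" for i j
  proof -
    have "((\<lambda>t. G (x t) (basis_vec i) (basis_vec j)) has_real_derivative G1 (x t) x' (basis_vec i) (basis_vec j)) (at t within S)"
      using has_vector_derivative_compose[OF x deriv[OF u]]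
      by (simp add: has_real_derivative_iff_has_vector_derivative)
    also have "G1 (x t) x' (basis_vec i) (basis_vec j) = G (x t) (chris (x t) x' (basis_vec i)) (basis_vec j)
       + G (x t) (chris (x t) x' (basis_vec j)) (basis_vec i)"
      by (simp only: G1_eq_chris[OF u] sym[OF u, of "basis_vec i"])
    also have "\<dots> = (transpose K ** gram (G (x t)) + gram (G (x t)) ** K) $ i $ j"
      unfolding expand[of "chris (x t) x' (basis_vec i)"] expand[of "chris (x t) x' (basis_vec j)"]
      by (simp add: matrix_matrix_mult_def transpose_def gram_def K_def sym[OF u, of _ "basis_vec i"] mult.commute)
    finally show ?thesis by (simp add: gram_def)
  qed
  from DERIV_det[OF this] have "((\<lambda>t. det (gram (G (x t)))) has_real_derivative
     2 * (\<Sum>i\<in>UNIV. K$i$i) * det (gram (G (x t)))) (at t within S)"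
    by (simp only: det_deriv_congruence)
  moreover have "(\<Sum>i\<in>UNIV. K$i$i) = trace_chris (x t) x'"
    by (simp add: K_def trace_chris_def sum_basis_index[where f="\<lambda>b. chris (x t) x' b \<bullet> b"])
  ultimately show ?thesis by simp
qed

lemma det_gram_G_nonzero: "u \<in> W \<Longrightarrow> det (gram (G u)) \<noteq> 0"
  by (rule det_gram_nonzero[OF bil pos])

end

section \<open>Projectively equivalent Riemannian metrics\<close>

locale metric_pair = local_metric W G G1 + M': local_metric W G' G1'
  for W :: "'e::euclidean_space set" and G G1 G' G1' +
  assumes proj: "u \<in> W \<Longrightarrow> M'.chris u \<xi> \<xi> - chris u \<xi> \<xi> \<in> span {\<xi>}"
begin

text \<open>The difference is symmetric bilinear, and projective equivalence says that its quadratic form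
  is radial.\<close>

lemma chris_diff:
  assumes u: "u \<in> W"
  obtains \<phi> :: "'e \<Rightarrow> real" where "linear \<phi>" "\<And>v w. M'.chris u v w = chris u v w + \<phi> v *\<^sub>R w + \<phi> w *\<^sub>R v"
proof -
  define T where "T v w = M'.chris u v w - chris u v w" for v w
  have 1: "linear (T v)" for v
    unfolding T_def[abs_def] by (intro linear_compose_sub M'.chris_linear chris_linear u)
  have 2: "T v w = T w v" for v w unfolding T_def M'.chris_sym[OF u, of v w] chris_sym[OF u, of v w] ..
  have 3: "T v v \<in> span {v}" for v unfolding T_def by (rule proj[OF u])
  obtain \<phi> :: "'e \<Rightarrow> real" where "linear \<phi>" "\<And>v w. T v w = \<phi> v *\<^sub>R w + \<phi> w *\<^sub>R v"
    using symmetric_bilinear_radial[of T, OF 1 2 3] by blast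
  then show thesis by (intro that[of \<phi>]) (auto simp: T_def algebra_simps)
qed

lemma trace_chris_diff:
  assumes "linear \<phi>" "\<And>v w. M'.chris u v w = chris u v w + \<phi> v *\<^sub>R w + \<phi> w *\<^sub>R v"
  shows "M'.trace_chris u h = trace_chris u h + real (DIM('e) + 1) * \<phi> h"
proof -
  have "M'.trace_chris u h = (\<Sum>b\<in>Basis. chris u h b \<bullet> b + \<phi> h + (h \<bullet> b) * \<phi> b)"
    unfolding M'.trace_chris_def assms(2)
    by (intro sum.cong refl) (simp add: inner_add_left inner_Basis mult.commute)
  also have "\<dots> = trace_chris u h + real (DIM('e)) * \<phi> h + (\<Sum>b\<in>Basis. (h \<bullet> b) * \<phi> b)"
    by (simp add: sum.distrib trace_chris_def)
  also have "(\<Sum>b\<in>Basis. (h \<bullet> b) * \<phi> b) = \<phi> h" by (rule linear_eq_sum_Basis[OF assms(1), symmetric])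
  finally show ?thesis by (simp add: algebra_simps)
qed

subsection \<open>Conformal and projectively equivalent metrics are homothetic\<close>

text \<open>Let \<open>G' = \<rho> G\<close>, and let \<open>\<phi>\<close> be the form by which the connections differ. Differentiating gives
  \<open>d\<rho>(h) |v|\<^sup>2 = 2 \<rho> (\<phi>(h) |v|\<^sup>2 + \<phi>(v) G(h, v))\<close>. For \<open>v = h\<close> this is \<open>d\<rho>(h) = 4 \<rho> \<phi>(h)\<close>, and for
  \<open>v\<close> orthogonal to \<open>h\<close> it is \<open>d\<rho>(h) = 2 \<rho> \<phi>(h)\<close>; so \<open>d\<rho>(h) = 0\<close>. An orthogonal vector exists in
  dimension at least \<open>2\<close>.\<close>

lemma conformal_factor_deriv_zero:
  assumes V: "open V" "V \<subseteq> W" and conf: "\<And>u. u \<in> V \<Longrightarrow> \<exists>\<rho>. \<forall>v w. G' u v w = \<rho> * G u v w"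
    and e: "e \<noteq> 0" and dim: "DIM('e) \<ge> 2" and u: "u \<in> V"
  shows "((\<lambda>u. G' u e e / G u e e) has_derivative (\<lambda>h. 0)) (at u)"
proof -
  have uW: "u \<in> W" using u V by auto
  define \<rho> where "\<rho> u = G' u e e / G u e e" for u
  have \<rho>: "G' x v w = \<rho> x * G x v w" if x: "x \<in> V" for x v w
  proof -
    obtain r where r: "\<forall>v w. G' x v w = r * G x v w" using conf[OF x] by blast
    have "G x e e > 0" using pos e V x by blast
    then show ?thesis using r by (simp add: \<rho>_def)
  qed
  have "G u e e \<noteq> 0" using pos[OF uW e] by simp
  then have "\<rho> differentiable (at u)"
    unfolding \<rho>_def[abs_def] using deriv[OF uW] M'.deriv[OF uW]
    by (intro differentiable_divide differentiableI) auto
  then obtain R where R: "(\<rho> has_derivative R) (at u)" unfolding differentiable_def by blast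
  have RG: "R h * G u v w = \<rho> u * (G u (M'.chris u h v - chris u h v) w + G u v (M'.chris u h w - chris u h w))" for h v w
  proof -
    have "((\<lambda>x. \<rho> x * G x v w) has_derivative (\<lambda>h. \<rho> u * G1 u h v w + R h * G u v w)) (at u)"
      by (rule has_derivative_mult[OF R deriv[OF uW]])
    then have "((\<lambda>x. G' x v w) has_derivative (\<lambda>h. \<rho> u * G1 u h v w + R h * G u v w)) (at u)"
      by (rule has_derivative_transform_within_open[OF _ V(1) u]) (simp only: \<rho>)
    from has_derivative_unique[OF M'.deriv[OF uW] this]
    have "G1' u h v w = \<rho> u * G1 u h v w + R h * G u v w" by meson
    then show ?thesis
      unfolding G1_eq_chris[OF uW] M'.G1_eq_chris[OF uW] \<rho>[OF u]
      by (simp add: G_ldiff[OF uW] G_rdiff[OF uW] algebra_simps)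
  qed
  obtain \<phi> :: "'e \<Rightarrow> real" where \<phi>: "linear \<phi>" "\<And>v w. M'.chris u v w = chris u v w + \<phi> v *\<^sub>R w + \<phi> w *\<^sub>R v"
    using chris_diff[OF uW] by blast
  have Rv: "R h * G u v v = 2 * \<rho> u * (\<phi> h * G u v v + \<phi> v * G u h v)" for h v
    unfolding RG \<phi>(2) using sym[OF uW, of v h]
    by (simp add: G_ladd[OF uW] G_radd[OF uW] G_lscale[OF uW] G_rscale[OF uW] algebra_simps)
  have "R h = 0" for h
  proof (cases "h = 0")
    case True
    then show ?thesis using linear_0[OF has_derivative_linear[OF R]] by simp
  next
    case False
    have 1: "R h = 4 * \<rho> u * \<phi> h" using Rv[of h h] pos[OF uW False] by (simp add: algebra_simps)
    obtain v where v: "v \<noteq> 0" "G u h v = 0"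
    proof -
      obtain b b' :: 'e where b: "b \<in> Basis" "b' \<in> Basis" "b \<noteq> b'"
      proof -
        have "\<not> is_singleton (Basis :: 'e set)" using dim by (auto simp: is_singleton_altdef)
        then show thesis using that nonempty_Basis by (metis is_singletonI')
      qed
      show thesis
      proof (cases "G u h b = 0")
        case True
        then show thesis using that b nonzero_Basis by metis
      next
        case False
        define w where "w = G u h b *\<^sub>R b' - G u h b' *\<^sub>R b"
        have "w \<bullet> b' = G u h b" using b by (simp add: w_def inner_diff_left inner_Basis)
        then have "w \<noteq> 0" using False by auto
        moreover have "G u h w = 0" by (simp add: w_def G_rdiff[OF uW] G_rscale[OF uW])
        ultimately show thesis using that by blast
      qed
    qed
    have 2: "R h = 2 * \<rho> u * \<phi> h" using Rv[of h v] v pos[OF uW v(1)] by simp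
    have "\<rho> u > 0" using pos[OF uW e] M'.pos[OF uW e] by (simp add: \<rho>_def)
    with 1 2 show ?thesis by simp
  qed
  then have "R = (\<lambda>h. 0)" by blast
  then show ?thesis using R unfolding \<rho>_def[abs_def] by metis
qed

lemma conformal_factor_const:
  assumes V: "open V" "V \<subseteq> W" "convex V" and conf: "\<And>u. u \<in> V \<Longrightarrow> \<exists>\<rho>. \<forall>v w. G' u v w = \<rho> * G u v w"
    and dim: "DIM('e) \<ge> 2"
  obtains c where "\<And>u v w. u \<in> V \<Longrightarrow> G' u v w = c * G u v w"
proof -
  have e: "(SOME b. b \<in> Basis) \<noteq> (0 :: 'e)" by (rule nonzero_Basis[OF SOME_Basis])
  define e :: 'e where "e = (SOME b. b \<in> Basis)"
  note e = e[folded e_def]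
  have d: "((\<lambda>u. G' u e e / G u e e) has_derivative (\<lambda>h. 0)) (at u within V)" if "u \<in> V" for u
    by (rule has_derivative_at_withinI[OF conformal_factor_deriv_zero[OF V(1,2) conf e dim that]])
  from has_derivative_zero_constant[OF V(3) d]
  obtain c where c: "\<And>u. u \<in> V \<Longrightarrow> G' u e e / G u e e = c" by meson
  have "G' u v w = c * G u v w" if u: "u \<in> V" for u v w
  proof -
    obtain r where r: "\<forall>v w. G' u v w = r * G u v w" using conf[OF u] by blast
    have "G u e e > 0" using pos e V u by blast
    then show ?thesis using r c[OF u] by simp
  qed
  then show thesis using that by blast
qed

subsection \<open>The quadratic integral of the geodesic flow\<close>

text \<open>Let \<open>\<phi>\<close> be the form by which the connections differ. Along a geodesic of \<open>G\<close> with velocity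
  \<open>v\<close>, the logarithmic derivative of \<open>G'(v, v)\<close> is \<open>4 \<phi>(v)\<close>, and that of \<open>det G' / det G\<close> is
  \<open>2 (n + 1) \<phi>(v)\<close> by the trace of the connections, where \<open>n\<close> is the dimension.\<close>

lemma quadratic_integral:
  assumes x: "\<And>s. s \<in> S \<Longrightarrow> (x has_vector_derivative v s) (at s within S)"
    and v: "\<And>s. s \<in> S \<Longrightarrow> (v has_vector_derivative - chris (x s) (v s) (v s)) (at s within S)"
    and S: "convex S" "x ` S \<subseteq> W"
  obtains c d where "\<And>s. s \<in> S \<Longrightarrow> G (x s) (v s) (v s) = c"
    "\<And>s. s \<in> S \<Longrightarrow> (G' (x s) (v s) (v s)) ^ (DIM('e) + 1) * (det (gram (G (x s))))\<^sup>2 / (det (gram (G' (x s))))\<^sup>2 = d"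
proof -
  define m where "m = DIM('e) + 1"
  define a where "a s = G' (x s) (v s) (v s)" for s
  define p where "p s = det (gram (G (x s)))" for s
  define q where "q s = det (gram (G' (x s)))" for s
  have c: "((\<lambda>s. G (x s) (v s) (v s)) has_real_derivative 0) (at s within S)" if s: "s \<in> S" for s
  proof -
    have u: "x s \<in> W" using s S(2) by auto
    show ?thesis
      using deriv_G[OF x[OF s] v[OF s] v[OF s] s S(2)]
      by (simp add: G1_eq_chris[OF u] G_lneg[OF u] G_rneg[OF u])
  qed
  have d: "((\<lambda>s. a s ^ m * (p s)\<^sup>2 / (q s)\<^sup>2) has_real_derivative 0) (at s within S)" if s: "s \<in> S" for s
  proof -
    have u: "x s \<in> W" using s S(2) by auto
    obtain \<phi> :: "'e \<Rightarrow> real" where \<phi>: "linear \<phi>" "\<And>v w. M'.chris (x s) v w = chris (x s) v w + \<phi> v *\<^sub>R w + \<phi> w *\<^sub>R v"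
      using chris_diff[OF u] by blast
    define k where "k = trace_chris (x s) (v s)"
    define k' where "k' = M'.trace_chris (x s) (v s)"
    have k': "k' = k + real m * \<phi> (v s)"
      unfolding k_def k'_def m_def by (rule trace_chris_diff[OF \<phi>])
    have da: "(a has_real_derivative 4 * \<phi> (v s) * a s) (at s within S)"
      unfolding a_def[abs_def]
      using M'.deriv_G[OF x[OF s] v[OF s] v[OF s] s S(2)]
      by (simp add: M'.G1_eq_chris[OF u] \<phi>(2) M'.G_lneg[OF u] M'.G_rneg[OF u] M'.G_ladd[OF u] M'.G_radd[OF u]
          M'.G_lscale[OF u] M'.G_rscale[OF u] mult.assoc)
    have dp: "(p has_real_derivative 2 * k * p s) (at s within S)"
      unfolding p_def[abs_def] k_def by (rule deriv_det_gram[OF x[OF s] s S(2)])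
    have dq: "(q has_real_derivative 2 * k' * q s) (at s within S)"
      unfolding q_def[abs_def] k'_def by (rule M'.deriv_det_gram[OF x[OF s] s S(2)])
    have q0: "q s \<noteq> 0" unfolding q_def by (rule M'.det_gram_G_nonzero[OF u])
    have dam: "((\<lambda>s. a s ^ m) has_real_derivative real m * (4 * \<phi> (v s) * a s) * a s ^ (m - 1)) (at s within S)"
      using DERIV_power[OF da, of m] by (simp add: mult.assoc)
    have "real m * (4 * \<phi> (v s) * a s) * a s ^ (m - 1) = 4 * real m * \<phi> (v s) * a s ^ m"
      by (simp add: m_def)
    from dam[unfolded this]
    have dam: "((\<lambda>s. a s ^ m) has_real_derivative 4 * real m * \<phi> (v s) * a s ^ m) (at s within S)" .
    have dp2: "((\<lambda>s. (p s)\<^sup>2) has_real_derivative 4 * k * (p s)\<^sup>2) (at s within S)"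
      using DERIV_power[OF dp, of 2] by (simp add: power2_eq_square algebra_simps)
    have dq2: "((\<lambda>s. (q s)\<^sup>2) has_real_derivative 4 * k' * (q s)\<^sup>2) (at s within S)"
      using DERIV_power[OF dq, of 2] by (simp add: power2_eq_square algebra_simps)
    have "((\<lambda>s. a s ^ m * (p s)\<^sup>2 / (q s)\<^sup>2) has_real_derivative
       ((4 * real m * \<phi> (v s) * a s ^ m * (p s)\<^sup>2 + 4 * k * (p s)\<^sup>2 * a s ^ m) * (q s)\<^sup>2
         - a s ^ m * (p s)\<^sup>2 * (4 * k' * (q s)\<^sup>2)) / ((q s)\<^sup>2 * (q s)\<^sup>2)) (at s within S)"
      using q0 by (intro DERIV_divide DERIV_mult dam dp2 dq2) simp
    also have "(4 * real m * \<phi> (v s) * a s ^ m * (p s)\<^sup>2 + 4 * k * (p s)\<^sup>2 * a s ^ m) * (q s)\<^sup>2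
         - a s ^ m * (p s)\<^sup>2 * (4 * k' * (q s)\<^sup>2) = 0"
      unfolding k' by (simp add: algebra_simps)
    finally show ?thesis by simp
  qed
  obtain c where "\<And>s. s \<in> S \<Longrightarrow> G (x s) (v s) (v s) = c"
    using has_field_derivative_zero_constant[OF S(1) c] by blast
  moreover obtain d where "\<And>s. s \<in> S \<Longrightarrow> a s ^ m * (p s)\<^sup>2 / (q s)\<^sup>2 = d"
    using has_field_derivative_zero_constant[OF S(1) d] by blast
  ultimately show thesis using that unfolding a_def p_def q_def m_def by blast
qed

text \<open>Second differences around \<open>u\<^sub>0\<close> recover the forms on all vectors.\<close>

lemma quadratic_forms_eq:
  fixes B B' :: "'e \<Rightarrow> 'e \<Rightarrow> real"
  assumes B: "bilinear B" "\<And>v w. B v w = B w v" and B': "bilinear B'" "\<And>v w. B' v w = B' w v"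
    and d: "d > 0" "\<And>w. w \<in> ball u0 d \<Longrightarrow> B w w = B' w w"
  shows "B v w = B' v w"
proof -
  have l: "linear (\<lambda>v. B v w)" "linear (B v)" "linear (\<lambda>v. B' v w)" "linear (B' v)" for v w
    using B(1) B'(1) unfolding bilinear_def by blast+
  note ls = linear_add[OF l(1)] linear_add[OF l(2)] linear_scale[OF l(1)] linear_scale[OF l(2)]
    linear_add[OF l(3)] linear_add[OF l(4)] linear_scale[OF l(3)] linear_scale[OF l(4)]
    linear_diff[OF l(1)] linear_diff[OF l(2)] linear_diff[OF l(3)] linear_diff[OF l(4)]
  have diag: "B v v = B' v v" for v
  proof -
    define s where "s = d / (norm v + 1)"
    have n: "norm v + 1 > 0" by (smt (verit) norm_ge_zero)
    have s: "s > 0" using d(1) n by (simp add: s_def)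
    have "s * norm v < s * (norm v + 1)" using s by simp
    also have "\<dots> = d" using n by (simp add: s_def)
    finally have sd: "s * norm v < d" .
    have "u0 + s *\<^sub>R v \<in> ball u0 d" "u0 - s *\<^sub>R v \<in> ball u0 d" using s sd by (simp_all add: dist_norm)
    then have p: "B (u0 + s *\<^sub>R v) (u0 + s *\<^sub>R v) = B' (u0 + s *\<^sub>R v) (u0 + s *\<^sub>R v)"
      "B (u0 - s *\<^sub>R v) (u0 - s *\<^sub>R v) = B' (u0 - s *\<^sub>R v) (u0 - s *\<^sub>R v)" by (simp_all only: d(2))
    have p0: "B u0 u0 = B' u0 u0" using d by simp
    have "s * B v u0 + s * B u0 v + s * (s * B v v) = s * B' v u0 + s * B' u0 v + s * (s * B' v v)"
      using p(1) p0 by (simp add: ls algebra_simps)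
    moreover have "s * (s * B v v) - s * B v u0 - s * B u0 v = s * (s * B' v v) - s * B' v u0 - s * B' u0 v"
      using p(2) p0 by (simp add: ls algebra_simps)
    ultimately have "s * (s * B v v) = s * (s * B' v v)" by linarith
    then show ?thesis using s by simp
  qed
  show ?thesis
    using diag[of "v + w"] diag[of v] diag[of w] B(2)[of w v] B'(2)[of w v] by (simp add: ls)
qed

subsection \<open>Unique continuation of homothety\<close>

text \<open>Let \<open>G' = c G\<close> on a small ball, and let \<open>x\<close> lie in the concentric ball of twice the radius.
  The geodesics from \<open>x\<close> in an open set of directions enter the small ball. The quadratic integral
  then shows that \<open>G'\<close> and \<open>G\<close> have the same ratio in all these directions, so they are conformal at
  \<open>x\<close>.\<close>

lemma homothety_doubling:
  assumes p: "p \<in> W" and dim: "DIM('e) \<ge> 2"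
  obtains r0 where "r0 > 0" "ball p r0 \<subseteq> W"
    "\<And>q r c u v w. \<lbrakk>r > 0; c > 0; ball q (2 * r) \<subseteq> ball p r0;
       \<And>u v w. u \<in> ball q r \<Longrightarrow> G' u v w = c * G u v w; u \<in> ball q (2 * r)\<rbrakk> \<Longrightarrow> G' u v w = c * G u v w"
proof -
  \<comment> \<open>the geodesics of \<open>G\<close> are those of the Randers metric with zero one-form\<close>
  interpret R: local_randers W G G1 "\<lambda>_ _. 0" "\<lambda>_ _ _. 0"
    by unfold_locales (auto simp: open_W linear_iff)
  have J0: "R.J u v = 0" if u: "u \<in> W" for u v
    by (rule G_cancel[OF u]) (simp add: R.G_J[OF u] R.F.dB_def G_l0[OF u])
  have spray: "R.spray u v = - chris u v v" if "u \<in> W" for u v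
    using J0[OF that] by (simp add: R.spray_def)
  obtain \<delta> \<tau> C where C: "\<delta> > 0" "\<tau> > 0" "C \<ge> 0" "cball p \<delta> \<subseteq> W"
    and sol: "\<And>u v. u \<in> cball p \<delta> \<Longrightarrow> norm v \<le> 2 \<Longrightarrow> \<exists>x x'. x 0 = u \<and> x' 0 = v \<and>
       (\<forall>t\<in>{0..\<tau>}. x t \<in> W \<and> (x has_vector_derivative x' t) (at t within {0..\<tau>}) \<and>
          (x' has_vector_derivative R.spray (x t) (x' t)) (at t within {0..\<tau>}) \<and>
          norm (x' t - v) \<le> C * t \<and> norm (x t - u - t *\<^sub>R v) \<le> C * t\<^sup>2)"
    using R.spray_solution[OF p, of 2] by (metis zero_le_numeral)
  \<comment> \<open>Up to time \<open>t \<le> r0\<close>, a geodesic stays within \<open>t / 8\<close> of the straight line.\<close>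
  define r0 where "r0 = min \<delta> (min \<tau> (1 / (8 * (C + 1))))"
  have r0: "r0 > 0" "r0 \<le> \<delta>" "r0 \<le> \<tau>" "C * r0 \<le> 1 / 8"
  proof -
    show "r0 > 0" "r0 \<le> \<delta>" "r0 \<le> \<tau>" using C by (auto simp: r0_def)
    have "C * r0 \<le> C * (1 / (8 * (C + 1)))" using C by (intro mult_left_mono) (auto simp: r0_def)
    also have "\<dots> \<le> 1 / 8" using C by (simp add: field_simps)
    finally show "C * r0 \<le> 1 / 8" .
  qed
  show thesis
  proof (rule that[OF r0(1)])
    show "ball p r0 \<subseteq> W" using r0 C(4) by (meson ball_subset_cball cball_subset_cball_iff order_trans subset_ball subset_cball)
    fix q r c u v w
    assume r: "r > 0" and c: "c > 0" and qp: "ball q (2 * r) \<subseteq> ball p r0"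
      and hom: "\<And>u v w. u \<in> ball q r \<Longrightarrow> G' u v w = c * G u v w" and u: "u \<in> ball q (2 * r)"
    have r2: "2 * r \<le> r0" using qp r unfolding ball_subset_ball_iff by (smt (verit) zero_le_dist)
    have WB: "ball q (2 * r) \<subseteq> W" using qp \<open>ball p r0 \<subseteq> W\<close> by blast
    have conf: "\<exists>\<rho>. \<forall>v w. G' x v w = \<rho> * G x v w" if x: "x \<in> ball q (2 * r)" for x
    proof (cases "x \<in> ball q r")
      case True
      then show ?thesis using hom by blast
    next
      case False
      have xW: "x \<in> W" using x WB by blast
      define t where "t = dist q x"
      have t: "r \<le> t" "t < 2 * r" "0 < t" using x False r by (auto simp: t_def)
      \<comment> \<open>The unit vector \<open>u0\<close> points at the centre, which is at distance \<open>t\<close> from \<open>x\<close>. For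
        directions within \<open>1 / 4\<close> of it, the geodesic is at time \<open>t\<close> within \<open>t / 8 + t / 4\<close> of the
        centre, which is less than \<open>r\<close>.\<close>
      define u0 where "u0 = (1 / t) *\<^sub>R (q - x)"
      have nu0: "norm u0 = 1" "t *\<^sub>R u0 = q - x" using t(3) by (auto simp: u0_def t_def dist_norm)
      define m where "m = DIM('e) + 1"
      have key: "G' x w w ^ m = (c * G x w w) ^ m * ((det (gram (G' x)))\<^sup>2 / (det (gram (G x)))\<^sup>2 / (c ^ CARD('e basis_index))\<^sup>2)"
        if w: "w \<in> ball u0 (1/4)" for w
      proof -
        have nw: "norm (w - u0) < 1 / 4" using w by (simp add: dist_norm norm_minus_commute)
        have "norm w \<le> norm u0 + norm (w - u0)" by (metis norm_triangle_sub)
        then have nw2: "norm w \<le> 2" using nw nu0 by simp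
        have "norm u0 \<le> norm w + norm (w - u0)" by (metis norm_triangle_sub norm_minus_commute)
        then have nw3: "norm w \<ge> 3 / 4" using nw nu0 by simp
        have xp: "x \<in> cball p \<delta>" using x qp r0 by (auto dest!: subsetD)
        obtain y y' where y: "y 0 = x" "y' 0 = w" and ysol: "\<forall>s\<in>{0..\<tau>}. y s \<in> W \<and> (y has_vector_derivative y' s) (at s within {0..\<tau>}) \<and>
          (y' has_vector_derivative R.spray (y s) (y' s)) (at s within {0..\<tau>}) \<and>
          norm (y' s - w) \<le> C * s \<and> norm (y s - x - s *\<^sub>R w) \<le> C * s\<^sup>2"
          using sol[OF xp nw2] by blast
        have tt: "t \<in> {0..\<tau>}" "0 \<in> {0..\<tau>}" using t r2 r0 C by auto
        have Ct: "C * t \<le> 1 / 8"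
        proof -
          have "C * t \<le> C * r0" using t r2 C by (intro mult_left_mono) auto
          then show ?thesis using r0 by simp
        qed
        have yW: "y ` {0..\<tau>} \<subseteq> W" using ysol by blast
        have dy: "(y has_vector_derivative y' s) (at s within {0..\<tau>})" if "s \<in> {0..\<tau>}" for s using ysol that by blast
        have dy': "(y' has_vector_derivative - chris (y s) (y' s) (y' s)) (at s within {0..\<tau>})" if "s \<in> {0..\<tau>}" for s
          using ysol that spray by metis
        obtain k d where kd: "\<And>s. s \<in> {0..\<tau>} \<Longrightarrow> G (y s) (y' s) (y' s) = k"
          "\<And>s. s \<in> {0..\<tau>} \<Longrightarrow> (G' (y s) (y' s) (y' s)) ^ m * (det (gram (G (y s))))\<^sup>2 / (det (gram (G' (y s))))\<^sup>2 = d"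
          using quadratic_integral[OF dy dy' convex_real_interval(5) yW] unfolding m_def by blast
        have yq: "y t \<in> ball q r"
        proof -
          have eq: "y t - q = (y t - x - t *\<^sub>R w) + t *\<^sub>R (w - u0)" using nu0(2) by (simp add: scaleR_diff_right)
          have "norm (y t - q) \<le> norm (y t - x - t *\<^sub>R w) + norm (t *\<^sub>R (w - u0))"
            unfolding eq by (rule norm_triangle_ineq)
          also have "norm (t *\<^sub>R (w - u0)) = t * norm (w - u0)" using t(3) by simp
          finally have "norm (y t - q) \<le> norm (y t - x - t *\<^sub>R w) + t * norm (w - u0)" .
          also have "\<dots> \<le> C * t\<^sup>2 + t * (1 / 4)"
            using ysol tt(1) nw t(3) by (intro add_mono mult_left_mono) auto
          also have "\<dots> = t * (C * t + 1 / 4)" by (simp add: power2_eq_square algebra_simps)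
          also have "\<dots> \<le> t * (3 / 8)" using Ct t(3) by (intro mult_left_mono) auto
          also have "\<dots> < r" using t r by simp
          finally show ?thesis by (simp add: dist_norm norm_minus_commute)
        qed
        have ytW: "y t \<in> W" using yW tt by blast
        have G't: "G' (y t) = (\<lambda>v w. c * G (y t) v w)" using hom[OF yq] by blast
        define n where "n = c ^ CARD('e basis_index)"
        have n: "n \<noteq> 0" using c by (simp add: n_def)
        have dt: "det (gram (G' (y t))) = n * det (gram (G (y t)))" unfolding G't det_gram_scale n_def ..
        have nz: "det (gram (G (y t))) \<noteq> 0" "det (gram (G x)) \<noteq> 0" "det (gram (G' x)) \<noteq> 0"
          by (rule det_gram_G_nonzero[OF ytW] det_gram_G_nonzero[OF xW] M'.det_gram_G_nonzero[OF xW])+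
        have "d = (c * k) ^ m * (det (gram (G (y t))))\<^sup>2 / (n * det (gram (G (y t))))\<^sup>2"
          unfolding kd(2)[OF tt(1), symmetric] dt unfolding G't kd(1)[OF tt(1)] ..
        also have "\<dots> = (c * k) ^ m / n\<^sup>2" using nz n by (simp add: power_mult_distrib)
        finally have d: "d = (c * G x w w) ^ m / n\<^sup>2" using kd(1)[OF tt(2)] y by simp
        have "G' x w w ^ m * (det (gram (G x)))\<^sup>2 / (det (gram (G' x)))\<^sup>2 = (c * G x w w) ^ m / n\<^sup>2"
          using kd(2)[OF tt(2)] y d by simp
        then show ?thesis using nz n unfolding n_def[symmetric] by (simp add: field_simps)
      qed
      have u00: "u0 \<noteq> 0" using nu0 by auto
      define \<rho> where "\<rho> = G' x u0 u0 / G x u0 u0"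
      have pu: "G x u0 u0 > 0" "G' x u0 u0 > 0" using pos[OF xW u00] M'.pos[OF xW u00] by auto
      then have "\<rho> > 0" by (simp add: \<rho>_def)
      have eqw: "G' x w w = \<rho> * G x w w" if w: "w \<in> ball u0 (1/4)" for w
      proof -
        have w0: "w \<noteq> 0" using w nu0 by (auto simp: dist_norm)
        have pw: "G x w w > 0" "G' x w w > 0" using pos[OF xW w0] M'.pos[OF xW w0] by auto
        define L where "L = (det (gram (G' x)))\<^sup>2 / (det (gram (G x)))\<^sup>2 / (c ^ CARD('e basis_index))\<^sup>2"
        have 1: "G' x w w ^ m = (c * G x w w) ^ m * L" using key[OF w] by (simp add: L_def)
        have 2: "G' x u0 u0 ^ m = (c * G x u0 u0) ^ m * L" using key[of u0] by (simp add: L_def)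
        have "(G' x w w * G x u0 u0) ^ m = (G' x u0 u0 * G x w w) ^ m"
          unfolding power_mult_distrib 1 2 by (simp add: algebra_simps)
        then have "G' x w w * G x u0 u0 = G' x u0 u0 * G x w w"
          using power_eq_iff_eq_base[of m "G' x w w * G x u0 u0" "G' x u0 u0 * G x w w"] pu pw by (simp add: m_def)
        then show ?thesis using pu by (simp add: \<rho>_def field_simps)
      qed
      have "G' x v w = \<rho> * G x v w" for v w
      proof (rule quadratic_forms_eq[of "G' x" "\<lambda>v w. \<rho> * G x v w" "1/4" u0])
        show "bilinear (G' x)" by (rule M'.bil[OF xW])
        show "bilinear (\<lambda>v w. \<rho> * G x v w)"
          unfolding bilinear_def
          using linear_compose_scale_right[OF linl[OF xW], of \<rho>] linear_compose_scale_right[OF linr[OF xW], of \<rho>] by simp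
        show "G' x v w = G' x w v" "\<rho> * G x v w = \<rho> * G x w v" for v w
          using M'.sym[OF xW] sym[OF xW] by auto
      qed (use eqw in auto)
      then show ?thesis by blast
    qed
    obtain c' where c': "\<And>u v w. u \<in> ball q (2 * r) \<Longrightarrow> G' u v w = c' * G u v w"
      using conformal_factor_const[OF open_ball WB convex_ball conf dim] by blast
    obtain e :: 'e where e: "e \<noteq> 0" using nonzero_Basis[OF SOME_Basis] by blast
    have qq: "q \<in> ball q r" "q \<in> ball q (2 * r)" using r by auto
    then have "c' * G q e e = c * G q e e" using c' hom by metis
    moreover have "G q e e > 0" using pos[of q e] WB qq e by blast
    ultimately have "c' = c" by simp
    then show "G' u v w = c * G u v w" using c'[OF u] by simp
  qed
qed

text \<open>The radius of a ball on which the metrics are homothetic can be doubled until the ball has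
  radius \<open>2 r0 / 3\<close>. With its centre in \<open>ball p (r0 / 3)\<close>, it then still lies in \<open>ball p r0\<close>, and it
  covers \<open>ball p (r0 / 3)\<close>.\<close>

lemma homothety_propagation:
  assumes p: "p \<in> W" and dim: "DIM('e) \<ge> 2"
  obtains d where "d > 0" "ball p d \<subseteq> W"
    "\<And>q r c. \<lbrakk>q \<in> ball p d; r > 0; c > 0; \<forall>u\<in>ball q r. \<forall>v w. G' u v w = c * G u v w\<rbrakk>
       \<Longrightarrow> \<forall>u\<in>ball p d. \<forall>v w. G' u v w = c * G u v w"
proof -
  obtain r0 where r0: "r0 > 0" "ball p r0 \<subseteq> W" and dbl: "\<And>q r c u v w. \<lbrakk>r > 0; c > 0; ball q (2 * r) \<subseteq> ball p r0;
       \<And>u v w. u \<in> ball q r \<Longrightarrow> G' u v w = c * G u v w; u \<in> ball q (2 * r)\<rbrakk> \<Longrightarrow> G' u v w = c * G u v w"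
    using homothety_doubling[OF p dim] by blast
  show thesis
  proof (rule that[of "r0 / 3"])
    show "r0 / 3 > 0" using r0 by simp
    show "ball p (r0 / 3) \<subseteq> W" using r0 subset_ball[of "r0 / 3" r0 p] by auto
    fix q r c
    assume q: "q \<in> ball p (r0 / 3)" and r: "r > 0" and c: "c > 0"
      and hom: "\<forall>u\<in>ball q r. \<forall>v w. G' u v w = c * G u v w"
    define R where "R k = min (2 ^ k * r) (2 * r0 / 3)" for k :: nat
    have Rsub: "ball q s \<subseteq> ball p r0" if "s \<le> 2 * r0 / 3" for s
    proof
      fix y assume "y \<in> ball q s"
      then show "y \<in> ball p r0" using that q dist_triangle[of p y q] by simp
    qed
    have all: "\<forall>u v w. u \<in> ball q (R k) \<longrightarrow> G' u v w = c * G u v w" for k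
    proof (induction k)
      case 0
      then show ?case using hom by (auto simp: R_def)
    next
      case (Suc k)
      have "R (Suc k) \<le> 2 * (2 ^ k * r)" "R (Suc k) \<le> 2 * r0 / 3" by (simp_all add: R_def)
      then have half: "R (Suc k) / 2 \<le> R k" "R (Suc k) > 0" using r r0 by (simp_all add: R_def[of k]) (simp add: R_def)
      show ?case
      proof (intro allI impI)
        fix u v w assume u: "u \<in> ball q (R (Suc k))"
        show "G' u v w = c * G u v w"
        proof (rule dbl[of "R (Suc k) / 2" c q])
          show "ball q (2 * (R (Suc k) / 2)) \<subseteq> ball p r0" by (rule Rsub) (simp add: R_def)
          show "G' u v w = c * G u v w" if "u \<in> ball q (R (Suc k) / 2)" for u v w
            using Suc.IH that half(1) by auto
        qed (use half c u in auto)
      qed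
    qed
    obtain k where "2 * r0 / 3 < 2 ^ k * r"
    proof -
      obtain k where "(2 * r0 / 3) / r < 2 ^ k" using real_arch_pow[of 2] by auto
      then have "2 * r0 / 3 < 2 ^ k * r" using r by (simp add: field_simps)
      then show thesis by (rule that)
    qed
    then have Rk: "R k = 2 * r0 / 3" by (simp add: R_def)
    have "ball p (r0 / 3) \<subseteq> ball q (R k)"
    proof
      fix u assume "u \<in> ball p (r0 / 3)"
      then have "dist q u < 2 * r0 / 3"
        using q dist_triangle[of q u p] by (simp add: dist_commute)
      then show "u \<in> ball q (R k)" by (simp only: mem_ball Rk)
    qed
    then show "\<forall>u\<in>ball p (r0 / 3). \<forall>v w. G' u v w = c * G u v w" using all[of k] by blast
  qed
qed

end

section \<open>Charts, tangent vectors and velocities\<close>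

locale mfd =
  fixes X :: "'a topology" and A :: "('a, 'e::euclidean_space) chart set"
  assumes smooth: "smooth_manifold X A"
begin

lemma open_chart: "c \<in> A \<Longrightarrow> openin X (fst c)"
  and open_W: "c \<in> A \<Longrightarrow> open (snd c ` fst c)"
  and homeo: "c \<in> A \<Longrightarrow> homeomorphic_map (subtopology X (fst c)) (top_of_set (snd c ` fst c)) (snd c)"
  and topspace_X: "topspace X = (\<Union>c\<in>A. fst c)"
  and trans_Ck: "c \<in> A \<Longrightarrow> d \<in> A \<Longrightarrow> Ck_on k (transition c d) (snd c ` (fst c \<inter> fst d))"
  using smooth unfolding smooth_manifold_def by blast+

lemma charts_at_iff: "c \<in> charts_at A p \<longleftrightarrow> c \<in> A \<and> p \<in> fst c"
  by (auto simp: charts_at_def)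

lemma ex_chart: "p \<in> topspace X \<Longrightarrow> \<exists>c\<in>A. p \<in> fst c"
  using topspace_X by auto

lemma inj_chart: assumes c: "c \<in> A" shows "inj_on (snd c) (fst c)"
proof -
  have "topspace (subtopology X (fst c)) = fst c"
    using openin_subset[OF open_chart[OF c]] by auto
  then show ?thesis using homeomorphic_imp_injective_map[OF homeo[OF c]] by simp
qed

lemma inv_chart: "c \<in> A \<Longrightarrow> p \<in> fst c \<Longrightarrow> chart_inv c (snd c p) = p"
  unfolding chart_inv_def by (rule inv_into_f_f[OF inj_chart])

lemma chart_inv: "u \<in> snd c ` fst c \<Longrightarrow> snd c (chart_inv c u) = u"
  unfolding chart_inv_def by (rule f_inv_into_f)

lemma chart_inv_in: "u \<in> snd c ` fst c \<Longrightarrow> chart_inv c u \<in> fst c"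
  unfolding chart_inv_def by (rule inv_into_into)

lemma cont_chart: "c \<in> A \<Longrightarrow> continuous_map (subtopology X (fst c)) (top_of_set (snd c ` fst c)) (snd c)"
  using homeo homeomorphic_imp_continuous_map by blast

lemma openin_preimage:
  assumes c: "c \<in> A" and T: "open T"
  shows "openin X {p \<in> fst c. snd c p \<in> T}"
proof -
  have U: "topspace (subtopology X (fst c)) = fst c"
    using openin_subset[OF open_chart[OF c]] by auto
  have "openin (top_of_set (snd c ` fst c)) (T \<inter> snd c ` fst c)"
    using T by (metis inf_commute openin_open_Int)
  from openin_continuous_map_preimage[OF cont_chart[OF c] this]
  have "openin (subtopology X (fst c)) {p \<in> fst c. snd c p \<in> T \<inter> snd c ` fst c}"
    by (simp only: U)
  then have "openin X {p \<in> fst c. snd c p \<in> T \<inter> snd c ` fst c}"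
    by (rule openin_trans_full[OF _ open_chart[OF c]])
  moreover have "{p \<in> fst c. snd c p \<in> T \<inter> snd c ` fst c} = {p \<in> fst c. snd c p \<in> T}" by auto
  ultimately show ?thesis by simp
qed

lemma open_image:
  assumes c: "c \<in> A" and T: "openin X T"
  shows "open (snd c ` (fst c \<inter> T))"
proof -
  have "openin (subtopology X (fst c)) (fst c \<inter> T)" using T by (metis inf_commute openin_subtopology_Int)
  then have "openin (top_of_set (snd c ` fst c)) (snd c ` (fst c \<inter> T))"
    using homeomorphic_imp_open_map[OF homeo[OF c]] unfolding open_map_def by blast
  then show ?thesis using openin_open_trans open_W[OF c] by blast
qed

lemma cont_chart_inv:
  assumes c: "c \<in> A"
  shows "continuous_map (top_of_set (snd c ` fst c)) X (chart_inv c)"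
proof -
  obtain g where g: "homeomorphic_maps (subtopology X (fst c)) (top_of_set (snd c ` fst c)) (snd c) g"
    using homeo[OF c] homeomorphic_map_maps by blast
  have U: "topspace (subtopology X (fst c)) = fst c"
    using openin_subset[OF open_chart[OF c]] by auto
  have cg: "continuous_map (top_of_set (snd c ` fst c)) (subtopology X (fst c)) g"
    and inv: "\<And>p. p \<in> fst c \<Longrightarrow> g (snd c p) = p"
    using g U unfolding homeomorphic_maps_def by auto
  have "continuous_map (top_of_set (snd c ` fst c)) X g"
    using cg continuous_map_in_subtopology by blast
  then show ?thesis
    by (rule continuous_map_eq) (auto simp: inv inv_chart[OF c])
qed

lemma open_overlap: "c \<in> A \<Longrightarrow> d \<in> A \<Longrightarrow> open (snd c ` (fst c \<inter> fst d))"
  using open_image open_chart by blast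

lemma trans_apply: "c \<in> A \<Longrightarrow> p \<in> fst c \<Longrightarrow> transition c d (snd c p) = snd d p"
  by (simp add: transition_def inv_chart)

text \<open>The derivative of a coordinate change, as a function of the point of the manifold.\<close>

definition Dtrans :: "('a, 'e) chart \<Rightarrow> ('a, 'e) chart \<Rightarrow> 'a \<Rightarrow> 'e \<Rightarrow> 'e" where
  "Dtrans c d p = frechet_derivative (transition c d) (at (snd c p))"

lemma Dtrans:
  assumes "c \<in> A" "d \<in> A" "p \<in> fst c" "p \<in> fst d"
  shows "(transition c d has_derivative Dtrans c d p) (at (snd c p))"
proof -
  have *: "snd c p \<in> snd c ` (fst c \<inter> fst d)" using assms by blast
  have "Ck_on 1 (transition c d) (snd c ` (fst c \<inter> fst d))" by (rule trans_Ck[OF assms(1,2)])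
  then obtain f' where f': "\<forall>x\<in>snd c ` (fst c \<inter> fst d). (transition c d has_derivative f' x) (at x within snd c ` (fst c \<inter> fst d))"
    by auto
  from bspec[OF f' *] have "(transition c d has_derivative f' (snd c p)) (at (snd c p))"
    by (simp only: at_within_open[OF * open_overlap[OF assms(1,2)]])
  then show ?thesis unfolding Dtrans_def using frechet_derivative_works differentiableI by blast
qed

lemma Dtrans_linear:
  assumes "c \<in> A" "d \<in> A" "p \<in> fst c" "p \<in> fst d"
  shows "linear (Dtrans c d p)"
  using Dtrans[OF assms] has_derivative_linear by blast

lemma Dtrans_self:
  assumes c: "c \<in> A" "p \<in> fst c" shows "Dtrans c c p v = v"
proof -
  have "(transition c c has_derivative (\<lambda>v. v)) (at (snd c p))"
    by (rule has_derivative_transform_within_open[OF has_derivative_ident open_W[OF c(1)]])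
      (use c in \<open>auto simp: trans_apply\<close>)
  from has_derivative_unique[OF Dtrans[OF c(1,1,2,2)] this] show ?thesis by metis
qed

lemma Dtrans_chain:
  assumes c: "c \<in> A" "p \<in> fst c" and d: "d \<in> A" "p \<in> fst d" and e: "e \<in> A" "p \<in> fst e"
  shows "Dtrans d e p (Dtrans c d p v) = Dtrans c e p v"
proof -
  have "(transition d e has_derivative Dtrans d e p) (at (transition c d (snd c p)))"
    using Dtrans[OF d(1) e(1) d(2) e(2)] by (simp only: trans_apply[OF c])
  from has_derivative_compose[OF Dtrans[OF c(1) d(1) c(2) d(2)] this]
  have 1: "((\<lambda>x. transition d e (transition c d x)) has_derivative (\<lambda>v. Dtrans d e p (Dtrans c d p v))) (at (snd c p))" .
  have "(transition c e has_derivative (\<lambda>v. Dtrans d e p (Dtrans c d p v))) (at (snd c p))"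
    by (rule has_derivative_transform_within_open[OF 1 open_overlap[OF c(1) d(1)]])
      (use c d in \<open>auto simp: trans_apply\<close>)
  from has_derivative_unique[OF Dtrans[OF c(1) e(1) c(2) e(2)] this] show ?thesis by metis
qed

lemma coord_tvec_eq:
  "coord_tvec A c p v = (\<lambda>d. if d \<in> charts_at A p then Dtrans c d p v else 0)"
  unfolding coord_tvec_def Dtrans_def ..

lemma coord_tvec_apply: "c \<in> A \<Longrightarrow> p \<in> fst c \<Longrightarrow> coord_tvec A c p v c = v"
  by (simp add: coord_tvec_eq charts_at_iff Dtrans_self)

lemma coord_tvec_tangent:
  assumes c: "c \<in> A" "p \<in> fst c" shows "coord_tvec A c p v \<in> tangent_space A p"
  unfolding tangent_space_def mem_Collect_eq
proof (intro conjI allI impI ballI)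
  fix d e assume "d \<in> charts_at A p" "e \<in> charts_at A p"
  then show "coord_tvec A c p v e = frechet_derivative (transition d e) (at (snd d p)) (coord_tvec A c p v d)"
    using Dtrans_chain[OF c, of d e v] unfolding Dtrans_def[of d e, symmetric]
    by (simp add: coord_tvec_eq charts_at_iff)
qed (simp add: coord_tvec_eq)

lemma tangent_change:
  assumes "c \<in> A" "p \<in> fst c" "d \<in> A" "p \<in> fst d" "\<xi> \<in> tangent_space A p"
  shows "\<xi> d = Dtrans c d p (\<xi> c)"
proof -
  have "c \<in> charts_at A p" "d \<in> charts_at A p" using assms by (simp_all add: charts_at_iff)
  then show ?thesis using assms(5) unfolding tangent_space_def Dtrans_def by blast
qed

lemma tangent_eq_coord_tvec:
  assumes c: "c \<in> A" "p \<in> fst c" and \<xi>: "\<xi> \<in> tangent_space A p"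
  shows "\<xi> = coord_tvec A c p (\<xi> c)"
proof
  fix d
  show "\<xi> d = coord_tvec A c p (\<xi> c) d"
  proof (cases "d \<in> charts_at A p")
    case True
    then have "\<xi> d = Dtrans c d p (\<xi> c)" using tangent_change[OF c _ _ \<xi>] by (simp only: charts_at_iff)
    then show ?thesis using True by (simp only: coord_tvec_eq if_True)
  next
    case False
    then have "\<xi> d = 0" using \<xi> unfolding tangent_space_def by blast
    then show ?thesis using False by (simp only: coord_tvec_eq if_False)
  qed
qed

lemma uminus_coord_tvec:
  assumes "c \<in> A" "p \<in> fst c" shows "- coord_tvec A c p v = coord_tvec A c p (- v)"
proof
  fix d show "(- coord_tvec A c p v) d = coord_tvec A c p (- v) d"
  proof (cases "d \<in> charts_at A p")
    case True
    then have "linear (Dtrans c d p)" using assms by (intro Dtrans_linear) (simp_all add: charts_at_iff)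
    from linear_neg[OF this, of v] show ?thesis using True by (simp add: coord_tvec_eq)
  qed (simp add: coord_tvec_eq)
qed

lemma local2_eq:
  assumes "c \<in> A" "p \<in> fst c" "\<xi> \<in> tangent_space A p" "\<eta> \<in> tangent_space A p"
  shows "g p \<xi> \<eta> = local2 A c g (snd c p) (\<xi> c) (\<eta> c)"
  unfolding local2_def inv_chart[OF assms(1,2)] tangent_eq_coord_tvec[OF assms(1-3), symmetric]
    tangent_eq_coord_tvec[OF assms(1,2,4), symmetric] ..

text \<open>Coordinate velocities transform by the chain rule.\<close>

lemma velocity_chart:
  assumes c: "c \<in> A" and xU: "x ` I \<subseteq> fst c" and t: "t \<in> I" and nb: "at t within I \<noteq> bot"
    and z: "((\<lambda>r. snd c (x r)) has_vector_derivative v) (at t within I)"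
  shows "velocity A I x t = coord_tvec A c (x t) v"
proof
  fix d
  show "velocity A I x t d = coord_tvec A c (x t) v d"
  proof (cases "d \<in> charts_at A (x t)")
    case False
    then show ?thesis by (simp add: velocity_def coord_tvec_def)
  next
    case True
    then have d: "d \<in> A" "x t \<in> fst d" by (auto simp: charts_at_iff)
    have xt: "x t \<in> fst c" using xU t by auto
    have 1: "((\<lambda>r. transition c d (snd c (x r))) has_vector_derivative Dtrans c d (x t) v) (at t within I)"
      by (rule has_vector_derivative_compose[OF z Dtrans[OF c d(1) xt d(2)]])
    have "((\<lambda>r. snd d (x r)) has_vector_derivative Dtrans c d (x t) v) (at t within I)"
    proof (rule has_vector_derivative_transform[OF t _ 1])
      fix r assume "r \<in> I"
      then show "snd d (x r) = transition c d (snd c (x r))" using xU by (auto simp: trans_apply[OF c])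
    qed
    then have "vector_derivative (snd d \<circ> x) (at t within I) = Dtrans c d (x t) v"
      using nb by (intro vector_derivative_within) (auto simp: o_def)
    then show ?thesis using True by (simp add: velocity_def coord_tvec_eq)
  qed
qed

section \<open>Length and its extremals in a chart\<close>

text \<open>The sign \<open>s\<close> is \<open>1\<close> for forward and \<open>-1\<close> for backward length; the latter is the
  forward length of the metric with the opposite one-form.\<close>

definition len :: "real \<Rightarrow> ('a, 'e) field2 \<Rightarrow> ('a, 'e) field1 \<Rightarrow> real \<Rightarrow> real \<Rightarrow> (real \<Rightarrow> 'a) \<Rightarrow> real" where
  "len s g \<omega> = (if s = 1 then length_fwd A (randers g \<omega>) else length_bwd A (randers g \<omega>))"

abbreviation "Gc c g \<equiv> local2 A c g"
abbreviation "G1c c g \<equiv> \<lambda>u h v w. frechet_derivative (\<lambda>u. local2 A c g u v w) (at u) h"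
abbreviation "Bc s c \<omega> \<equiv> \<lambda>u v. s * local1 A c \<omega> u v"
abbreviation "B1c s c \<omega> \<equiv> \<lambda>u h v. s * frechet_derivative (\<lambda>u. local1 A c \<omega> u v) (at u) h"
abbreviation "chr c g \<equiv> local_metric.chris (Gc c g) (G1c c g)"
abbreviation "nr c g \<equiv> local_metric.nrm (Gc c g)"
abbreviation "Jm s c g \<omega> \<equiv> local_randers.J (Gc c g) (B1c s c \<omega>)"

lemma Ck_2_frechet:
  fixes f :: "'e \<Rightarrow> real"
  assumes "open W" "Ck_on 2 f W"
  shows "u \<in> W \<Longrightarrow> (f has_derivative frechet_derivative f (at u)) (at u)"
    and "continuous_on W (\<lambda>u. frechet_derivative f (at u) h)"
proof -
  obtain D where D: "\<forall>x\<in>W. (f has_derivative D x) (at x within W)" "\<forall>v. Ck_on 1 (\<lambda>x. D x v) W"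
    using assms by (auto simp: numeral_2_eq_2)
  have D': "(f has_derivative D x) (at x)" if "x \<in> W" for x
    using bspec[OF D(1) that] by (simp only: at_within_open[OF that assms(1)])
  have eq: "frechet_derivative f (at x) = D x" if "x \<in> W" for x
    using frechet_derivative_at[OF D'[OF that]] by simp
  show "u \<in> W \<Longrightarrow> (f has_derivative frechet_derivative f (at u)) (at u)"
    using D' eq by simp
  have "continuous_on W (\<lambda>x. D x h)" using Ck_on_imp_continuous_on[OF spec[OF D(2)]] .
  then show "continuous_on W (\<lambda>u. frechet_derivative f (at u) h)"
    by (rule continuous_on_eq) (simp add: eq)
qed

lemma local_metric_chart:
  assumes g: "riemannian_metric A g" and c: "c \<in> A"
  shows "local_metric (snd c ` fst c) (Gc c g) (G1c c g)"
proof
  show op: "open (snd c ` fst c)" by (rule open_W[OF c])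
  have C2: "Ck_on 2 (\<lambda>u. local2 A c g u v w) (snd c ` fst c)" for v w
    using g c unfolding riemannian_metric_def by blast
  fix v w h
  show "continuous_on (snd c ` fst c) (\<lambda>u. G1c c g u h v w)" by (rule Ck_2_frechet(2)[OF op C2])
  fix u assume u: "u \<in> snd c ` fst c"
  show "bilinear (Gc c g u)" "Gc c g u v w = Gc c g u w v" "v \<noteq> 0 \<Longrightarrow> 0 < Gc c g u v v"
    using g c u unfolding riemannian_metric_def by blast+
  show "((\<lambda>u. local2 A c g u v w) has_derivative (\<lambda>h. G1c c g u h v w)) (at u)"
    using Ck_2_frechet(1)[OF op C2 u] .
qed

lemma local_form_chart:
  assumes \<omega>: "one_form A \<omega>" and c: "c \<in> A"
  shows "local_form (snd c ` fst c) (Bc s c \<omega>) (B1c s c \<omega>)"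
proof (rule local_form.intro)
  show op: "open (snd c ` fst c)" by (rule open_W[OF c])
  have C2: "Ck_on 2 (\<lambda>u. local1 A c \<omega> u v) (snd c ` fst c)" for v
    using \<omega> c unfolding one_form_def by blast
  fix v h
  show "continuous_on (snd c ` fst c) (\<lambda>u. B1c s c \<omega> u h v)"
    by (intro continuous_on_mult_left Ck_2_frechet(2)[OF op C2])
  fix u assume u: "u \<in> snd c ` fst c"
  have "linear (local1 A c \<omega> u)" using \<omega> c u unfolding one_form_def by blast
  from linear_compose_scale_right[OF this, of s] show "linear (Bc s c \<omega> u)" by simp
  show "((\<lambda>u. Bc s c \<omega> u v) has_derivative (\<lambda>h. B1c s c \<omega> u h v)) (at u)"
    using has_derivative_mult_right[OF Ck_2_frechet(1)[OF op C2 u]] by simp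
qed

lemma local_randers_chart:
  assumes "riemannian_metric A g" "one_form A \<omega>" "c \<in> A"
  shows "local_randers (snd c ` fst c) (Gc c g) (G1c c g) (Bc s c \<omega>) (B1c s c \<omega>)"
  using local_metric_chart[OF assms(1,3)] local_form_chart[OF assms(2,3)] unfolding local_randers_def ..

end

locale randers_mfd = mfd X A for X :: "'a topology" and A :: "('a, 'e::euclidean_space) chart set" +
  fixes g :: "('a, 'e) field2" and \<omega> :: "('a, 'e) field1"
  assumes g: "riemannian_metric A g" and \<omega>: "one_form A \<omega>"
begin

abbreviation "lagc s c \<equiv> local_randers.lag (Gc c g) (Bc s c \<omega>)"
abbreviation "ELc s c \<equiv> local_randers.EL (Gc c g) (G1c c g) (B1c s c \<omega>)"

text \<open>The velocity enters backward length with the opposite sign, which does not affect the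
  Riemannian part.\<close>

lemma len_chart:
  assumes c: "c \<in> A" and s: "s \<in> {1,-1}" and ab: "a < b" and yU: "y ` {a..b} \<subseteq> fst c"
    and z: "\<And>t. t \<in> {a..b} \<Longrightarrow> ((\<lambda>r. snd c (y r)) has_vector_derivative v t) (at t within {a..b})"
  shows "len s g \<omega> a b y =
    integral {a..b} (\<lambda>t. lagc s c (snd c (y t)) (vector_derivative (\<lambda>r. snd c (y r)) (at t within {a..b})))"
proof -
  interpret R: local_randers "snd c ` fst c" "Gc c g" "G1c c g" "Bc s c \<omega>" "B1c s c \<omega>"
    by (rule local_randers_chart[OF g \<omega> c])
  have V: "velocity A {a..b} y t = coord_tvec A c (y t) (v t)" and D: "vector_derivative (\<lambda>r. snd c (y r)) (at t within {a..b}) = v t"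
    if t: "t \<in> {a..b}" for t
  proof -
    have nb: "at t within {a..b} \<noteq> bot" using t ab by (simp add: trivial_limit_within islimpt_Icc)
    show "velocity A {a..b} y t = coord_tvec A c (y t) (v t)" by (rule velocity_chart[OF c yU t nb z[OF t]])
    show "vector_derivative (\<lambda>r. snd c (y r)) (at t within {a..b}) = v t" by (rule vector_derivative_within[OF nb z[OF t]])
  qed
  have F: "randers g \<omega> (y t) (coord_tvec A c (y t) w) = sqrt (Gc c g (snd c (y t)) w w) + local1 A c \<omega> (snd c (y t)) w"
    if t: "t \<in> {a..b}" for t w
  proof -
    have "y t \<in> fst c" using yU t by auto
    then show ?thesis
      unfolding randers_def local1_def local2_def by (simp add: inv_chart[OF c])
  qed
  have neg: "randers g \<omega> (y t) (- coord_tvec A c (y t) w) = sqrt (Gc c g (snd c (y t)) w w) - local1 A c \<omega> (snd c (y t)) w"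
    if t: "t \<in> {a..b}" for t w
  proof -
    have yt: "y t \<in> fst c" using yU t by auto
    then have u: "snd c (y t) \<in> snd c ` fst c" by blast
    have "linear (local1 A c \<omega> (snd c (y t)))" using \<omega> c u unfolding one_form_def by blast
    then show ?thesis
      unfolding uminus_coord_tvec[OF c yt] F[OF t]
      by (simp add: R.G_lneg[OF u] R.G_rneg[OF u] linear_neg)
  qed
  have lag: "lagc s c u w = sqrt (Gc c g u w w) + s * local1 A c \<omega> u w" for u w
    by (simp only: R.lag_def R.nrm_def)
  have "len s g \<omega> a b y = integral {a..b} (\<lambda>t. lagc s c (snd c (y t)) (v t))"
  proof (cases "s = 1")
    case True
    then show ?thesis
      unfolding len_def length_fwd_def lag
      by (simp, intro integral_cong) (simp add: V F)
  next
    case False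
    then have "s = -1" using s by simp
    then show ?thesis
      unfolding len_def length_bwd_def lag
      by (simp, intro integral_cong) (simp add: V neg)
  qed
  also have "\<dots> = integral {a..b} (\<lambda>t. lagc s c (snd c (y t)) (vector_derivative (\<lambda>r. snd c (y r)) (at t within {a..b})))"
    by (intro integral_cong) (simp add: D)
  finally show ?thesis .
qed

end

lemma Ck_on_2_has_derivative:
  assumes "Ck_on 2 f S"
  obtains D where "\<And>x. x \<in> S \<Longrightarrow> (f has_derivative D x) (at x within S)"
  using assms by (auto simp: numeral_2_eq_2)

lemma has_vector_derivative_slice_fst:
  fixes f :: "real \<times> real \<Rightarrow> 'b::euclidean_space"
  assumes f: "\<And>x. x \<in> S \<times> T \<Longrightarrow> (f has_derivative D x) (at x within S \<times> T)" and s: "s \<in> S" and t: "t \<in> T"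
  shows "((\<lambda>r. f (r, t)) has_vector_derivative D (s, t) (1, 0)) (at s within S)"
proof -
  have x: "(s, t) \<in> S \<times> T" using s t by blast
  have "((\<lambda>r. f (r, t)) has_derivative (\<lambda>d. D (s, t) (d *\<^sub>R (1, 0)))) (at s within S)"
    by (rule has_derivative_in_compose2[where t="S \<times> T" and g=f and g'=D, OF f _ s])
      (use t in \<open>auto intro!: derivative_eq_intros\<close>)
  then show ?thesis unfolding has_vector_derivative_def
    by (simp only: linear_scale[OF has_derivative_linear[OF f[OF x]]])
qed

lemma has_vector_derivative_slice_snd:
  fixes f :: "real \<times> real \<Rightarrow> 'b::euclidean_space"
  assumes f: "\<And>x. x \<in> S \<times> T \<Longrightarrow> (f has_derivative D x) (at x within S \<times> T)" and s: "s \<in> S" and t: "t \<in> T"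
  shows "((\<lambda>r. f (s, r)) has_vector_derivative D (s, t) (0, 1)) (at t within T)"
proof -
  have x: "(s, t) \<in> S \<times> T" using s t by blast
  have "((\<lambda>r. f (s, r)) has_derivative (\<lambda>d. D (s, t) (d *\<^sub>R (0, 1)))) (at t within T)"
    by (rule has_derivative_in_compose2[where t="S \<times> T" and g=f and g'=D, OF f _ t])
      (use s in \<open>auto intro!: derivative_eq_intros\<close>)
  then show ?thesis unfolding has_vector_derivative_def
    by (simp only: linear_scale[OF has_derivative_linear[OF f[OF x]]])
qed

lemma Ck_on_real_polynomial_function:
  assumes "real_polynomial_function (q :: real \<Rightarrow> real)"
  shows "Ck_on 2 q S"
proof -
  obtain q' where q': "real_polynomial_function q'" "\<And>x. (q has_real_derivative q' x) (at x)"
    using has_real_derivative_polynomial_function[OF assms] by blast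
  obtain q'' where q'': "real_polynomial_function q''" "\<And>x. (q' has_real_derivative q'' x) (at x)"
    using has_real_derivative_polynomial_function[OF q'(1)] by blast
  have "continuous_on S q''"
    using continuous_on_polymonial_function q''(1) real_polynomial_function_eq by blast
  moreover have "\<forall>t\<in>S. (q has_vector_derivative q' t) (at t within S)" "\<forall>t\<in>S. (q' has_vector_derivative q'' t) (at t within S)"
    using has_field_derivative_at_within[OF q'(2)] has_field_derivative_at_within[OF q''(2)]
    by (simp_all add: has_real_derivative_iff_has_vector_derivative[symmetric])
  ultimately show ?thesis unfolding Ck_on_2_real_iff by blast
qed

text \<open>Of an open set that contains a compact segment, a strip around the segment remains.\<close>

lemma strip_around_segment:
  assumes \<epsilon>: "\<epsilon> > (0::real)" and op: "openin (top_of_set ({-\<epsilon><..<\<epsilon>} \<times> {a..b::real})) O'"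
    and seg: "{0} \<times> {a..b} \<subseteq> O'"
  obtains e where "e > 0" "e \<le> \<epsilon>" "{-e<..<e} \<times> {a..b} \<subseteq> O'"
proof -
  obtain T where T: "open T" "O' = ({-\<epsilon><..<\<epsilon>} \<times> {a..b}) \<inter> T"
    using op unfolding openin_open by blast
  have "{0} \<times> {a..b} \<subseteq> T" using seg T(2) by blast
  from Elementary_Topology.tube_lemma[OF compact_Icc T(1) this]
  obtain X0 where X0: "0 \<in> X0" "open X0" "X0 \<times> {a..b} \<subseteq> T" by auto
  obtain d where d: "d > 0" "ball 0 d \<subseteq> X0" using openE[OF X0(2,1)] .
  define e where "e = min d \<epsilon>"
  have "{-e<..<e} \<times> {a..b} \<subseteq> O'"
  proof
    fix y assume y: "y \<in> {-e<..<e} \<times> {a..b}"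
    then have "fst y \<in> ball 0 d" by (auto simp: e_def dist_real_def)
    then have "fst y \<in> X0" using d(2) by blast
    then have "y \<in> T" using X0(3) y by (auto simp: mem_Times_iff)
    moreover have "y \<in> {-\<epsilon><..<\<epsilon>} \<times> {a..b}" using y by (auto simp: e_def)
    ultimately show "y \<in> O'" using T(2) by blast
  qed
  then show thesis using that[of e] d \<epsilon> by (auto simp: e_def)
qed

context randers_mfd
begin

lemma deriv_length_variation:
  fixes h :: "real \<times> real \<Rightarrow> 'a"
  assumes c: "c \<in> A" and s: "s \<in> {1,-1}" and ab: "a < b" and \<epsilon>: "\<epsilon> > 0"
    and hU: "h ` ({-\<epsilon><..<\<epsilon>} \<times> {a..b}) \<subseteq> fst c"
    and C2: "Ck_on 2 (\<lambda>x. snd c (h x)) ({-\<epsilon><..<\<epsilon>} \<times> {a..b})"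
    and h0: "\<And>t. t \<in> {a..b} \<Longrightarrow> h (0, t) = y t"
    and ends: "\<And>r. r \<in> {-\<epsilon><..<\<epsilon>} \<Longrightarrow> h (r, a) = y a \<and> h (r, b) = y b"
    and z: "\<And>t. t \<in> {a..b} \<Longrightarrow> ((\<lambda>r. snd c (y r)) has_vector_derivative v t) (at t within {a..b})"
    and v: "\<And>t. t \<in> {a..b} \<Longrightarrow> (v has_vector_derivative acc t) (at t within {a..b})"
    and cacc: "continuous_on {a..b} acc" and v0: "\<And>t. t \<in> {a..b} \<Longrightarrow> v t \<noteq> 0"
    and \<eta>: "\<And>t. t \<in> {a..b} \<Longrightarrow> ((\<lambda>r. snd c (h (r, t))) has_vector_derivative \<eta> t) (at 0)"
  shows "((\<lambda>r. len s g \<omega> a b (\<lambda>t. h (r, t))) has_real_derivative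
      integral {a..b} (\<lambda>t. ELc s c (snd c (y t)) (v t) (acc t) (\<eta> t))) (at 0)"
proof -
  interpret R: local_randers "snd c ` fst c" "Gc c g" "G1c c g" "Bc s c \<omega>" "B1c s c \<omega>"
    by (rule local_randers_chart[OF g \<omega> c])
  define S where "S = {-\<epsilon><..<\<epsilon>}"
  obtain D where D: "\<And>x. x \<in> S \<times> {a..b} \<Longrightarrow> ((\<lambda>x. snd c (h x)) has_derivative D x) (at x within S \<times> {a..b})"
    using Ck_on_2_has_derivative[OF C2] unfolding S_def by blast
  have "((\<lambda>r. integral {a..b} (\<lambda>t. R.lag (snd c (h (r, t))) (vector_derivative (\<lambda>t. snd c (h (r, t))) (at t within {a..b}))))
     has_real_derivative integral {a..b} (\<lambda>t. ELc s c (snd c (y t)) (v t) (acc t) (\<eta> t))) (at 0)"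
  proof (rule R.first_variation[OF ab \<epsilon> C2 _ _ z v cacc v0 _ \<eta>])
    show "(\<lambda>x. snd c (h x)) ` ({-\<epsilon><..<\<epsilon>} \<times> {a..b}) \<subseteq> snd c ` fst c" using hU by blast
    show "snd c (h (0, t)) = snd c (y t)" if "t \<in> {a..b}" for t using h0[OF that] by simp
    show "snd c (h (r, a)) = snd c (y a) \<and> snd c (h (r, b)) = snd c (y b)" if "r \<in> {-\<epsilon><..<\<epsilon>}" for r
      using ends[OF that] by simp
  qed
  then show ?thesis
  proof (rule has_field_derivative_transform_within_open[where S=S])
    show "open S" "0 \<in> S" using \<epsilon> by (simp_all add: S_def)
    fix r assume r: "r \<in> S"
    show "integral {a..b} (\<lambda>t. R.lag (snd c (h (r, t))) (vector_derivative (\<lambda>t. snd c (h (r, t))) (at t within {a..b})))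
      = len s g \<omega> a b (\<lambda>t. h (r, t))"
    proof (rule len_chart[OF c s ab, symmetric])
      show "(\<lambda>t. h (r, t)) ` {a..b} \<subseteq> fst c" using hU r unfolding S_def by blast
      show "((\<lambda>t. snd c (h (r, t))) has_vector_derivative D (r, t) (0, 1)) (at t within {a..b})"
        if "t \<in> {a..b}" for t
        by (rule has_vector_derivative_slice_snd[OF D r that])
    qed
  qed
qed

text \<open>Varied curves with a small parameter stay in the chart, so the first variation can be computed
  there.\<close>

lemma EL_imp_extremal:
  assumes c: "c \<in> A" and s: "s \<in> {1,-1}" and ab: "a \<le> b" and yU: "y ` {a..b} \<subseteq> fst c"
    and z: "\<And>t. t \<in> {a..b} \<Longrightarrow> ((\<lambda>r. snd c (y r)) has_vector_derivative v t) (at t within {a..b})"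
    and v: "\<And>t. t \<in> {a..b} \<Longrightarrow> (v has_vector_derivative acc t) (at t within {a..b})"
    and cacc: "continuous_on {a..b} acc" and v0: "\<And>t. t \<in> {a..b} \<Longrightarrow> v t \<noteq> 0"
    and EL: "\<And>t \<eta>. t \<in> {a..b} \<Longrightarrow> ELc s c (snd c (y t)) (v t) (acc t) \<eta> = 0"
  shows "extremal X A (len s g \<omega>) a b y"
  unfolding extremal_def
proof (intro allI impI)
  fix \<epsilon> h assume h: "variation X A a b y \<epsilon> h"
  show "((\<lambda>r. len s g \<omega> a b (\<lambda>t. h (r, t))) has_real_derivative 0) (at 0)"
  proof (cases "a = b")
    case True
    then have "len s g \<omega> a b (\<lambda>t. h (r, t)) = 0" for r by (simp add: len_def length_fwd_def length_bwd_def)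
    then show ?thesis by simp
  next
    case False
    then have ab: "a < b" using ab by simp
    define S where "S = {-\<epsilon><..<\<epsilon>} \<times> {a..b}"
    have \<epsilon>: "\<epsilon> > 0" and cm: "continuous_map (top_of_set S) X h"
      and Ck: "Ck_on 2 (snd c \<circ> h) (S \<inter> h -` fst c)"
      and h0: "\<And>t. t \<in> {a..b} \<Longrightarrow> h (0, t) = y t"
      and ends: "\<And>r. r \<in> {-\<epsilon><..<\<epsilon>} \<Longrightarrow> h (r, a) = y a \<and> h (r, b) = y b"
      using h c unfolding variation_def Ck_map_def S_def by blast+
    have op: "openin (top_of_set S) (S \<inter> h -` fst c)"
      using openin_continuous_map_preimage[OF cm open_chart[OF c]] by (simp add: vimage_def Collect_conj_eq)
    have "{0} \<times> {a..b} \<subseteq> S \<inter> h -` fst c"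
      using h0 yU \<epsilon> by (auto simp: S_def)
    from strip_around_segment[OF \<epsilon> op[unfolded S_def] this[unfolded S_def]]
    obtain e where e: "e > 0" "e \<le> \<epsilon>" "{-e<..<e} \<times> {a..b} \<subseteq> S \<inter> h -` fst c" unfolding S_def by blast
    have C2: "Ck_on 2 (\<lambda>x. snd c (h x)) ({-e<..<e} \<times> {a..b})"
      using Ck_on_subset[OF Ck e(3)] by (simp add: o_def)
    obtain D where D: "\<And>x. x \<in> {-e<..<e} \<times> {a..b} \<Longrightarrow> ((\<lambda>x. snd c (h x)) has_derivative D x) (at x within {-e<..<e} \<times> {a..b})"
      using Ck_on_2_has_derivative[OF C2] by blast
    have e0: "0 \<in> {-e<..<e}" using e(1) by simp
    have "((\<lambda>r. len s g \<omega> a b (\<lambda>t. h (r, t))) has_real_derivative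
      integral {a..b} (\<lambda>t. ELc s c (snd c (y t)) (v t) (acc t) (D (0,t) (1,0)))) (at 0)"
    proof (rule deriv_length_variation[OF c s ab e(1) _ C2 h0 _ z v cacc v0])
      show "h ` ({-e<..<e} \<times> {a..b}) \<subseteq> fst c" using e(3) by blast
      show "h (r, a) = y a \<and> h (r, b) = y b" if "r \<in> {-e<..<e}" for r using that e(2) by (intro ends) auto
      show "((\<lambda>r. snd c (h (r, t))) has_vector_derivative D (0, t) (1, 0)) (at 0)" if "t \<in> {a..b}" for t
        using has_vector_derivative_slice_fst[OF D e0 that] by (simp only: at_within_open[OF e0 open_greaterThanLessThan])
    qed
    also have "integral {a..b} (\<lambda>t. ELc s c (snd c (y t)) (v t) (acc t) (D (0,t) (1,0))) = integral {a..b} (\<lambda>t. 0)"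
      by (rule integral_cong) (rule EL)
    finally show ?thesis by simp
  qed
qed

text \<open>In coordinates, the variation moves the curve by multiples of \<open>(t - a) (b - t) p(t) \<eta>\<close> for a
  polynomial \<open>p\<close> and a constant vector \<open>\<eta>\<close>, as the fundamental lemma requires.\<close>

lemma extremal_imp_EL:
  assumes c: "c \<in> A" and s: "s \<in> {1,-1}" and ab: "a < b" and yU: "y ` {a..b} \<subseteq> fst c"
    and z: "\<And>t. t \<in> {a..b} \<Longrightarrow> ((\<lambda>r. snd c (y r)) has_vector_derivative v t) (at t within {a..b})"
    and v: "\<And>t. t \<in> {a..b} \<Longrightarrow> (v has_vector_derivative acc t) (at t within {a..b})"
    and cacc: "continuous_on {a..b} acc" and v0: "\<And>t. t \<in> {a..b} \<Longrightarrow> v t \<noteq> 0"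
    and ext: "extremal X A (len s g \<omega>) a b y" and t: "t \<in> {a..b}"
  shows "ELc s c (snd c (y t)) (v t) (acc t) \<eta> = 0"
proof -
  interpret R: local_randers "snd c ` fst c" "Gc c g" "G1c c g" "Bc s c \<omega>" "B1c s c \<omega>"
    by (rule local_randers_chart[OF g \<omega> c])
  define z where "z r = snd c (y r)" for r
  have zd: "(z has_vector_derivative v t) (at t within {a..b})" if "t \<in> {a..b}" for t
    using z[OF that] by (simp add: z_def[abs_def])
  have zW: "z ` {a..b} \<subseteq> snd c ` fst c" using yU unfolding z_def by blast
  have z2: "Ck_on 2 z {a..b}" unfolding Ck_on_2_real_iff
    by (rule exI[of _ v], rule exI[of _ acc]) (intro conjI ballI zd v cacc)
  have cz: "continuous_on {a..b} z" by (rule Ck_on_imp_continuous_on[OF z2])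
  have cv: "continuous_on {a..b} v"
    unfolding continuous_on_eq_continuous_within by (intro ballI has_vector_derivative_continuous, erule v)
  show ?thesis
  proof (rule fundamental_lemma[OF ab _ _ t, of "\<lambda>t. ELc s c (snd c (y t)) (v t) (acc t) \<eta>"])
    show "continuous_on {a..b} (\<lambda>t. ELc s c (snd c (y t)) (v t) (acc t) \<eta>)"
      using R.cont_EL[OF cz cv cacc continuous_on_const zW v0] by (simp add: z_def)
    fix p :: "real \<Rightarrow> real" assume p: "real_polynomial_function p"
    define q where "q t = (t - a) * (b - t) * p t" for t
    have q: "real_polynomial_function q"
      unfolding q_def[abs_def]
      by (intro real_polynomial_function.intros(1,2,4) real_polynomial_function_diff p bounded_linear_ident)
    define H where "H x = z (snd x) + fst x *\<^sub>R (q (snd x) *\<^sub>R \<eta>)" for x :: "real \<times> real"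
    have H2: "Ck_on 2 H (T \<times> {a..b})" for T
      unfolding H_def
    proof (intro Ck_on_add Ck_on_scaleR Ck_on_const)
      show "Ck_on 2 (\<lambda>x. z (snd x)) (T \<times> {a..b})"
        by (rule Ck_on_compose[OF Ck_on_linear[OF bounded_linear_snd] _ z2]) auto
      show "Ck_on 2 fst (T \<times> {a..b})" by (rule Ck_on_linear[OF bounded_linear_fst])
      show "Ck_on 2 (\<lambda>x. q (snd x)) (T \<times> {a..b})"
        by (rule Ck_on_compose[OF Ck_on_linear[OF bounded_linear_snd] _ Ck_on_real_polynomial_function[OF q, of UNIV]]) auto
    qed
    have op: "openin (top_of_set ({-1<..<1} \<times> {a..b})) (({-1<..<1} \<times> {a..b}) \<inter> H -` (snd c ` fst c))"
      by (rule continuous_openin_preimage_gen[OF Ck_on_imp_continuous_on[OF H2] open_W[OF c]])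
    have "{0} \<times> {a..b} \<subseteq> ({-1<..<1} \<times> {a..b}) \<inter> H -` (snd c ` fst c)"
      using zW by (auto simp: H_def)
    then obtain e where e': "e > 0" "e \<le> 1" "{-e<..<e} \<times> {a..b} \<subseteq> ({-1<..<1} \<times> {a..b}) \<inter> H -` (snd c ` fst c)"
      by (rule strip_around_segment[OF zero_less_one op])
    note e = e'(1,3)
    define S where "S = {-e<..<e} \<times> {a..b}"
    define h where "h x = chart_inv c (H x)" for x
    have HW: "H x \<in> snd c ` fst c" if "x \<in> S" for x using e(2) that unfolding S_def by blast
    have hU: "h x \<in> fst c" and hH: "snd c (h x) = H x" if "x \<in> S" for x
      unfolding h_def using chart_inv_in[OF HW[OF that]] chart_inv[OF HW[OF that]] by auto
    have h0: "h (0, t) = y t" if "t \<in> {a..b}" for t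
    proof -
      have "y t \<in> fst c" using yU that by blast
      then show ?thesis by (simp add: h_def H_def z_def inv_chart[OF c])
    qed
    have ends: "h (r, a) = y a \<and> h (r, b) = y b" for r
    proof -
      have "h (r, a) = h (0, a)" "h (r, b) = h (0, b)" by (simp_all add: h_def H_def q_def)
      then show ?thesis using h0 ab by simp
    qed
    have C2: "Ck_on 2 (\<lambda>x. snd c (h x)) S"
      by (rule Ck_on_cong[OF _ H2[of "{-e<..<e}", folded S_def]]) (simp add: hH)
    have "variation X A a b y e h"
      unfolding variation_def Ck_map_def S_def[symmetric]
    proof (intro conjI ballI)
      have "continuous_map (top_of_set S) (top_of_set (snd c ` fst c)) H"
        unfolding continuous_map_in_subtopology using Ck_on_imp_continuous_on[OF H2[of "{-e<..<e}", folded S_def]] HW by auto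
      from continuous_map_compose[OF this cont_chart_inv[OF c]]
      show "continuous_map (top_of_set S) X h" by (simp add: h_def[abs_def] o_def)
      fix d assume d: "d \<in> A"
      have "Ck_on 2 (\<lambda>x. transition c d (H x)) (S \<inter> h -` fst d)"
      proof (rule Ck_on_compose[OF _ _ trans_Ck[OF c d]])
        show "Ck_on 2 H (S \<inter> h -` fst d)"
          by (rule Ck_on_subset[OF H2[of "{-e<..<e}", folded S_def]]) simp
        show "H ` (S \<inter> h -` fst d) \<subseteq> snd c ` (fst c \<inter> fst d)"
        proof
          fix w assume "w \<in> H ` (S \<inter> h -` fst d)"
          then obtain x where x: "x \<in> S" "h x \<in> fst d" "w = H x" by blast
          have "w = snd c (h x)" unfolding x(3) hH[OF x(1)] ..
          then show "w \<in> snd c ` (fst c \<inter> fst d)" using hU[OF x(1)] x(2) by blast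
        qed
      qed
      then show "Ck_on 2 (snd d \<circ> h) (S \<inter> h -` fst d)" by (simp add: transition_def o_def h_def)
    next
      show "0 < e" by (rule e(1))
      show "h (0, t) = y t" if "t \<in> {a..b}" for t by (rule h0[OF that])
      show "h (r, a) = y a" "h (r, b) = y b" for r using ends by blast+
    qed
    then have d0: "((\<lambda>r. len s g \<omega> a b (\<lambda>t. h (r, t))) has_real_derivative 0) (at 0)"
      using ext unfolding extremal_def by blast
    have "((\<lambda>r. len s g \<omega> a b (\<lambda>t. h (r, t))) has_real_derivative
      integral {a..b} (\<lambda>t. ELc s c (snd c (y t)) (v t) (acc t) (q t *\<^sub>R \<eta>))) (at 0)"
    proof (rule deriv_length_variation[OF c s ab e(1) _ C2[unfolded S_def] h0 ends _ v cacc v0])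
      show "h ` ({-e<..<e} \<times> {a..b}) \<subseteq> fst c" using hU unfolding S_def by blast
      show "((\<lambda>r. snd c (y r)) has_vector_derivative v t) (at t within {a..b})" if "t \<in> {a..b}" for t by (rule z[OF that])
      fix t assume t: "t \<in> {a..b}"
      have Hd: "((\<lambda>r. H (r, t)) has_vector_derivative q t *\<^sub>R \<eta>) (at 0)"
        unfolding H_def has_vector_derivative_def by (auto intro!: derivative_eq_intros)
      have eq: "H (r, t) = snd c (h (r, t))" if "r \<in> {-e<..<e}" for r
        by (rule hH[symmetric]) (use that t in \<open>simp add: S_def\<close>)
      have e0: "0 \<in> {-e<..<e}" using e(1) by simp
      show "((\<lambda>r. snd c (h (r, t))) has_vector_derivative q t *\<^sub>R \<eta>) (at 0)"
        by (rule has_vector_derivative_transform_within_open[OF Hd open_greaterThanLessThan e0 eq])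
    qed
    from DERIV_unique[OF this d0]
    have "integral {a..b} (\<lambda>t. ELc s c (snd c (y t)) (v t) (acc t) (q t *\<^sub>R \<eta>)) = 0" .
    moreover have "integral {a..b} (\<lambda>t. ELc s c (snd c (y t)) (v t) (acc t) (q t *\<^sub>R \<eta>))
      = integral {a..b} (\<lambda>t. ELc s c (snd c (y t)) (v t) (acc t) \<eta> * q t)"
    proof (rule integral_cong)
      fix t assume "t \<in> {a..b}"
      then have "snd c (y t) \<in> snd c ` fst c" using yU by blast
      then show "ELc s c (snd c (y t)) (v t) (acc t) (q t *\<^sub>R \<eta>) = ELc s c (snd c (y t)) (v t) (acc t) \<eta> * q t"
        by (simp add: linear_scale[OF R.EL_linear])
    qed
    ultimately show "integral {a..b} (\<lambda>t. ELc s c (snd c (y t)) (v t) (acc t) \<eta> * ((t - a) * (b - t) * p t)) = 0"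
      unfolding q_def by simp
  qed
qed

abbreviation "sprayc s c \<equiv> local_randers.spray (Gc c g) (G1c c g) (B1c s c \<omega>)"

text \<open>A solution of the spray equation satisfies the Euler-Lagrange equation; it is regular as long
  as its velocity does not vanish.\<close>

lemma geodesic_exists:
  assumes c: "c \<in> A" and u: "u \<in> snd c ` fst c" and \<xi>: "\<xi> \<noteq> 0"
  obtains \<tau> x v where "\<tau> > 0" "forward_geodesic X A (randers g \<omega>) {0..\<tau>} x"
    "x ` {0..\<tau>} \<subseteq> fst c" "snd c (x 0) = u" "v 0 = \<xi>"
    "\<And>t. t \<in> {0..\<tau>} \<Longrightarrow> ((\<lambda>r. snd c (x r)) has_vector_derivative v t) (at t within {0..\<tau>})"
    "\<And>t. t \<in> {0..\<tau>} \<Longrightarrow> (v has_vector_derivative sprayc 1 c (snd c (x t)) (v t)) (at t within {0..\<tau>})"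
    "continuous_on {0..\<tau>} (\<lambda>t. sprayc 1 c (snd c (x t)) (v t))"
    "\<And>t. t \<in> {0..\<tau>} \<Longrightarrow> v t \<noteq> 0"
proof -
  interpret R: local_randers "snd c ` fst c" "Gc c g" "G1c c g" "Bc 1 c \<omega>" "B1c 1 c \<omega>"
    by (rule local_randers_chart[OF g \<omega> c])
  obtain \<delta> \<tau>' C where C: "\<delta> > 0" "\<tau>' > 0" "C \<ge> 0"
    and sol: "\<And>u' v'. u' \<in> cball u \<delta> \<Longrightarrow> norm v' \<le> norm \<xi> \<Longrightarrow> \<exists>x x'. x 0 = u' \<and> x' 0 = v' \<and>
       (\<forall>t\<in>{0..\<tau>'}. x t \<in> snd c ` fst c \<and> (x has_vector_derivative x' t) (at t within {0..\<tau>'}) \<and>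
          (x' has_vector_derivative R.spray (x t) (x' t)) (at t within {0..\<tau>'}) \<and>
          norm (x' t - v') \<le> C * t \<and> norm (x t - u' - t *\<^sub>R v') \<le> C * t\<^sup>2)"
    using R.spray_solution[OF u norm_ge_zero[of \<xi>]] by (metis (no_types, lifting))
  have "u \<in> cball u \<delta>" using C by simp
  from sol[OF this order_refl] obtain z v where zv: "z 0 = u" "v 0 = \<xi>"
    and S: "\<And>t. t \<in> {0..\<tau>'} \<Longrightarrow> z t \<in> snd c ` fst c"
      "\<And>t. t \<in> {0..\<tau>'} \<Longrightarrow> (z has_vector_derivative v t) (at t within {0..\<tau>'})"
      "\<And>t. t \<in> {0..\<tau>'} \<Longrightarrow> (v has_vector_derivative R.spray (z t) (v t)) (at t within {0..\<tau>'})"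
      "\<And>t. t \<in> {0..\<tau>'} \<Longrightarrow> norm (v t - \<xi>) \<le> C * t"
    by blast
  \<comment> \<open>short enough for the velocity not to vanish\<close>
  define \<tau> where "\<tau> = min \<tau>' (norm \<xi> / (2 * (C + 1)))"
  have \<tau>: "\<tau> > 0" "\<tau> \<le> \<tau>'" using C \<xi> by (auto simp: \<tau>_def)
  have sub: "{0..\<tau>} \<subseteq> {0..\<tau>'}" using \<tau> by auto
  have v0: "v t \<noteq> 0" if t: "t \<in> {0..\<tau>}" for t
  proof
    assume "v t = 0"
    then have "norm \<xi> \<le> C * t" using S(4)[of t] t sub by auto
    also have "\<dots> \<le> C * (norm \<xi> / (2 * (C + 1)))" using t C by (intro mult_left_mono) (auto simp: \<tau>_def)
    also have "\<dots> = norm \<xi> * (C / (2 * (C + 1)))" by simp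
    also have "\<dots> \<le> norm \<xi> * (1 / 2)" using C by (intro mult_left_mono) (simp_all add: field_simps)
    finally show False using \<xi> by simp
  qed
  define x where "x t = chart_inv c (z t)" for t
  have xz: "snd c (x t) = z t" and xU: "x t \<in> fst c" if "t \<in> {0..\<tau>}" for t
  proof -
    have "z t \<in> snd c ` fst c" using S(1) that sub by blast
    then show "snd c (x t) = z t" "x t \<in> fst c" unfolding x_def by (rule chart_inv, rule chart_inv_in)
  qed
  have zd: "(z has_vector_derivative v t) (at t within {0..\<tau>})" and vd: "(v has_vector_derivative R.spray (z t) (v t)) (at t within {0..\<tau>})"
    if t: "t \<in> {0..\<tau>}" for t
    using has_vector_derivative_within_subset[OF S(2) sub] has_vector_derivative_within_subset[OF S(3) sub] t sub by blast+
  have xd: "((\<lambda>r. snd c (x r)) has_vector_derivative v t) (at t within {0..\<tau>})" if t: "t \<in> {0..\<tau>}" for t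
    by (rule has_vector_derivative_transform[OF t _ zd[OF t]]) (rule xz)
  have cz: "continuous_on {0..\<tau>} z" "continuous_on {0..\<tau>} v"
    unfolding continuous_on_eq_continuous_within by (intro ballI has_vector_derivative_continuous, erule zd vd)+
  have zW: "z ` {0..\<tau>} \<subseteq> snd c ` fst c" using S(1) sub by blast
  have ca: "continuous_on {0..\<tau>} (\<lambda>t. R.spray (z t) (v t))" by (rule R.cont_spray[OF cz zW])
  have z2: "Ck_on 2 z {0..\<tau>}" unfolding Ck_on_2_real_iff
    by (rule exI[of _ v], rule exI[of _ "\<lambda>t. R.spray (z t) (v t)"]) (intro conjI ballI zd vd ca)
  have geo: "forward_geodesic X A (randers g \<omega>) {0..\<tau>} x"
    unfolding forward_geodesic_def regular_curve_def
  proof (intro conjI)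
    show "interval {0..\<tau>}" using \<tau> by (simp add: interval_def is_interval_cc)
    show "Ck_map X A 2 {0..\<tau>} x"
      unfolding Ck_map_def
    proof (intro conjI ballI)
      have "continuous_map (top_of_set {0..\<tau>}) (top_of_set (snd c ` fst c)) z"
        unfolding continuous_map_in_subtopology using cz(1) zW by auto
      from continuous_map_compose[OF this cont_chart_inv[OF c]]
      show "continuous_map (top_of_set {0..\<tau>}) X x" by (simp add: x_def[abs_def] o_def)
      fix d assume d: "d \<in> A"
      have "Ck_on 2 (\<lambda>t. transition c d (z t)) ({0..\<tau>} \<inter> x -` fst d)"
      proof (rule Ck_on_compose[OF _ _ trans_Ck[OF c d]])
        show "Ck_on 2 z ({0..\<tau>} \<inter> x -` fst d)" by (rule Ck_on_subset[OF z2]) simp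
        show "z ` ({0..\<tau>} \<inter> x -` fst d) \<subseteq> snd c ` (fst c \<inter> fst d)"
        proof
          fix w assume "w \<in> z ` ({0..\<tau>} \<inter> x -` fst d)"
          then obtain t where t: "t \<in> {0..\<tau>}" "x t \<in> fst d" "w = z t" by blast
          have "w = snd c (x t)" unfolding t(3) xz[OF t(1)] ..
          then show "w \<in> snd c ` (fst c \<inter> fst d)" using xU[OF t(1)] t(2) by blast
        qed
      qed
      then show "Ck_on 2 (snd d \<circ> x) ({0..\<tau>} \<inter> x -` fst d)" by (simp add: transition_def o_def x_def)
    qed
    show "\<forall>t\<in>{0..\<tau>}. velocity A {0..\<tau>} x t \<noteq> (\<lambda>_. 0)"
    proof (intro ballI notI)
      fix t assume t: "t \<in> {0..\<tau>}" and 0: "velocity A {0..\<tau>} x t = (\<lambda>_. 0)"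
      have nb: "at t within {0..\<tau>} \<noteq> bot" using t \<tau> by (simp add: trivial_limit_within islimpt_Icc)
      have "velocity A {0..\<tau>} x t = coord_tvec A c (x t) (v t)"
        by (rule velocity_chart[OF c _ t nb xd[OF t]]) (use xU in blast)
      then have "velocity A {0..\<tau>} x t c = v t" using coord_tvec_apply[OF c xU[OF t]] by simp
      then show False using 0 v0[OF t] by simp
    qed
    show "locally_extremal X A (length_fwd A (randers g \<omega>)) {0..\<tau>} x"
      unfolding locally_extremal_def
    proof (intro ballI exI[of _ 1] conjI impI zero_less_one)
      fix t a b assume "a \<in> {0..\<tau>} \<inter> ball t 1" "b \<in> {0..\<tau>} \<inter> ball t 1" and ab: "a \<le> b"
      then have s: "{a..b} \<subseteq> {0..\<tau>}" by auto
      have "extremal X A (len 1 g \<omega>) a b x"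
      proof (rule EL_imp_extremal[OF c _ ab, of 1 x v "\<lambda>t. R.spray (z t) (v t)"])
        show "x ` {a..b} \<subseteq> fst c" using xU s by blast
        show "continuous_on {a..b} (\<lambda>t. R.spray (z t) (v t))" by (rule continuous_on_subset[OF ca s])
        fix t assume "t \<in> {a..b}"
        then have t: "t \<in> {0..\<tau>}" using s by blast
        show "((\<lambda>r. snd c (x r)) has_vector_derivative v t) (at t within {a..b})"
          by (rule has_vector_derivative_within_subset[OF xd[OF t] s])
        show "(v has_vector_derivative R.spray (z t) (v t)) (at t within {a..b})"
          by (rule has_vector_derivative_within_subset[OF vd[OF t] s])
        show "v t \<noteq> 0" by (rule v0[OF t])
        have "z t \<in> snd c ` fst c" using zW t by blast
        then show "ELc 1 c (snd c (x t)) (v t) (R.spray (z t) (v t)) \<eta> = 0" for \<eta>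
          unfolding xz[OF t] by (rule R.EL_spray[OF _ v0[OF t]])
      qed simp
      then show "extremal X A (length_fwd A (randers g \<omega>)) a b x" by (simp add: len_def)
    qed
  qed
  show thesis
  proof (rule that[OF \<tau>(1) geo])
    show "x ` {0..\<tau>} \<subseteq> fst c" using xU by blast
    show "snd c (x 0) = u" using xz[of 0] \<tau> zv by simp
    show "continuous_on {0..\<tau>} (\<lambda>t. sprayc 1 c (snd c (x t)) (v t))"
      by (rule continuous_on_eq[OF ca]) (simp add: xz)
    show "(v has_vector_derivative sprayc 1 c (snd c (x t)) (v t)) (at t within {0..\<tau>})" if "t \<in> {0..\<tau>}" for t
      using vd[OF that] by (simp only: xz[OF that])
  qed (rule zv xd v0; assumption)+
qed

text \<open>The equation of unparametrized geodesics does not depend on the parametrization, so it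
  can be read off from a reparametrization.\<close>

lemma reparam_geodesic_equation:
  assumes c: "c \<in> A" and s: "s \<in> {1,-1}" and \<tau>: "\<tau> > 0" and xU: "x ` {0..\<tau>} \<subseteq> fst c"
    and z: "\<And>t. t \<in> {0..\<tau>} \<Longrightarrow> ((\<lambda>r. snd c (x r)) has_vector_derivative v t) (at t within {0..\<tau>})"
    and v: "\<And>t. t \<in> {0..\<tau>} \<Longrightarrow> (v has_vector_derivative acc t) (at t within {0..\<tau>})"
    and cacc: "continuous_on {0..\<tau>} acc" and v0: "\<And>t. t \<in> {0..\<tau>} \<Longrightarrow> v t \<noteq> 0"
    and \<sigma>: "orientation_preserving_reparam J {0..\<tau>} \<sigma>"
    and ext: "locally_extremal X A (len s g \<omega>) J (x \<circ> \<sigma>)"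
  shows "\<exists>k. acc 0 + chr c g (snd c (x 0)) (v 0) (v 0) + nr c g (snd c (x 0)) (v 0) *\<^sub>R Jm s c g \<omega> (snd c (x 0)) (v 0) = k *\<^sub>R v 0"
proof -
  interpret R: local_randers "snd c ` fst c" "Gc c g" "G1c c g" "Bc s c \<omega>" "B1c s c \<omega>"
    by (rule local_randers_chart[OF g \<omega> c])
  have intJ: "is_interval J" "interior J \<noteq> {}" and bij: "bij_betw \<sigma> J {0..\<tau>}" and C2: "Ck_on 2 \<sigma> J"
    and pos: "\<And>t. t \<in> J \<Longrightarrow> vector_derivative \<sigma> (at t within J) > 0"
    using \<sigma> unfolding orientation_preserving_reparam_def interval_def by blast+
  have "0 \<in> \<sigma> ` J" using bij \<tau> by (simp add: bij_betw_def)
  then obtain t0 where t0: "t0 \<in> J" "\<sigma> t0 = 0" by auto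
  obtain \<delta> where \<delta>: "\<delta> > 0" "\<And>a b. a \<in> J \<inter> ball t0 \<delta> \<Longrightarrow> b \<in> J \<inter> ball t0 \<delta> \<Longrightarrow> a \<le> b \<Longrightarrow> extremal X A (len s g \<omega>) a b (x \<circ> \<sigma>)"
    using ext t0(1) unfolding locally_extremal_def by blast
  \<comment> \<open>The parameter of the starting point may be an endpoint of \<open>J\<close>, on either side.\<close>
  obtain t1 where t1: "t1 \<in> J" "t1 \<noteq> t0" "t1 \<in> ball t0 \<delta>"
  proof -
    have "\<tau> \<in> \<sigma> ` J" using bij \<tau> by (simp add: bij_betw_def)
    then obtain t2 where t2: "t2 \<in> J" "\<sigma> t2 = \<tau>" by auto
    then have ne: "t2 \<noteq> t0" using t0 \<tau> by auto
    define \<theta> where "\<theta> = min 1 (\<delta> / (2 * \<bar>t2 - t0\<bar>))"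
    have \<theta>: "0 < \<theta>" "\<theta> \<le> 1" using \<delta>(1) ne by (auto simp: \<theta>_def)
    have "\<theta> * \<bar>t2 - t0\<bar> \<le> \<delta> / (2 * \<bar>t2 - t0\<bar>) * \<bar>t2 - t0\<bar>" by (intro mult_right_mono) (auto simp: \<theta>_def)
    also have "\<dots> = \<delta> / 2" using ne by simp
    also have "\<dots> < \<delta>" using \<delta>(1) by simp
    finally have *: "\<theta> * \<bar>t2 - t0\<bar> < \<delta>" .
    have "convex J" using intJ(1) by (rule is_interval_convex)
    from convexD[OF this t0(1) t2(1), of "1 - \<theta>" \<theta>] \<theta>
    have "t0 + \<theta> * (t2 - t0) \<in> J" by (simp add: algebra_simps)
    moreover have "t0 + \<theta> * (t2 - t0) \<noteq> t0" using \<theta> ne by simp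
    moreover have "t0 + \<theta> * (t2 - t0) \<in> ball t0 \<delta>" using * \<theta> by (simp add: dist_real_def abs_mult)
    ultimately show thesis using that by blast
  qed
  define a where "a = min t0 t1"
  define b where "b = max t0 t1"
  have ab: "a < b" "t0 \<in> {a..b}" using t1(2) by (auto simp: a_def b_def)
  have aJ: "a \<in> J \<inter> ball t0 \<delta>" "b \<in> J \<inter> ball t0 \<delta>" using t0 t1 \<delta>(1) by (auto simp: a_def b_def min_def max_def)
  have sub: "{a..b} \<subseteq> J"
    using intJ(1) aJ unfolding is_interval_1 by (meson IntE atLeastAtMost_iff subsetI)
  have ext': "extremal X A (len s g \<omega>) a b (x \<circ> \<sigma>)" using \<delta>(2)[OF aJ] ab by simp
  obtain \<sigma>1 \<sigma>2 where s1: "\<And>t. t \<in> J \<Longrightarrow> (\<sigma> has_vector_derivative \<sigma>1 t) (at t within J)"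
    and s2: "\<And>t. t \<in> J \<Longrightarrow> (\<sigma>1 has_vector_derivative \<sigma>2 t) (at t within J)" and cs2: "continuous_on J \<sigma>2"
    using C2 unfolding Ck_on_2_real_iff by blast
  have nb: "at t within J \<noteq> bot" if "t \<in> {a..b}" for t
  proof -
    have "at t within {a..b} \<noteq> bot" using that ab by (simp add: trivial_limit_within islimpt_Icc)
    then show ?thesis using sub at_le by (metis bot.extremum_uniqueI)
  qed
  have s1pos: "\<sigma>1 t > 0" if t: "t \<in> {a..b}" for t
    using pos[of t] vector_derivative_within[OF nb[OF t] s1] t sub by auto
  have \<sigma>I: "\<sigma> t \<in> {0..\<tau>}" if "t \<in> J" for t using bij that by (auto simp: bij_betw_def)
  have chain: "((\<lambda>r. f (\<sigma> r)) has_vector_derivative \<sigma>1 t *\<^sub>R f' (\<sigma> t)) (at t within {a..b})"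
    if t: "t \<in> {a..b}" and f: "\<And>r. r \<in> {0..\<tau>} \<Longrightarrow> (f has_vector_derivative f' r) (at r within {0..\<tau>})"
    for f f' :: "real \<Rightarrow> 'e" and t
  proof -
    have d: "(\<sigma> has_vector_derivative \<sigma>1 t) (at t within {a..b})"
      using has_vector_derivative_within_subset[OF s1 sub] t sub by blast
    have tJ: "t \<in> J" using t sub by blast
    have "\<sigma> ` {a..b} \<subseteq> {0..\<tau>}" using \<sigma>I sub by blast
    then have "(f has_vector_derivative f' (\<sigma> t)) (at (\<sigma> t) within \<sigma> ` {a..b})"
      using has_vector_derivative_within_subset[OF f[OF \<sigma>I[OF tJ]]] by blast
    from vector_diff_chain_within[OF d this] show ?thesis by (simp add: o_def)
  qed
  define w where "w t = \<sigma>1 t *\<^sub>R v (\<sigma> t)" for t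
  define \<alpha> where "\<alpha> t = \<sigma>1 t *\<^sub>R (\<sigma>1 t *\<^sub>R acc (\<sigma> t)) + \<sigma>2 t *\<^sub>R v (\<sigma> t)" for t
  have dy: "((\<lambda>r. snd c ((x \<circ> \<sigma>) r)) has_vector_derivative w t) (at t within {a..b})" if t: "t \<in> {a..b}" for t
    unfolding w_def o_def by (rule chain[OF t z])
  have dw: "(w has_vector_derivative \<alpha> t) (at t within {a..b})" if t: "t \<in> {a..b}" for t
  proof -
    have "(\<sigma>1 has_vector_derivative \<sigma>2 t) (at t within {a..b})"
      using has_vector_derivative_within_subset[OF s2 sub] t sub by blast
    then have "(\<sigma>1 has_field_derivative \<sigma>2 t) (at t within {a..b})"
      by (simp add: has_real_derivative_iff_has_vector_derivative)
    from has_vector_derivative_scaleR[OF this chain[OF t v]]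
    show ?thesis unfolding w_def[abs_def] \<alpha>_def .
  qed
  have cont\<sigma>: "continuous_on {a..b} \<sigma>" using continuous_on_subset[OF Ck_on_imp_continuous_on[OF C2] sub] .
  have im: "\<sigma> ` {a..b} \<subseteq> {0..\<tau>}" using \<sigma>I sub by blast
  have cv: "continuous_on {0..\<tau>} v"
    unfolding continuous_on_eq_continuous_within by (intro ballI has_vector_derivative_continuous, erule v)
  have cs1: "continuous_on J \<sigma>1"
    unfolding continuous_on_eq_continuous_within by (intro ballI has_vector_derivative_continuous, erule s2)
  have c\<alpha>: "continuous_on {a..b} \<alpha>"
    unfolding \<alpha>_def
    by (intro continuous_on_add continuous_on_scaleR continuous_on_subset[OF cs1 sub] continuous_on_subset[OF cs2 sub]
        continuous_on_compose2[OF cacc cont\<sigma> im] continuous_on_compose2[OF cv cont\<sigma> im])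
  have w0: "w t \<noteq> 0" if t: "t \<in> {a..b}" for t
    using s1pos[OF t] v0[OF \<sigma>I] t sub by (auto simp: w_def)
  have EL0: "R.EL (snd c (x 0)) (w t0) (\<alpha> t0) \<eta> = 0" for \<eta>
    using extremal_imp_EL[OF c s ab(1) _ dy dw c\<alpha> w0 ext' ab(2), of \<eta>] xU im t0 by (simp add: image_comp) blast
  define u where "u = snd c (x 0)"
  have "x 0 \<in> fst c" using xU \<tau> by auto
  then have u: "u \<in> snd c ` fst c" unfolding u_def by blast
  define l where "l = \<sigma>1 t0"
  have l: "l > 0" using s1pos[OF ab(2)] by (simp add: l_def)
  have wt: "w t0 = l *\<^sub>R v 0" "\<alpha> t0 = l *\<^sub>R (l *\<^sub>R acc 0) + \<sigma>2 t0 *\<^sub>R v 0" by (simp_all add: w_def \<alpha>_def t0 l_def)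
  have "\<exists>k. \<alpha> t0 + R.chris u (w t0) (w t0) + R.nrm u (w t0) *\<^sub>R R.J u (w t0) = k *\<^sub>R w t0"
    using R.EL_zero_iff[OF u w0[OF ab(2)], of "\<alpha> t0"] EL0 unfolding u_def by blast
  then obtain k where k: "\<alpha> t0 + R.chris u (w t0) (w t0) + R.nrm u (w t0) *\<^sub>R R.J u (w t0) = k *\<^sub>R w t0" by blast
  have ch: "R.chris u (l *\<^sub>R v 0) (l *\<^sub>R v 0) = (l * l) *\<^sub>R R.chris u (v 0) (v 0)"
    by (simp add: linear_scale[OF R.chris_linear[OF u]] R.chris_sym[OF u, of "l *\<^sub>R v 0" "v 0"])
  have nJ: "R.nrm u (l *\<^sub>R v 0) *\<^sub>R R.J u (l *\<^sub>R v 0) = (l * l) *\<^sub>R (R.nrm u (v 0) *\<^sub>R R.J u (v 0))"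
    using l by (simp add: R.nrm_scale[OF u] linear_scale[OF R.J_linear[OF u]] algebra_simps)
  have "(l * l) *\<^sub>R (acc 0 + R.chris u (v 0) (v 0) + R.nrm u (v 0) *\<^sub>R R.J u (v 0)) = (k * l - \<sigma>2 t0) *\<^sub>R v 0"
    using k unfolding wt ch nJ by (simp add: algebra_simps)
  then have "acc 0 + R.chris u (v 0) (v 0) + R.nrm u (v 0) *\<^sub>R R.J u (v 0) = ((k * l - \<sigma>2 t0) / (l * l)) *\<^sub>R v 0"
    using l by (simp add: eq_vector_fraction_iff)
  then show ?thesis unfolding u_def by blast
qed

end

section \<open>The exterior derivative in charts\<close>

context mfd
begin

definition dform :: "('a, 'e) chart \<Rightarrow> ('a, 'e) field1 \<Rightarrow> 'e \<Rightarrow> 'e \<Rightarrow> 'e \<Rightarrow> real" where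
  "dform c \<omega> u v w = frechet_derivative (\<lambda>u. local1 A c \<omega> u w) (at u) v - frechet_derivative (\<lambda>u. local1 A c \<omega> u v) (at u) w"

lemma dB_chart:
  assumes "one_form A \<omega>" "c \<in> A"
  shows "local_form.dB (B1c s c \<omega>) u v w = s * dform c \<omega> u v w"
proof -
  interpret F: local_form "snd c ` fst c" "Bc s c \<omega>" "B1c s c \<omega>" by (rule local_form_chart[OF assms])
  show ?thesis by (simp add: F.dB_def dform_def right_diff_distrib)
qed

text \<open>The terms with second derivatives of the transition map cancel by their symmetry.\<close>

lemma dform_change:
  assumes \<omega>: "one_form A \<omega>" and c: "c \<in> A" "p \<in> fst c" and d: "d \<in> A" "p \<in> fst d"
  shows "dform c \<omega> (snd c p) v w = dform d \<omega> (snd d p) (Dtrans c d p v) (Dtrans c d p w)"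
proof -
  define W where "W = snd c ` (fst c \<inter> fst d)"
  define \<tau> where "\<tau> = transition c d"
  define u0 where "u0 = snd c p"
  have W: "open W" "u0 \<in> W" using open_overlap[OF c(1) d(1)] c d by (auto simp: W_def u0_def)
  have C2: "Ck_on 2 \<tau> W" unfolding \<tau>_def W_def by (rule trans_Ck[OF c(1) d(1)])
  obtain D where D: "\<forall>x\<in>W. (\<tau> has_derivative D x) (at x within W)" "\<forall>v. Ck_on 1 (\<lambda>x. D x v) W"
    using C2 by (auto simp: numeral_2_eq_2)
  have D': "(\<tau> has_derivative D x) (at x)" if "x \<in> W" for x
    using bspec[OF D(1) that] by (simp only: at_within_open[OF that W(1)])
  have "\<exists>E. ((\<lambda>x. D x v) has_derivative E) (at u0)" for v
  proof -
    obtain E where "\<forall>x\<in>W. ((\<lambda>x. D x v) has_derivative E x) (at x within W)" using spec[OF D(2), of v] by auto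
    from bspec[OF this W(2)] show ?thesis by (auto simp only: at_within_open[OF W(2,1)])
  qed
  then obtain E where E: "\<And>v. ((\<lambda>x. D x v) has_derivative E v) (at u0)" by metis
  have Esym: "E v w = E w v" for v w by (rule Ck_on_2_symmetric[OF W C2 D' E E])
  have DD: "D (snd c q) = Dtrans c d q" if "q \<in> fst c" "q \<in> fst d" for q
  proof -
    have "snd c q \<in> W" using that by (auto simp: W_def)
    from has_derivative_unique[OF D'[OF this]] show ?thesis
      using Dtrans[OF c(1) d(1) that] by (simp add: \<tau>_def)
  qed
  interpret Fc: local_form "snd c ` fst c" "Bc 1 c \<omega>" "B1c 1 c \<omega>" by (rule local_form_chart[OF \<omega> c(1)])
  interpret Fd: local_form "snd d ` fst d" "Bc 1 d \<omega>" "B1c 1 d \<omega>" by (rule local_form_chart[OF \<omega> d(1)])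
  have pull: "local1 A c \<omega> u v = local1 A d \<omega> (\<tau> u) (D u v)" if "u \<in> W" for u v
  proof -
    from that obtain q where "u = snd c q" "q \<in> fst c \<inter> fst d" unfolding W_def by (rule imageE)
    then have q: "q \<in> fst c" "q \<in> fst d" "u = snd c q" by blast+
    have eq: "coord_tvec A c q v = coord_tvec A d q (Dtrans c d q v)"
    proof
      fix e show "coord_tvec A c q v e = coord_tvec A d q (Dtrans c d q v) e"
        using Dtrans_chain[OF c(1) q(1) d(1) q(2)] by (simp add: coord_tvec_eq charts_at_iff)
    qed
    have "\<tau> u = snd d q" by (simp add: \<tau>_def q(3) trans_apply[OF c(1) q(1)])
    then show ?thesis
      unfolding local1_def q(3) inv_chart[OF c(1) q(1)] DD[OF q(1,2)] eq by (simp add: inv_chart[OF d(1) q(2)])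
  qed
  have dpull: "B1c 1 c \<omega> u0 h v = B1c 1 d \<omega> (\<tau> u0) (D u0 h) (D u0 v) + Bc 1 d \<omega> (\<tau> u0) (E v h)" for h v
  proof -
    define S where "S = (\<lambda>r. u0 + r *\<^sub>R h) -` W"
    have S: "open S" "0 \<in> S" using W by (auto simp: S_def intro!: open_vimage continuous_intros)
    have line: "((\<lambda>r. u0 + r *\<^sub>R h) has_vector_derivative h) (at 0 within S)"
      by (auto intro!: derivative_eq_intros simp: has_vector_derivative_def)
    have u00: "u0 + 0 *\<^sub>R h = u0" by simp
    have 1: "((\<lambda>r. \<tau> (u0 + r *\<^sub>R h)) has_vector_derivative D u0 h) (at 0 within S)"
      by (rule has_vector_derivative_compose[OF line]) (use D'[OF W(2)] in simp)
    have 2: "((\<lambda>r. D (u0 + r *\<^sub>R h) v) has_vector_derivative E v h) (at 0 within S)"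
      by (rule has_vector_derivative_compose[OF line, of "\<lambda>x. D x v"]) (use E in simp)
    have im: "(\<lambda>r. \<tau> (u0 + r *\<^sub>R h)) ` S \<subseteq> snd d ` fst d"
    proof
      fix y assume "y \<in> (\<lambda>r. \<tau> (u0 + r *\<^sub>R h)) ` S"
      then obtain q where "q \<in> fst c" "q \<in> fst d" "y = \<tau> (snd c q)" by (auto simp: S_def W_def)
      then show "y \<in> snd d ` fst d" by (simp add: \<tau>_def trans_apply[OF c(1)])
    qed
    have 3: "((\<lambda>r. Bc 1 d \<omega> (\<tau> (u0 + r *\<^sub>R h)) (D (u0 + r *\<^sub>R h) v)) has_real_derivative
        B1c 1 d \<omega> (\<tau> u0) (D u0 h) (D u0 v) + Bc 1 d \<omega> (\<tau> u0) (E v h)) (at 0 within S)"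
      using Fd.deriv_B[OF 1 2 S(2) im] by (simp only: u00)
    have 4: "((\<lambda>r. Bc 1 c \<omega> (u0 + r *\<^sub>R h) v) has_real_derivative
        B1c 1 d \<omega> (\<tau> u0) (D u0 h) (D u0 v) + Bc 1 d \<omega> (\<tau> u0) (E v h)) (at 0 within S)"
      by (rule has_field_derivative_transform_within[OF 3 zero_less_one S(2)]) (simp add: pull S_def)
    have u0c: "u0 \<in> snd c ` fst c" using c(2) by (auto simp: u0_def)
    have "((\<lambda>r. Bc 1 c \<omega> (u0 + r *\<^sub>R h) v) has_vector_derivative B1c 1 c \<omega> u0 h v) (at 0 within S)"
      by (rule has_vector_derivative_compose[OF line, of "\<lambda>u. Bc 1 c \<omega> u v"]) (use Fc.fderiv[OF u0c] in \<open>simp only: u00\<close>)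
    then have "((\<lambda>r. Bc 1 c \<omega> (u0 + r *\<^sub>R h) v) has_real_derivative B1c 1 c \<omega> u0 h v) (at 0 within S)"
      by (simp only: has_real_derivative_iff_has_vector_derivative)
    from DERIV_unique[OF this[unfolded at_within_open[OF S(2,1)]] 4[unfolded at_within_open[OF S(2,1)]]]
    show ?thesis .
  qed
  have "\<tau> u0 = snd d p" "D u0 = Dtrans c d p"
    using DD[OF c(2) d(2)] by (simp_all add: \<tau>_def u0_def trans_apply[OF c])
  then show ?thesis
    using dpull[of v w] dpull[of w v] Esym[of v w] unfolding dform_def u0_def[symmetric] by simp
qed

lemma ext_deriv_chart:
  assumes \<omega>: "one_form A \<omega>" and c: "c \<in> A" "p \<in> fst c"
    and \<xi>: "\<xi> \<in> tangent_space A p" and \<eta>: "\<eta> \<in> tangent_space A p"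
  shows "ext_deriv A \<omega> p \<xi> \<eta> = dform c \<omega> (snd c p) (\<xi> c) (\<eta> c)"
proof -
  define d where "d = (SOME d. d \<in> charts_at A p)"
  have "c \<in> charts_at A p" using c by (simp add: charts_at_iff)
  then have "d \<in> charts_at A p" unfolding d_def by (rule someI)
  then have d: "d \<in> A" "p \<in> fst d" by (simp_all add: charts_at_iff)
  have "ext_deriv A \<omega> p \<xi> \<eta> = dform d \<omega> (snd d p) (\<xi> d) (\<eta> d)"
    by (simp add: ext_deriv_def dform_def d_def Let_def)
  then show ?thesis
    unfolding dform_change[OF \<omega> c d] tangent_change[OF c d \<xi>] tangent_change[OF c d \<eta>] .
qed

lemma ext_deriv_chart_all:
  assumes c: "c \<in> A" "p \<in> fst c"
  shows "(\<forall>\<xi>\<in>tangent_space A p. \<forall>\<eta>\<in>tangent_space A p. P (\<xi> c) (\<eta> c)) \<longleftrightarrow> (\<forall>v w. P v w)"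
proof (intro iffI allI ballI)
  fix v w assume "\<forall>\<xi>\<in>tangent_space A p. \<forall>\<eta>\<in>tangent_space A p. P (\<xi> c) (\<eta> c)"
  from bspec[OF bspec[OF this coord_tvec_tangent[OF c, of v]] coord_tvec_tangent[OF c, of w]]
  show "P v w" by (simp only: coord_tvec_apply[OF c])
qed blast

lemma nonclosed_chart:
  assumes \<omega>: "one_form A \<omega>" and c: "c \<in> A" "p \<in> fst c"
  shows "p \<in> nonclosed_locus X A \<omega> \<longleftrightarrow> (\<exists>v w. dform c \<omega> (snd c p) v w \<noteq> 0)"
proof -
  have "p \<in> topspace X" using c topspace_X by blast
  then have "p \<notin> nonclosed_locus X A \<omega> \<longleftrightarrow>
    (\<forall>\<xi>\<in>tangent_space A p. \<forall>\<eta>\<in>tangent_space A p. dform c \<omega> (snd c p) (\<xi> c) (\<eta> c) = 0)"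
    unfolding nonclosed_locus_def using ext_deriv_chart[OF \<omega> c] by auto
  then show ?thesis unfolding ext_deriv_chart_all[OF c, of "\<lambda>v w. dform c \<omega> (snd c p) v w = 0"] by blast
qed

lemma cont_dform:
  assumes \<omega>: "one_form A \<omega>" and c: "c \<in> A"
  shows "continuous_on (snd c ` fst c) (\<lambda>u. dform c \<omega> u v w)"
proof -
  have "Ck_on 2 (\<lambda>u. local1 A c \<omega> u v) (snd c ` fst c)" for v
    using \<omega> c unfolding one_form_def by blast
  from Ck_2_frechet(2)[OF open_W[OF c] this] show ?thesis
    unfolding dform_def by (intro continuous_on_diff)
qed

text \<open>All three exterior derivatives are computed in the same chart, which depends on \<open>p\<close> only.\<close>

lemma ext_deriv_lincomb:
  assumes \<omega>: "one_form A \<omega>" and \<omega>': "one_form A \<omega>'" and p: "p \<in> topspace X"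
  shows "ext_deriv A (\<lambda>p \<xi>. \<omega>' p \<xi> + k * \<omega> p \<xi>) p \<xi> \<eta> = ext_deriv A \<omega>' p \<xi> \<eta> + k * ext_deriv A \<omega> p \<xi> \<eta>"
proof -
  define d where "d = (SOME d. d \<in> charts_at A p)"
  obtain c where "c \<in> charts_at A p" using ex_chart[OF p] by (auto simp: charts_at_iff)
  then have "d \<in> charts_at A p" unfolding d_def by (rule someI)
  then have d: "d \<in> A" "p \<in> fst d" by (simp_all add: charts_at_iff)
  then have u: "snd d p \<in> snd d ` fst d" by blast
  have C2: "Ck_on 2 (\<lambda>u. local1 A d \<omega> u v) (snd d ` fst d)" "Ck_on 2 (\<lambda>u. local1 A d \<omega>' u v) (snd d ` fst d)" for v
    using \<omega> \<omega>' d unfolding one_form_def by blast+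
  have "((\<lambda>u. local1 A d \<omega>' u v + k * local1 A d \<omega> u v) has_derivative
     (\<lambda>h. frechet_derivative (\<lambda>u. local1 A d \<omega>' u v) (at (snd d p)) h + k * frechet_derivative (\<lambda>u. local1 A d \<omega> u v) (at (snd d p)) h)) (at (snd d p))" for v
    by (intro has_derivative_add has_derivative_mult_right Ck_2_frechet(1)[OF open_W[OF d(1)] C2(1) u]
        Ck_2_frechet(1)[OF open_W[OF d(1)] C2(2) u])
  note fd = frechet_derivative_at[OF this]
  have eq: "local1 A d (\<lambda>p \<xi>. \<omega>' p \<xi> + k * \<omega> p \<xi>) u v = local1 A d \<omega>' u v + k * local1 A d \<omega> u v" for u v
    by (simp only: local1_def)
  have fr: "frechet_derivative (\<lambda>u. local1 A d (\<lambda>p \<xi>. \<omega>' p \<xi> + k * \<omega> p \<xi>) u v) (at (snd d p)) h =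
    frechet_derivative (\<lambda>u. local1 A d \<omega>' u v) (at (snd d p)) h + k * frechet_derivative (\<lambda>u. local1 A d \<omega> u v) (at (snd d p)) h" for v h
    unfolding eq fd[symmetric] ..
  show ?thesis
    unfolding ext_deriv_def Let_def d_def[symmetric] fr by (simp add: algebra_simps)
qed

definition homothetic_at :: "('a, 'e) field2 \<Rightarrow> ('a, 'e) field2 \<Rightarrow> real \<Rightarrow> 'a \<Rightarrow> bool" where
  "homothetic_at g g' \<kappa> p \<longleftrightarrow> (\<forall>\<xi>\<in>tangent_space A p. \<forall>\<eta>\<in>tangent_space A p. g' p \<xi> \<eta> = \<kappa> * g p \<xi> \<eta>)"

lemma homothetic_at_chart:
  assumes c: "c \<in> A" "p \<in> fst c"
  shows "homothetic_at g g' \<kappa> p \<longleftrightarrow> (\<forall>v w. Gc c g' (snd c p) v w = \<kappa> * Gc c g (snd c p) v w)"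
proof -
  have "homothetic_at g g' \<kappa> p \<longleftrightarrow> (\<forall>\<xi>\<in>tangent_space A p. \<forall>\<eta>\<in>tangent_space A p.
     Gc c g' (snd c p) (\<xi> c) (\<eta> c) = \<kappa> * Gc c g (snd c p) (\<xi> c) (\<eta> c))"
    unfolding homothetic_at_def using local2_eq[OF c] by simp
  then show ?thesis unfolding ext_deriv_chart_all[OF c, of "\<lambda>v w. Gc c g' (snd c p) v w = \<kappa> * Gc c g (snd c p) v w"] .
qed

lemma homothetic_at_unique:
  assumes g: "riemannian_metric A g" and p: "p \<in> topspace X"
    and "homothetic_at g g' \<kappa> p" "homothetic_at g g' \<kappa>' p"
  shows "\<kappa> = \<kappa>'"
proof -
  obtain c where c: "c \<in> A" "p \<in> fst c" using ex_chart[OF p] by blast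
  interpret local_metric "snd c ` fst c" "Gc c g" "G1c c g" by (rule local_metric_chart[OF g c(1)])
  obtain e :: 'e where e: "e \<noteq> 0" using nonzero_Basis[OF SOME_Basis] by blast
  have "Gc c g (snd c p) e e > 0" using c e by (intro pos) auto
  moreover have "\<kappa> * Gc c g (snd c p) e e = \<kappa>' * Gc c g (snd c p) e e"
    using assms(3,4) unfolding homothetic_at_chart[OF c] by metis
  ultimately show ?thesis by simp
qed

text \<open>Coordinate balls lift to neighbourhoods.\<close>

lemma chart_ball_nhd:
  assumes c: "c \<in> A" "p \<in> fst c" and r: "r > 0"
  obtains N where "openin X N" "p \<in> N" "N \<subseteq> fst c" "\<And>q. q \<in> N \<longleftrightarrow> q \<in> fst c \<and> snd c q \<in> ball (snd c p) r"
proof (rule that)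
  show "openin X {q \<in> fst c. snd c q \<in> ball (snd c p) r}" by (rule openin_preimage[OF c(1) open_ball])
qed (use c r in auto)

end

lemma connectedin_locally_constant:
  assumes S: "connectedin X S" and loc: "\<And>p. p \<in> S \<Longrightarrow> \<exists>N. openin X N \<and> p \<in> N \<and> (\<forall>q\<in>N \<inter> S. P q = P p)"
    and p0: "p0 \<in> S" "P p0" and p: "p \<in> S"
  shows "P p"
proof (rule ccontr)
  assume np: "\<not> P p"
  define E where "E b = \<Union>{N. openin X N \<and> (\<forall>q\<in>N \<inter> S. P q = b)}" for b
  have op: "openin X (E b)" for b unfolding E_def by (rule openin_Union) blast
  have in_E: "q \<in> E (P q)" if q: "q \<in> S" for q
  proof -
    obtain N where "openin X N" "q \<in> N" "\<forall>q'\<in>N \<inter> S. P q' = P q" using loc[OF q] by blast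
    then show ?thesis unfolding E_def by blast
  qed
  have E_in: "P q = b" if "q \<in> E b" "q \<in> S" for q b using that unfolding E_def by blast
  have "S \<subseteq> E True \<union> E False"
  proof
    fix q assume "q \<in> S"
    then show "q \<in> E True \<union> E False" using in_E[of q] by (cases "P q") auto
  qed
  moreover have "E True \<inter> E False \<inter> S = {}" using E_in by blast
  moreover have "E True \<inter> S \<noteq> {}" using in_E[OF p0(1)] p0 by auto
  moreover have "E False \<inter> S \<noteq> {}" using in_E[OF p] p np by auto
  ultimately show False using S op unfolding connectedin by blast
qed

section \<open>Projectively related Randers metrics\<close>

context mfd
begin

text \<open>What it means at a point that the geodesic of the first metric in the direction \<open>\<xi>\<close> is a
  forward (\<open>\<epsilon> = 1\<close>) or a backward (\<open>\<epsilon> = -1\<close>) geodesic of the second one.\<close>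

lemma geodesics_among_pointwise:
  assumes g1: "riemannian_metric A g1" "one_form A \<omega>1" and g2: "riemannian_metric A g2" "one_form A \<omega>2"
    and among: "geodesics_among X A (randers g1 \<omega>1) (randers g2 \<omega>2)"
    and c: "c \<in> A" and u: "u \<in> snd c ` fst c" and \<xi>: "\<xi> \<noteq> 0"
  obtains \<epsilon> where "\<epsilon> \<in> {1,-1}"
    "chr c g2 u \<xi> \<xi> - chr c g1 u \<xi> \<xi> - nr c g1 u \<xi> *\<^sub>R Jm 1 c g1 \<omega>1 u \<xi>
      + \<epsilon> *\<^sub>R (nr c g2 u \<xi> *\<^sub>R Jm 1 c g2 \<omega>2 u \<xi>) \<in> span {\<xi>}"
proof -
  interpret F1: randers_mfd X A g1 \<omega>1 by unfold_locales (rule g1)+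
  interpret F2: randers_mfd X A g2 \<omega>2 by unfold_locales (rule g2)+
  interpret R1: local_randers "snd c ` fst c" "Gc c g1" "G1c c g1" "Bc 1 c \<omega>1" "B1c 1 c \<omega>1"
    by (rule local_randers_chart[OF g1 c])
  obtain \<tau> x v where \<tau>: "\<tau> > 0" and geo: "forward_geodesic X A (randers g1 \<omega>1) {0..\<tau>} x"
    and xU: "x ` {0..\<tau>} \<subseteq> fst c" and x0: "snd c (x 0) = u" "v 0 = \<xi>"
    and xv: "\<And>t. t \<in> {0..\<tau>} \<Longrightarrow> ((\<lambda>r. snd c (x r)) has_vector_derivative v t) (at t within {0..\<tau>})"
    "\<And>t. t \<in> {0..\<tau>} \<Longrightarrow> (v has_vector_derivative R1.spray (snd c (x t)) (v t)) (at t within {0..\<tau>})"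
    "continuous_on {0..\<tau>} (\<lambda>t. R1.spray (snd c (x t)) (v t))"
    "\<And>t. t \<in> {0..\<tau>} \<Longrightarrow> v t \<noteq> 0"
  proof (rule F1.geodesic_exists[OF c u \<xi>])
  qed (rule that; assumption)
  obtain J \<sigma> where \<sigma>: "orientation_preserving_reparam J {0..\<tau>} \<sigma>"
    and fb: "forward_geodesic X A (randers g2 \<omega>2) J (x \<circ> \<sigma>) \<or> backward_geodesic X A (randers g2 \<omega>2) J (x \<circ> \<sigma>)"
    using among geo unfolding geodesics_among_def by blast
  obtain s where s: "s \<in> {1,-1}" and ext: "locally_extremal X A (len s g2 \<omega>2) J (x \<circ> \<sigma>)"
  proof (cases "forward_geodesic X A (randers g2 \<omega>2) J (x \<circ> \<sigma>)")
    case True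
    then have "locally_extremal X A (len 1 g2 \<omega>2) J (x \<circ> \<sigma>)" by (simp add: forward_geodesic_def len_def)
    then show thesis by (rule that[of 1, rotated]) simp
  next
    case False
    then have "backward_geodesic X A (randers g2 \<omega>2) J (x \<circ> \<sigma>)" using fb by blast
    then have "locally_extremal X A (len (-1) g2 \<omega>2) J (x \<circ> \<sigma>)" by (simp add: backward_geodesic_def len_def)
    then show thesis by (rule that[of "-1", rotated]) simp
  qed
  interpret R2: local_randers "snd c ` fst c" "Gc c g2" "G1c c g2" "Bc 1 c \<omega>2" "B1c 1 c \<omega>2"
    by (rule local_randers_chart[OF g2 c])
  interpret R3: local_randers "snd c ` fst c" "Gc c g2" "G1c c g2" "Bc s c \<omega>2" "B1c s c \<omega>2"
    by (rule local_randers_chart[OF g2 c])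
  have J: "R3.J u \<xi> = s *\<^sub>R R2.J u \<xi>"
  proof (rule R2.G_cancel[OF u])
    fix \<eta>
    show "Gc c g2 u (R3.J u \<xi>) \<eta> = Gc c g2 u (s *\<^sub>R R2.J u \<xi>) \<eta>"
      unfolding R3.G_J[OF u] R2.G_lscale[OF u] R2.G_J[OF u] dB_chart[OF g2(2) c] by simp
  qed
  obtain k where "R1.spray u \<xi> + R2.chris u \<xi> \<xi> + R2.nrm u \<xi> *\<^sub>R R3.J u \<xi> = k *\<^sub>R \<xi>"
    using F2.reparam_geodesic_equation[OF c s \<tau> xU xv \<sigma> ext] unfolding x0 by blast
  then have "R2.chris u \<xi> \<xi> - R1.chris u \<xi> \<xi> - R1.nrm u \<xi> *\<^sub>R R1.J u \<xi> + s *\<^sub>R (R2.nrm u \<xi> *\<^sub>R R2.J u \<xi>) = k *\<^sub>R \<xi>"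
    unfolding R1.spray_def J by (simp only: scaleR_left_commute[of s] diff_conv_add_uminus ac_simps)
  then show thesis by (intro that[OF s]) (metis span_scale span_base singletonI)
qed

text \<open>Even and odd part of the resulting relation: the Riemannian metrics are projectively
  equivalent, and where one of the exterior derivatives does not vanish, they are homothetic and the
  exterior derivatives are proportional with the corresponding constant.\<close>

lemma projectively_related_pointwise:
  assumes g: "riemannian_metric A g" "one_form A \<omega>" and g': "riemannian_metric A g'" "one_form A \<omega>'"
    and proj: "pointwise_projectively_related X A (randers g \<omega>) (randers g' \<omega>')"
    and c: "c \<in> A" and u: "u \<in> snd c ` fst c"
  shows "chr c g' u \<xi> \<xi> - chr c g u \<xi> \<xi> \<in> span {\<xi>}"
    and "(\<forall>v w. dform c \<omega> u v w = 0) \<and> (\<forall>v w. dform c \<omega>' u v w = 0) \<or>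
      (\<exists>\<rho>>0. (\<forall>v w. Gc c g' u v w = \<rho> * Gc c g u v w) \<and>
        ((\<forall>v w. dform c \<omega>' u v w = sqrt \<rho> * dform c \<omega> u v w) \<or> (\<forall>v w. dform c \<omega>' u v w = - sqrt \<rho> * dform c \<omega> u v w)))"
proof -
  interpret R: local_randers "snd c ` fst c" "Gc c g" "G1c c g" "Bc 1 c \<omega>" "B1c 1 c \<omega>"
    by (rule local_randers_chart[OF g c])
  interpret R': local_randers "snd c ` fst c" "Gc c g'" "G1c c g'" "Bc 1 c \<omega>'" "B1c 1 c \<omega>'"
    by (rule local_randers_chart[OF g' c])
  have among: "geodesics_among X A (randers g \<omega>) (randers g' \<omega>')" "geodesics_among X A (randers g' \<omega>') (randers g \<omega>)"
    using proj unfolding pointwise_projectively_related_def by blast+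
  define T where "T \<xi> = R'.chris u \<xi> \<xi> - R.chris u \<xi> \<xi>" for \<xi>
  define a where "a \<xi> = R.nrm u \<xi> *\<^sub>R R.J u \<xi>" for \<xi>
  define b where "b \<xi> = R'.nrm u \<xi> *\<^sub>R R'.J u \<xi>" for \<xi>
  have odd: "T (- \<xi>) = T \<xi>" "a (- \<xi>) = - a \<xi>" "b (- \<xi>) = - b \<xi>" for \<xi>
  proof -
    have "R.chris u (- \<xi>) (- \<xi>) = R.chris u \<xi> \<xi>" "R'.chris u (- \<xi>) (- \<xi>) = R'.chris u \<xi> \<xi>"
      using R.chris_sym[OF u, of "- \<xi>" \<xi>] R'.chris_sym[OF u, of "- \<xi>" \<xi>]
      by (simp_all only: linear_neg[OF R.chris_linear[OF u]] linear_neg[OF R'.chris_linear[OF u]] minus_minus)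
    then show "T (- \<xi>) = T \<xi>" by (simp only: T_def)
    have "R.nrm u (- \<xi>) = R.nrm u \<xi>" "R'.nrm u (- \<xi>) = R'.nrm u \<xi>"
      using R.nrm_scale[OF u, of "-1" \<xi>] R'.nrm_scale[OF u, of "-1" \<xi>] by simp_all
    then show "a (- \<xi>) = - a \<xi>" "b (- \<xi>) = - b \<xi>"
      by (simp_all only: a_def b_def linear_neg[OF R.J_linear[OF u]] linear_neg[OF R'.J_linear[OF u]] scaleR_minus_right)
  qed
  have sep: "T \<xi> \<in> span {\<xi>} \<and> (\<exists>\<epsilon>\<in>{1,-1}. a \<xi> - \<epsilon> *\<^sub>R b \<xi> \<in> span {\<xi>})" if \<xi>: "\<xi> \<noteq> 0" for \<xi>
  proof -
    have m\<xi>: "- \<xi> \<noteq> 0" using \<xi> by simp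
    have sp: "span {- \<xi>} = span {\<xi>}" using span_image_scale[of "{\<xi>}" "\<lambda>_. -1"] by simp
    obtain \<epsilon>1 where e1: "\<epsilon>1 \<in> {1,-1}" "T \<xi> - a \<xi> + \<epsilon>1 *\<^sub>R b \<xi> \<in> span {\<xi>}"
      unfolding T_def a_def b_def by (rule geodesics_among_pointwise[OF g g' among(1) c u \<xi>])
    obtain \<epsilon>2 where e2: "\<epsilon>2 \<in> {1,-1}" "T (- \<xi>) - a (- \<xi>) + \<epsilon>2 *\<^sub>R b (- \<xi>) \<in> span {- \<xi>}"
      unfolding T_def a_def b_def by (rule geodesics_among_pointwise[OF g g' among(1) c u m\<xi>])
    obtain \<epsilon>3 where e3: "\<epsilon>3 \<in> {1,-1}" "- T \<xi> - b \<xi> + \<epsilon>3 *\<^sub>R a \<xi> \<in> span {\<xi>}"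
      unfolding T_def a_def b_def minus_diff_eq by (rule geodesics_among_pointwise[OF g' g among(2) c u \<xi>])
    obtain \<epsilon>4 where e4: "\<epsilon>4 \<in> {1,-1}" "- T (- \<xi>) - b (- \<xi>) + \<epsilon>4 *\<^sub>R a (- \<xi>) \<in> span {- \<xi>}"
      unfolding T_def a_def b_def minus_diff_eq by (rule geodesics_among_pointwise[OF g' g among(2) c u m\<xi>])
    have 2: "T \<xi> + a \<xi> - \<epsilon>2 *\<^sub>R b \<xi> \<in> span {\<xi>}" using e2(2) unfolding sp odd by simp
    have 3: "T \<xi> + b \<xi> - \<epsilon>3 *\<^sub>R a \<xi> \<in> span {\<xi>}" using span_neg[OF e3(2)] by (simp add: algebra_simps)
    have 4: "T \<xi> - b \<xi> + \<epsilon>4 *\<^sub>R a \<xi> \<in> span {\<xi>}" using span_neg[OF e4(2)] unfolding sp odd by (simp add: algebra_simps)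
    show ?thesis
      using even_odd_separation[OF e1 e2(1) 2 e3(1) 3 e4(1) 4] by blast
  qed
  show "chr c g' u \<xi> \<xi> - chr c g u \<xi> \<xi> \<in> span {\<xi>}"
  proof (cases "\<xi> = 0")
    case True
    then show ?thesis
      by (simp add: linear_0[OF R.chris_linear[OF u]] linear_0[OF R'.chris_linear[OF u]])
  next
    case False
    then show ?thesis using sep[of \<xi>] unfolding T_def by blast
  qed
  have GJ: "Gc c g u (R.J u v) w = dform c \<omega> u v w" "Gc c g' u (R'.J u v) w = dform c \<omega>' u v w" for v w
    unfolding R.G_J[OF u] R'.G_J[OF u] dB_chart[OF g(2) c] dB_chart[OF g'(2) c] by simp_all
  have dself: "dform c \<omega>0 u v v = 0" for \<omega>0 v by (simp add: dform_def)
  have rel: "\<exists>\<epsilon>\<in>{1,-1}. \<exists>k. sqrt (Gc c g u \<xi> \<xi>) *\<^sub>R R.J u \<xi> - (\<epsilon> * sqrt (Gc c g' u \<xi> \<xi>)) *\<^sub>R R'.J u \<xi> = k *\<^sub>R \<xi>"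
    if \<xi>: "\<xi> \<noteq> 0" for \<xi>
  proof -
    obtain \<epsilon> where e: "\<epsilon> \<in> {1,-1}" "a \<xi> - \<epsilon> *\<^sub>R b \<xi> \<in> span {\<xi>}" using sep[OF \<xi>] by blast
    then obtain k where "a \<xi> - \<epsilon> *\<^sub>R b \<xi> = k *\<^sub>R \<xi>" unfolding span_singleton by blast
    then have "sqrt (Gc c g u \<xi> \<xi>) *\<^sub>R R.J u \<xi> - (\<epsilon> * sqrt (Gc c g' u \<xi> \<xi>)) *\<^sub>R R'.J u \<xi> = k *\<^sub>R \<xi>"
      unfolding a_def b_def R.nrm_def R'.nrm_def scaleR_scaleR .
    then show ?thesis using e(1) by blast
  qed
  show "(\<forall>v w. dform c \<omega> u v w = 0) \<and> (\<forall>v w. dform c \<omega>' u v w = 0) \<or>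
      (\<exists>\<rho>>0. (\<forall>v w. Gc c g' u v w = \<rho> * Gc c g u v w) \<and>
        ((\<forall>v w. dform c \<omega>' u v w = sqrt \<rho> * dform c \<omega> u v w) \<or> (\<forall>v w. dform c \<omega>' u v w = - sqrt \<rho> * dform c \<omega> u v w)))"
    using skew_relation[OF R.bil[OF u] R.sym[OF u] R.pos[OF u] R'.bil[OF u] R'.sym[OF u] R'.pos[OF u]
        R.J_linear[OF u] _ R'.J_linear[OF u] _ rel]
    unfolding GJ dself by blast
qed

end

locale projective_randers = mfd X A for X :: "'a topology" and A :: "('a, 'e::euclidean_space) chart set" +
  fixes g g' :: "('a, 'e) field2" and \<omega> \<omega>' :: "('a, 'e) field1"
  assumes g: "riemannian_metric A g" "one_form A \<omega>" and g': "riemannian_metric A g'" "one_form A \<omega>'"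
    and proj: "pointwise_projectively_related X A (randers g \<omega>) (randers g' \<omega>')"
    and dim: "DIM('e) \<ge> 2"
begin

lemma metric_pair_chart:
  assumes c: "c \<in> A"
  shows "metric_pair (snd c ` fst c) (Gc c g) (G1c c g) (Gc c g') (G1c c g')"
  unfolding metric_pair_def metric_pair_axioms_def
  using local_metric_chart[OF g(1) c] local_metric_chart[OF g'(1) c]
    projectively_related_pointwise(1)[OF g g' proj c] by blast

abbreviation "M0 \<equiv> nonclosed_locus X A \<omega>"

lemma M0_chart:
  assumes c: "c \<in> A" "p \<in> fst c" and p: "p \<in> M0"
  obtains \<rho> where "\<rho> > 0" "homothetic_at g g' \<rho> p"
    "(\<forall>v w. dform c \<omega>' (snd c p) v w = sqrt \<rho> * dform c \<omega> (snd c p) v w) \<or>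
     (\<forall>v w. dform c \<omega>' (snd c p) v w = - sqrt \<rho> * dform c \<omega> (snd c p) v w)"
proof -
  have "snd c p \<in> snd c ` fst c" using c by blast
  from projectively_related_pointwise(2)[OF g g' proj c(1) this] show thesis
    using p that unfolding nonclosed_chart[OF g(2) c] homothetic_at_chart[OF c] by blast
qed

lemma M0_ball:
  assumes c: "c \<in> A" "p \<in> fst c" and p: "p \<in> M0"
  obtains r where "r > 0" "ball (snd c p) r \<subseteq> snd c ` fst c" "\<And>q. q \<in> fst c \<Longrightarrow> snd c q \<in> ball (snd c p) r \<Longrightarrow> q \<in> M0"
proof -
  obtain v w where vw: "dform c \<omega> (snd c p) v w \<noteq> 0" using p nonclosed_chart[OF g(2) c] by blast
  have "open (snd c ` fst c \<inter> (\<lambda>u. dform c \<omega> u v w) -` (- {0}))"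
    by (rule continuous_open_preimage[OF cont_dform[OF g(2) c(1)] open_W[OF c(1)]]) auto
  moreover have "snd c p \<in> snd c ` fst c \<inter> (\<lambda>u. dform c \<omega> u v w) -` (- {0})" using c vw by blast
  ultimately obtain r where r: "r > 0" "ball (snd c p) r \<subseteq> snd c ` fst c \<inter> (\<lambda>u. dform c \<omega> u v w) -` (- {0})"
    by (rule openE)
  show thesis
  proof (rule that[OF r(1)])
    show "ball (snd c p) r \<subseteq> snd c ` fst c" using r(2) by blast
    fix q assume "q \<in> fst c" "snd c q \<in> ball (snd c p) r"
    then show "q \<in> M0" using r(2) nonclosed_chart[OF g(2) c(1), of q] by blast
  qed
qed

text \<open>On the locus where \<open>d\<omega> \<noteq> 0\<close> the metrics are conformal, so the factor is locally constant
  there.\<close>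

lemma homothetic_near_M0:
  assumes p: "p \<in> M0"
  obtains N \<kappa> where "openin X N" "p \<in> N" "\<kappa> > 0" "\<And>q. q \<in> N \<Longrightarrow> homothetic_at g g' \<kappa> q"
proof -
  have pX: "p \<in> topspace X" using p by (simp add: nonclosed_locus_def)
  obtain c where c: "c \<in> A" "p \<in> fst c" using ex_chart[OF pX] by blast
  interpret P: metric_pair "snd c ` fst c" "Gc c g" "G1c c g" "Gc c g'" "G1c c g'" by (rule metric_pair_chart[OF c(1)])
  obtain r where r: "r > 0" "ball (snd c p) r \<subseteq> snd c ` fst c" "\<And>q. q \<in> fst c \<Longrightarrow> snd c q \<in> ball (snd c p) r \<Longrightarrow> q \<in> M0"
    by (rule M0_ball[OF c p]) (rule that; assumption)
  have conf: "\<exists>\<rho>. \<forall>v w. Gc c g' u v w = \<rho> * Gc c g u v w" if u: "u \<in> ball (snd c p) r" for u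
  proof -
    obtain q where q: "q \<in> fst c" "u = snd c q" using u r(2) by blast
    have "q \<in> M0" by (rule r(3)[OF q(1)]) (use q(2) u in simp)
    obtain \<rho> where "homothetic_at g g' \<rho> q" by (rule M0_chart[OF c(1) q(1) \<open>q \<in> M0\<close>])
    then show ?thesis unfolding homothetic_at_chart[OF c(1) q(1)] q(2) by blast
  qed
  obtain \<kappa> where \<kappa>: "\<And>u v w. u \<in> ball (snd c p) r \<Longrightarrow> Gc c g' u v w = \<kappa> * Gc c g u v w"
    by (rule P.conformal_factor_const[OF open_ball r(2) convex_ball conf dim]) (assumption | (rule that; assumption))+
  obtain \<rho> where \<rho>: "\<rho> > 0" "homothetic_at g g' \<rho> p" by (rule M0_chart[OF c p])
  have "homothetic_at g g' \<kappa> p" unfolding homothetic_at_chart[OF c] using \<kappa> r(1) by simp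
  from homothetic_at_unique[OF g(1) pX this \<rho>(2)] have "\<kappa> > 0" using \<rho>(1) by simp
  obtain N where N: "openin X N" "p \<in> N" "\<And>q. q \<in> N \<longleftrightarrow> q \<in> fst c \<and> snd c q \<in> ball (snd c p) r"
    by (rule chart_ball_nhd[OF c r(1)]) (rule that; assumption)
  show thesis
  proof (rule that[OF N(1,2) \<open>\<kappa> > 0\<close>])
    fix q assume "q \<in> N"
    then have q: "q \<in> fst c" "snd c q \<in> ball (snd c p) r" using N(3) by blast+
    show "homothetic_at g g' \<kappa> q" unfolding homothetic_at_chart[OF c(1) q(1)] by (intro allI \<kappa>[OF q(2)])
  qed
qed

text \<open>At each point there is at most one factor, so being homothetic with the factor \<open>\<kappa>\<close> is a
  locally constant property on \<open>M0\<close>.\<close>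

lemma homothetic_M0:
  assumes conn: "connectedin X M0" and ne: "M0 \<noteq> {}"
  obtains \<kappa> where "\<kappa> > 0" "\<And>p. p \<in> M0 \<Longrightarrow> homothetic_at g g' \<kappa> p"
proof -
  obtain p0 where p0: "p0 \<in> M0" using ne by blast
  obtain N0 \<kappa> where \<kappa>: "p0 \<in> N0" "\<kappa> > 0" "\<And>q. q \<in> N0 \<Longrightarrow> homothetic_at g g' \<kappa> q"
    by (rule homothetic_near_M0[OF p0]) (rule that; assumption)
  have "homothetic_at g g' \<kappa> p" if p: "p \<in> M0" for p
  proof (rule connectedin_locally_constant[OF conn _ p0 _ p])
    show "homothetic_at g g' \<kappa> p0" by (rule \<kappa>(3)[OF \<kappa>(1)])
    fix q assume q: "q \<in> M0"
    obtain N \<kappa>' where N: "openin X N" "q \<in> N" "\<And>q. q \<in> N \<Longrightarrow> homothetic_at g g' \<kappa>' q"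
      by (rule homothetic_near_M0[OF q]) (rule that; assumption)
    have iff: "homothetic_at g g' \<kappa> r \<longleftrightarrow> \<kappa> = \<kappa>'" if "r \<in> N" for r
    proof -
      have r: "r \<in> topspace X" using openin_subset[OF N(1)] that by blast
      show ?thesis
      proof
        assume "homothetic_at g g' \<kappa> r"
        then show "\<kappa> = \<kappa>'" by (rule homothetic_at_unique[OF g(1) r _ N(3)[OF that]])
      next
        assume "\<kappa> = \<kappa>'"
        then show "homothetic_at g g' \<kappa> r" using N(3)[OF that] by simp
      qed
    qed
    have "\<forall>r\<in>N \<inter> M0. homothetic_at g g' \<kappa> r = homothetic_at g g' \<kappa> q"
      using iff N(2) by blast
    then show "\<exists>N. openin X N \<and> q \<in> N \<and> (\<forall>r\<in>N \<inter> M0. homothetic_at g g' \<kappa> r = homothetic_at g g' \<kappa> q)"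
      using N(1,2) by blast
  qed
  then show thesis by (rule that[OF \<kappa>(2)])
qed

text \<open>Unique continuation: the interior of the set of homothety is closed, too.\<close>

lemma homothetic_everywhere:
  assumes conn: "connected_space X" and \<kappa>: "\<kappa> > 0"
    and p0: "p0 \<in> N0" "openin X N0" "\<And>q. q \<in> N0 \<Longrightarrow> homothetic_at g g' \<kappa> q" and p: "p \<in> topspace X"
  shows "homothetic_at g g' \<kappa> p"
proof -
  define P where "P q \<longleftrightarrow> (\<exists>N. openin X N \<and> q \<in> N \<and> (\<forall>r\<in>N. homothetic_at g g' \<kappa> r))" for q
  have "P p"
  proof (rule connectedin_locally_constant[of X "topspace X" P p0])
    show "connectedin X (topspace X)" using conn by (simp add: connectedin_topspace)
    show "p0 \<in> topspace X" using p0 openin_subset by blast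
    show "P p0" unfolding P_def using p0 by blast
    show "p \<in> topspace X" by (rule p)
    fix q assume "q \<in> topspace X"
    then obtain c where c: "c \<in> A" "q \<in> fst c" using ex_chart by blast
    interpret P: metric_pair "snd c ` fst c" "Gc c g" "G1c c g" "Gc c g'" "G1c c g'" by (rule metric_pair_chart[OF c(1)])
    have "snd c q \<in> snd c ` fst c" using c by blast
    then obtain d where d: "d > 0" "ball (snd c q) d \<subseteq> snd c ` fst c"
      and propag: "\<And>q' r \<kappa>. q' \<in> ball (snd c q) d \<Longrightarrow> r > 0 \<Longrightarrow> \<kappa> > 0 \<Longrightarrow>
         \<forall>u\<in>ball q' r. \<forall>v w. Gc c g' u v w = \<kappa> * Gc c g u v w \<Longrightarrow>
         \<forall>u\<in>ball (snd c q) d. \<forall>v w. Gc c g' u v w = \<kappa> * Gc c g u v w"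
      by (rule P.homothety_propagation[OF _ dim]) (rule that; assumption)
    obtain N where N: "openin X N" "q \<in> N" "\<And>r. r \<in> N \<longleftrightarrow> r \<in> fst c \<and> snd c r \<in> ball (snd c q) d"
      by (rule chart_ball_nhd[OF c d(1)]) (rule that; assumption)
    have all: "P r'" if r: "r \<in> N" "P r" and r': "r' \<in> N" for r r'
    proof -
      obtain N' where N': "openin X N'" "r \<in> N'" "\<forall>s\<in>N'. homothetic_at g g' \<kappa> s" using r(2) unfolding P_def by blast
      have rc: "r \<in> fst c" "snd c r \<in> ball (snd c q) d" using N(3) r(1) by blast+
      have "open (snd c ` (fst c \<inter> N'))" by (rule open_image[OF c(1) N'(1)])
      moreover have "snd c r \<in> snd c ` (fst c \<inter> N')" using rc N'(2) by blast
      ultimately obtain e where e: "e > 0" "ball (snd c r) e \<subseteq> snd c ` (fst c \<inter> N')" by (rule openE)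
      have hom: "\<forall>u\<in>ball (snd c r) e. \<forall>v w. Gc c g' u v w = \<kappa> * Gc c g u v w"
      proof
        fix u assume "u \<in> ball (snd c r) e"
        then obtain s where s: "s \<in> fst c" "s \<in> N'" "u = snd c s" using e(2) by blast
        then show "\<forall>v w. Gc c g' u v w = \<kappa> * Gc c g u v w" using N'(3) homothetic_at_chart[OF c(1) s(1)] by blast
      qed
      have "homothetic_at g g' \<kappa> s" if "s \<in> N" for s
      proof -
        have s: "s \<in> fst c" "snd c s \<in> ball (snd c q) d" using N(3) that by blast+
        show ?thesis unfolding homothetic_at_chart[OF c(1) s(1)]
          using propag[OF rc(2) e(1) \<kappa> hom] s(2) by blast
      qed
      then show "P r'" unfolding P_def using N(1) r' by blast
    qed
    have "\<forall>r\<in>N \<inter> topspace X. P r = P q" using all N(2) by blast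
    then show "\<exists>N. openin X N \<and> q \<in> N \<and> (\<forall>r\<in>N \<inter> topspace X. P r = P q)" using N(1,2) by blast
  qed
  then show ?thesis unfolding P_def by blast
qed

definition ext_deriv_ratio :: "real \<Rightarrow> 'a \<Rightarrow> bool" where
  "ext_deriv_ratio k p \<longleftrightarrow> (\<forall>\<xi>\<in>tangent_space A p. \<forall>\<eta>\<in>tangent_space A p. ext_deriv A \<omega>' p \<xi> \<eta> = k * ext_deriv A \<omega> p \<xi> \<eta>)"

lemma ext_deriv_ratio_chart:
  assumes c: "c \<in> A" "p \<in> fst c"
  shows "ext_deriv_ratio k p \<longleftrightarrow> (\<forall>v w. dform c \<omega>' (snd c p) v w = k * dform c \<omega> (snd c p) v w)"
proof -
  have "ext_deriv_ratio k p \<longleftrightarrow> (\<forall>\<xi>\<in>tangent_space A p. \<forall>\<eta>\<in>tangent_space A p.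
     dform c \<omega>' (snd c p) (\<xi> c) (\<eta> c) = k * dform c \<omega> (snd c p) (\<xi> c) (\<eta> c))"
    unfolding ext_deriv_ratio_def using ext_deriv_chart[OF g(2) c] ext_deriv_chart[OF g'(2) c] by simp
  then show ?thesis unfolding ext_deriv_chart_all[OF c, of "\<lambda>v w. dform c \<omega>' (snd c p) v w = k * dform c \<omega> (snd c p) v w"] .
qed

text \<open>In a chart, some component of \<open>d\<omega>' + k d\<omega>\<close> is equal to a component of \<open>2 k d\<omega>\<close> at \<open>p\<close>, so it
  does not vanish there, nor in a neighbourhood.\<close>

lemma ext_deriv_ratio_sign_stable:
  assumes p: "p \<in> M0" and k: "k \<noteq> 0" "ext_deriv_ratio k p"
  obtains N where "openin X N" "p \<in> N" "\<And>q. q \<in> N \<Longrightarrow> \<not> ext_deriv_ratio (- k) q"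
proof -
  have pX: "p \<in> topspace X" using p by (simp add: nonclosed_locus_def)
  obtain c where c: "c \<in> A" "p \<in> fst c" using ex_chart[OF pX] by blast
  obtain v w where vw: "dform c \<omega> (snd c p) v w \<noteq> 0" using p nonclosed_chart[OF g(2) c] by blast
  define f where "f u = dform c \<omega>' u v w + k * dform c \<omega> u v w" for u
  have "f (snd c p) = 2 * k * dform c \<omega> (snd c p) v w"
    using k(2) unfolding ext_deriv_ratio_chart[OF c] f_def by simp
  then have f0: "f (snd c p) \<noteq> 0" using k(1) vw by simp
  have "continuous_on (snd c ` fst c) f"
    unfolding f_def by (intro continuous_intros cont_dform g(2) g'(2) c(1))
  from continuous_open_preimage[OF this open_W[OF c(1)], of "- {0}"]
  have "open (snd c ` fst c \<inter> f -` (- {0}))" by auto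
  from openin_preimage[OF c(1) this]
  have "openin X {q \<in> fst c. snd c q \<in> snd c ` fst c \<inter> f -` (- {0})}" .
  then show thesis
  proof (rule that)
    show "p \<in> {q \<in> fst c. snd c q \<in> snd c ` fst c \<inter> f -` (- {0})}" using c f0 by blast
    fix q assume "q \<in> {q \<in> fst c. snd c q \<in> snd c ` fst c \<inter> f -` (- {0})}"
    then have q: "q \<in> fst c" "f (snd c q) \<noteq> 0" by blast+
    show "\<not> ext_deriv_ratio (- k) q"
    proof
      assume "ext_deriv_ratio (- k) q"
      then have "dform c \<omega>' (snd c q) v w = - k * dform c \<omega> (snd c q) v w"
        unfolding ext_deriv_ratio_chart[OF c(1) q(1)] by blast
      then show False using q(2) by (simp add: f_def)
    qed
  qed
qed

text \<open>On \<open>M0\<close> the ratio is \<open>\<surd>\<kappa>\<close> or \<open>-\<surd>\<kappa>\<close>, and which of the two is locally constant. Where \<open>d\<omega>\<close>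
  vanishes, so does \<open>d\<omega>'\<close>, and every ratio is right.\<close>

lemma ext_deriv_ratio_constant:
  assumes conn: "connectedin X M0" and \<kappa>: "\<kappa> > 0" "\<And>p. p \<in> M0 \<Longrightarrow> homothetic_at g g' \<kappa> p"
  obtains s where "s \<in> {1,-1}" "\<And>p. p \<in> topspace X \<Longrightarrow> ext_deriv_ratio (s * sqrt \<kappa>) p"
proof -
  have k0: "sqrt \<kappa> \<noteq> 0" "- sqrt \<kappa> \<noteq> 0" using \<kappa>(1) by auto
  have alt: "ext_deriv_ratio (sqrt \<kappa>) p \<or> ext_deriv_ratio (- sqrt \<kappa>) p" if p: "p \<in> M0" for p
  proof -
    have pX: "p \<in> topspace X" using p by (simp add: nonclosed_locus_def)
    obtain c where c: "c \<in> A" "p \<in> fst c" using ex_chart[OF pX] by blast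
    obtain \<rho> where \<rho>: "homothetic_at g g' \<rho> p" "(\<forall>v w. dform c \<omega>' (snd c p) v w = sqrt \<rho> * dform c \<omega> (snd c p) v w) \<or>
     (\<forall>v w. dform c \<omega>' (snd c p) v w = - sqrt \<rho> * dform c \<omega> (snd c p) v w)" by (rule M0_chart[OF c p])
    have "\<rho> = \<kappa>" by (rule homothetic_at_unique[OF g(1) pX \<rho>(1) \<kappa>(2)[OF p]])
    then show ?thesis using \<rho>(2) unfolding ext_deriv_ratio_chart[OF c] by blast
  qed
  have outside: "ext_deriv_ratio k p" if p: "p \<in> topspace X" "p \<notin> M0" for k p
  proof -
    obtain c where c: "c \<in> A" "p \<in> fst c" using ex_chart[OF p(1)] by blast
    have u: "snd c p \<in> snd c ` fst c" using c by blast
    have 0: "dform c \<omega> (snd c p) v w = 0" for v w using p(2) nonclosed_chart[OF g(2) c] by blast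
    have "dform c \<omega>' (snd c p) v w = 0" for v w
      using projectively_related_pointwise(2)[OF g g' proj c(1) u] unfolding 0 by auto
    then show ?thesis unfolding ext_deriv_ratio_chart[OF c] 0 by simp
  qed
  have near: "\<exists>N. openin X N \<and> q \<in> N \<and> (\<forall>r\<in>N \<inter> M0. ext_deriv_ratio (sqrt \<kappa>) r = ext_deriv_ratio (sqrt \<kappa>) q)" if q: "q \<in> M0" for q
  proof (cases "ext_deriv_ratio (sqrt \<kappa>) q")
    case True
    obtain N where N: "openin X N" "q \<in> N" "\<And>r. r \<in> N \<Longrightarrow> \<not> ext_deriv_ratio (- sqrt \<kappa>) r"
      by (rule ext_deriv_ratio_sign_stable[OF q k0(1) True]) (rule that; assumption)
    then show ?thesis using True alt by blast
  next
    case False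
    then have neg: "ext_deriv_ratio (- sqrt \<kappa>) q" using alt[OF q] by blast
    obtain N where N: "openin X N" "q \<in> N" "\<And>r. r \<in> N \<Longrightarrow> \<not> ext_deriv_ratio (- (- sqrt \<kappa>)) r"
      by (rule ext_deriv_ratio_sign_stable[OF q k0(2) neg]) (rule that; assumption)
    show ?thesis using False N(1,2) N(3)[unfolded minus_minus] by blast
  qed
  show thesis
  proof (cases "\<exists>p0\<in>M0. ext_deriv_ratio (sqrt \<kappa>) p0")
    case True
    then obtain p0 where p0: "p0 \<in> M0" "ext_deriv_ratio (sqrt \<kappa>) p0" by blast
    have "ext_deriv_ratio (sqrt \<kappa>) p" if "p \<in> M0" for p by (rule connectedin_locally_constant[OF conn near p0 that])
    then have "ext_deriv_ratio (1 * sqrt \<kappa>) p" if "p \<in> topspace X" for p using outside[OF that] by (cases "p \<in> M0") auto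
    then show thesis by (intro that[of 1]) auto
  next
    case False
    then have "ext_deriv_ratio (- sqrt \<kappa>) p" if "p \<in> M0" for p using alt that by blast
    then have "ext_deriv_ratio (- 1 * sqrt \<kappa>) p" if "p \<in> topspace X" for p using outside[OF that] by (cases "p \<in> M0") auto
    then show thesis by (intro that[of "- 1"]) auto
  qed
qed

lemma closed_lincomb:
  assumes "\<And>p. p \<in> topspace X \<Longrightarrow> ext_deriv_ratio k p"
  shows "closed_form X A (\<lambda>p \<xi>. \<omega>' p \<xi> + (- k) * \<omega> p \<xi>)"
  unfolding closed_form_def
proof (intro ballI)
  fix p \<xi> \<eta> assume p: "p \<in> topspace X" and t: "\<xi> \<in> tangent_space A p" "\<eta> \<in> tangent_space A p"
  have "ext_deriv A \<omega>' p \<xi> \<eta> = k * ext_deriv A \<omega> p \<xi> \<eta>" using assms[OF p] t unfolding ext_deriv_ratio_def by blast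
  then show "ext_deriv A (\<lambda>p \<xi>. \<omega>' p \<xi> + (- k) * \<omega> p \<xi>) p \<xi> \<eta> = 0"
    unfolding ext_deriv_lincomb[OF g(2) g'(2) p] by simp
qed

end

theorem corollary4:
  fixes X :: "'a topology"
    and A :: "('a, 'e::euclidean_space) chart set"
    and g g' :: "('a, 'e) field2"
    and \<omega> \<omega>' :: "('a, 'e) field1"
  assumes "smooth_manifold X A"
    and "connected_space X"
    and "DIM('e) \<ge> 2"
    and "riemannian_metric A g" and "one_form A \<omega>" and "finsler_metric A (randers g \<omega>)"
    and "riemannian_metric A g'" and "one_form A \<omega>'" and "finsler_metric A (randers g' \<omega>')"
    and "pointwise_projectively_related X A (randers g \<omega>) (randers g' \<omega>')"
    and "connectedin X (nonclosed_locus X A \<omega>)"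
    and "nonclosed_locus X A \<omega> \<noteq> {}"
  shows "\<exists>c::real. c > 0 \<and>
    ((\<forall>p\<in>topspace X. \<forall>\<xi>\<in>tangent_space A p. \<forall>\<eta>\<in>tangent_space A p. g' p \<xi> \<eta> = c\<^sup>2 * g p \<xi> \<eta>) \<and>
       closed_form X A (\<lambda>p \<xi>. \<omega>' p \<xi> - c * \<omega> p \<xi>)
     \<or>
     (\<forall>p\<in>topspace X. \<forall>\<xi>\<in>tangent_space A p. \<forall>\<eta>\<in>tangent_space A p. g' p \<xi> \<eta> = c\<^sup>2 * g p \<xi> \<eta>) \<and>
       closed_form X A (\<lambda>p \<xi>. \<omega>' p \<xi> + c * \<omega> p \<xi>))"
proof -
  interpret projective_randers X A g g' \<omega> \<omega>'
    by unfold_locales (rule assms(1,3-5,7,8,10))+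
  obtain \<kappa> where \<kappa>: "\<kappa> > 0" "\<And>p. p \<in> M0 \<Longrightarrow> homothetic_at g g' \<kappa> p"
    by (rule homothetic_M0[OF assms(11,12)]) (rule that; assumption)
  obtain p0 where p0: "p0 \<in> M0" using assms(12) by blast
  obtain N \<kappa>' where N: "openin X N" "p0 \<in> N" "\<And>q. q \<in> N \<Longrightarrow> homothetic_at g g' \<kappa>' q"
    by (rule homothetic_near_M0[OF p0]) (rule that; assumption)
  have "p0 \<in> topspace X" using openin_subset[OF N(1)] N(2) by blast
  then have eq: "\<kappa>' = \<kappa>" by (rule homothetic_at_unique[OF g(1) _ N(3)[OF N(2)] \<kappa>(2)[OF p0]])
  have hom: "homothetic_at g g' \<kappa> p" if "p \<in> topspace X" for p
    by (rule homothetic_everywhere[OF assms(2) \<kappa>(1) N(2,1) N(3)[unfolded eq] that])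
  define c where "c = sqrt \<kappa>"
  have c: "c > 0" "c\<^sup>2 = \<kappa>" using \<kappa>(1) by (auto simp: c_def)
  have metric: "\<forall>p\<in>topspace X. \<forall>\<xi>\<in>tangent_space A p. \<forall>\<eta>\<in>tangent_space A p. g' p \<xi> \<eta> = c\<^sup>2 * g p \<xi> \<eta>"
    using hom unfolding homothetic_at_def c(2) by blast
  obtain s where s: "s \<in> {1,-1}" "\<And>p. p \<in> topspace X \<Longrightarrow> ext_deriv_ratio (s * sqrt \<kappa>) p"
    by (rule ext_deriv_ratio_constant[OF assms(11) \<kappa>]) (assumption | (rule that; assumption))+
  have cl: "closed_form X A (\<lambda>p \<xi>. \<omega>' p \<xi> + (- (s * c)) * \<omega> p \<xi>)"
    by (rule closed_lincomb[OF s(2)[folded c_def]])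
  have "closed_form X A (\<lambda>p \<xi>. \<omega>' p \<xi> - c * \<omega> p \<xi>) \<or> closed_form X A (\<lambda>p \<xi>. \<omega>' p \<xi> + c * \<omega> p \<xi>)"
  proof (cases "s = 1")
    case True
    then show ?thesis using cl by simp
  next
    case False
    then have "s = -1" using s(1) by simp
    then show ?thesis using cl by simp
  qed
  then show ?thesis using c(1) metric by blast
qed

end
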